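(* Let $m\in\mathbb{Z}\setminus\{0\}$ and $\omega\in\mathbb{R}$. Let $g\in C^\infty([0,\pi])$ satisfy conditions (i)–(iii) of the context, and let $\widetilde H:S^2\to\mathbb{R}$ be of the form $\widetilde H(u)=\widetilde G(d(u))$, where $\widetilde G'(x)=g(x)-\omega\sin x$ on $[0,\pi]$. Then the equation $$u_t=u\times\bigl(\Delta u-\nabla\widetilde H(u)\bigr),\qquad u:\mathbb{R}^2\times\mathbb{R}\to S^2,$$ admits a solution of the form $$u(x,t)=\bigl(\sin h(r)\cos(m\theta+\omega t),\ \sin h(r)\sin(m\theta+\omega t),\ \cos h(r)\bigr)$$ with $h(0)=0$, $\lim_{r\to\infty}h(r)=\pi$ and $0<h(r)<\pi$ on $(0,\infty)$, if and only if the function $G(x)=-\int_x^\pi g(t)\,dt$ satisfies $$0<\int_0^\infty G(\varphi_1(r))\,r\,dr\le\infty,\qquad \varphi_1(r)=2\arctan(r^{|m|}).$$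
   Context: $S^2=\{x\in\mathbb{R}^3:|x|=1\}$; $d(u)$ is the geodesic distance on $S^2$ from $u$ to the north pole $P=(0,0,1)$; $\nabla\widetilde H$ is the gradient of $\widetilde H$ on $S^2$; $\times$ is the cross product in $\mathbb{R}^3$; $(r,\theta)$ are polar coordinates of $x\in\mathbb{R}^2$; $\Delta$ is the Laplacian on $\mathbb{R}^2$. Conditions on $g$: (i) there exists $\xi\in(0,\pi)$ such that $g(0)=g(\xi)=g(\pi)=0$, $g(x)>0$ for $x\in(0,\xi)$ and $g(x)<0$ for $x\in(\xi,\pi)$; (ii) $\int_0^\pi g(x)\,dx>0$; (iii) $g'(\pi)>0$. The integral $\int_0^\infty G(\varphi_1(r))\,r\,dr$ is well defined in $(-\infty,+\infty]$ since $G\ge0$ on $[\xi,\pi]$. *)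

theory Defs
  imports "HOL-Analysis.Analysis"
begin

section \<open>Smooth functions on a closed interval\<close>

text \<open>Derivatives at the end points are one-sided; \<open>D k\<close> is the derivative of order \<open>k\<close>.\<close>

definition smooth_on_Icc :: "real \<Rightarrow> real \<Rightarrow> (real \<Rightarrow> real) \<Rightarrow> bool" where
  "smooth_on_Icc a b f \<longleftrightarrow>
     (\<exists>D :: nat \<Rightarrow> real \<Rightarrow> real. (\<forall>x\<in>{a..b}. D 0 x = f x) \<and>
        (\<forall>k. \<forall>x\<in>{a..b}. (D k has_real_derivative D (Suc k) x) (at x within {a..b})))"


section \<open>Geometry of the unit sphere\<close>

definition north_pole :: "real^3" where
  "north_pole = vector [0, 0, 1]"

definition curve_length :: "(real \<Rightarrow> 'a::real_normed_vector) \<Rightarrow> real" where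
  "curve_length \<gamma> = integral {0..1} (\<lambda>t. norm (vector_derivative \<gamma> (at t)))"

definition sphere_dist :: "'a::euclidean_space \<Rightarrow> 'a \<Rightarrow> real" where
  "sphere_dist x y = Inf {curve_length \<gamma> | \<gamma>. \<gamma> C1_differentiable_on {0..1} \<and>
     \<gamma> ` {0..1} \<subseteq> sphere 0 1 \<and> \<gamma> 0 = x \<and> \<gamma> 1 = y}"

text \<open>The tangent space of the unit sphere at \<open>p\<close> is the orthogonal complement of \<open>p\<close>. The gradient
  is the tangent vector representing the differential of \<open>H\<close>, where \<open>H\<close> is only considered on the
  sphere.\<close>

definition sphere_gradient :: "('a::euclidean_space \<Rightarrow> real) \<Rightarrow> 'a \<Rightarrow> 'a" where
  "sphere_gradient H p =
     (THE v. v \<bullet> p = 0 \<and> (H has_derivative (\<lambda>w. v \<bullet> w)) (at p within sphere 0 1))"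

lemma great_circle_on_sphere:
  fixes p w :: "'a::real_inner"
  assumes "norm p = 1" "norm w = 1" "p \<bullet> w = 0"
  shows "norm (cos t *\<^sub>R p + sin t *\<^sub>R w) = 1"
proof -
  have "p \<bullet> p = 1" "w \<bullet> w = 1" using assms by (simp_all add: dot_square_norm)
  then have "(cos t *\<^sub>R p + sin t *\<^sub>R w) \<bullet> (cos t *\<^sub>R p + sin t *\<^sub>R w) = (cos t)\<^sup>2 + (sin t)\<^sup>2"
    using assms(3) by (simp add: inner_add_left inner_add_right inner_commute power2_eq_square)
  then show ?thesis by (simp add: norm_eq_sqrt_inner)
qed

lemma sphere_gradient_eqI:
  assumes p: "norm p = 1" and v: "v \<bullet> p = 0"
    and der: "(H has_derivative (\<lambda>w. v \<bullet> w)) (at p within sphere 0 1)"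
  shows "sphere_gradient H p = v"
  unfolding sphere_gradient_def
proof (rule the_equality)
  show "v \<bullet> p = 0 \<and> (H has_derivative (\<lambda>w. v \<bullet> w)) (at p within sphere 0 1)"
    using v der by simp
next
  fix v' assume v': "v' \<bullet> p = 0 \<and> (H has_derivative (\<lambda>w. v' \<bullet> w)) (at p within sphere 0 1)"
  show "v' = v"
  proof (rule ccontr)
    assume ne: "v' \<noteq> v"
    define w where "w = (1 / norm (v' - v)) *\<^sub>R (v' - v)"
    have w: "norm w = 1" "p \<bullet> w = 0"
      using ne v v' by (auto simp: w_def inner_diff_right inner_commute)
    define c where "c = (\<lambda>t. cos t *\<^sub>R p + sin t *\<^sub>R w)"
    have c: "(c has_derivative (\<lambda>t. t *\<^sub>R w)) (at 0)"
      unfolding c_def by (auto intro!: derivative_eq_intros)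
    have D: "((H \<circ> c) has_derivative ((\<lambda>x. y \<bullet> x) \<circ> (\<lambda>t. t *\<^sub>R w))) (at 0)"
      if "(H has_derivative (\<lambda>x. y \<bullet> x)) (at p within sphere 0 1)" for y
    proof (rule diff_chain_within[OF c])
      have "c ` UNIV \<subseteq> sphere 0 1" "c 0 = p"
        using great_circle_on_sphere[OF p w] by (auto simp: c_def)
      then show "(H has_derivative (\<lambda>x. y \<bullet> x)) (at (c 0) within range c)"
        using that has_derivative_subset by metis
    qed
    have "((\<lambda>x. v' \<bullet> x) \<circ> (\<lambda>t. t *\<^sub>R w)) = ((\<lambda>x. v \<bullet> x) \<circ> (\<lambda>t::real. t *\<^sub>R w))"
      using has_derivative_unique[OF D D] v' der by blast
    from fun_cong[OF this, of 1] have "(v' - v) \<bullet> w = 0" by (simp add: inner_diff_left)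
    then show False using ne by (simp add: w_def)
  qed
qed

lemma arccos_le_curve_length:
  fixes \<gamma> :: "real \<Rightarrow> 'a::euclidean_space"
  assumes C1: "\<gamma> C1_differentiable_on {0..1}" and sph: "\<gamma> ` {0..1} \<subseteq> sphere 0 1"
  shows "arccos (\<gamma> 0 \<bullet> \<gamma> 1) \<le> curve_length \<gamma>"
proof -
  obtain D where D: "\<And>t. t \<in> {0..1} \<Longrightarrow> (\<gamma> has_vector_derivative D t) (at t)"
    and contD: "continuous_on {0..1} D"
    using C1 unfolding C1_differentiable_on_def by blast
  define x where "x = \<gamma> 0"
  have nx: "norm x = 1" and n\<gamma>: "\<And>t. t \<in> {0..1} \<Longrightarrow> norm (\<gamma> t) = 1"
    using sph by (auto simp: x_def image_subset_iff)
  have bound: "\<bar>x \<bullet> \<gamma> t\<bar> \<le> 1" if "t \<in> {0..1}" for t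
    using Cauchy_Schwarz_ineq2[of x "\<gamma> t"] nx n\<gamma>[OF that] by simp
  have len: "((\<lambda>t. norm (D t)) has_integral curve_length \<gamma>) {0..1}"
  proof -
    have "curve_length \<gamma> = integral {0..1} (\<lambda>t. norm (D t))"
      unfolding curve_length_def by (intro integral_cong) (simp add: vector_derivative_at[OF D])
    moreover have "(\<lambda>t. norm (D t)) integrable_on {0..1}"
      by (intro integrable_continuous_real continuous_on_norm contD)
    ultimately show ?thesis by (simp add: integrable_integral)
  qed
  have tang: "\<gamma> t \<bullet> D t = 0" if t: "t \<in> {0<..<1}" for t
  proof -
    have "((\<lambda>s. \<gamma> s \<bullet> \<gamma> s) has_derivative (\<lambda>h. \<gamma> t \<bullet> (h *\<^sub>R D t) + (h *\<^sub>R D t) \<bullet> \<gamma> t)) (at t)"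
      using D[of t] t by (intro has_derivative_inner) (auto simp: has_vector_derivative_def)
    moreover have "((\<lambda>s. \<gamma> s \<bullet> \<gamma> s) has_derivative (\<lambda>h. 0)) (at t)"
    proof (rule has_derivative_transform_within_open[OF has_derivative_const[of 1]])
      show "open {0<..<1::real}" "t \<in> {0<..<1}" using t by auto
      show "1 = \<gamma> s \<bullet> \<gamma> s" if "s \<in> {0<..<1}" for s
        using n\<gamma>[of s] that by (simp add: dot_square_norm)
    qed
    ultimately have "(\<lambda>h. \<gamma> t \<bullet> (h *\<^sub>R D t) + (h *\<^sub>R D t) \<bullet> \<gamma> t) = (\<lambda>h. 0)"
      by (rule has_derivative_unique)
    from fun_cong[OF this, of 1] show ?thesis by (simp add: inner_commute)
  qed
  have tbound: "\<bar>x \<bullet> D t\<bar> \<le> sqrt (1 - (x \<bullet> \<gamma> t)\<^sup>2) * norm (D t)" if t: "t \<in> {0<..<1}" for t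
  proof -
    have "\<gamma> t \<bullet> \<gamma> t = 1" "x \<bullet> x = 1"
      using n\<gamma>[of t] nx t by (simp_all add: dot_square_norm)
    then have "norm (x - (x \<bullet> \<gamma> t) *\<^sub>R \<gamma> t) = sqrt (1 - (x \<bullet> \<gamma> t)\<^sup>2)"
      by (simp add: norm_eq_sqrt_inner inner_diff_left inner_diff_right inner_commute power2_eq_square)
    moreover have "x \<bullet> D t = (x - (x \<bullet> \<gamma> t) *\<^sub>R \<gamma> t) \<bullet> D t"
      using tang[OF t] by (simp add: inner_diff_left)
    ultimately show ?thesis
      using Cauchy_Schwarz_ineq2[of "x - (x \<bullet> \<gamma> t) *\<^sub>R \<gamma> t" "D t"] by simp
  qed
  have step: "arccos (c * (x \<bullet> \<gamma> 1)) - arccos c \<le> curve_length \<gamma>" if c: "0 \<le> c" "c < 1" for c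
  proof -
    define F where "F = (\<lambda>t. - (c * (x \<bullet> D t)) / sqrt (1 - (c * (x \<bullet> \<gamma> t))\<^sup>2))"
    have lt: "\<bar>c * (x \<bullet> \<gamma> t)\<bar> < 1" if "t \<in> {0..1}" for t
    proof -
      have "\<bar>c * (x \<bullet> \<gamma> t)\<bar> \<le> c * 1"
        unfolding abs_mult using bound[OF that] c by (intro mult_mono) auto
      then show ?thesis using c by simp
    qed
    have der: "((\<lambda>t. arccos (c * (x \<bullet> \<gamma> t))) has_vector_derivative F t) (at t)"
      if t: "t \<in> {0..1}" for t
    proof -
      have "((\<lambda>s. x \<bullet> \<gamma> s) has_real_derivative x \<bullet> D t) (at t)"
        using bounded_linear.has_vector_derivative[OF bounded_linear_inner_right D[OF t], of x]
        by (simp add: has_real_derivative_iff_has_vector_derivative)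
      then have "((\<lambda>s. c * (x \<bullet> \<gamma> s)) has_real_derivative c * (x \<bullet> D t)) (at t)"
        by (rule DERIV_cmult)
      then have "((\<lambda>s. arccos (c * (x \<bullet> \<gamma> s))) has_real_derivative
          inverse (- sqrt (1 - (c * (x \<bullet> \<gamma> t))\<^sup>2)) * (c * (x \<bullet> D t))) (at t)"
        by (rule DERIV_chain2[OF DERIV_arccos, rotated 2]) (use lt[OF t] in auto)
      then show ?thesis
        by (simp add: F_def has_real_derivative_iff_has_vector_derivative field_simps)
    qed
    have "((\<lambda>t. F t) has_integral
        (arccos (c * (x \<bullet> \<gamma> 1)) - arccos (c * (x \<bullet> \<gamma> 0)))) {0..1}"
      using fundamental_theorem_of_calculus[of 0 1 "\<lambda>t. arccos (c * (x \<bullet> \<gamma> t))" F]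
        has_vector_derivative_at_within[OF der] by simp
    then have "((\<lambda>t. if t \<in> {0<..<1} then F t else 0) has_integral
        (arccos (c * (x \<bullet> \<gamma> 1)) - arccos (c * (x \<bullet> \<gamma> 0)))) {0..1}"
      by (rule has_integral_spike_finite[of "{0,1}", rotated 2]) auto
    then have "arccos (c * (x \<bullet> \<gamma> 1)) - arccos (c * (x \<bullet> \<gamma> 0)) \<le> curve_length \<gamma>"
    proof (rule has_integral_le[OF _ len])
      fix t :: real assume "t \<in> {0..1}"
      show "(if t \<in> {0<..<1} then F t else 0) \<le> norm (D t)"
      proof (cases "t \<in> {0<..<1}")
        case True
        then have t: "t \<in> {0..1}" by auto
        have pos: "0 < sqrt (1 - (c * (x \<bullet> \<gamma> t))\<^sup>2)"
          using lt[OF t] by (simp add: abs_square_less_1)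
        have "(c * (x \<bullet> \<gamma> t))\<^sup>2 \<le> (x \<bullet> \<gamma> t)\<^sup>2"
          using c by (simp add: power_mult_distrib mult_left_le_one_le power_le_one)
        then have sq: "sqrt (1 - (x \<bullet> \<gamma> t)\<^sup>2) \<le> sqrt (1 - (c * (x \<bullet> \<gamma> t))\<^sup>2)" by simp
        have "- (c * (x \<bullet> D t)) \<le> c * \<bar>x \<bullet> D t\<bar>"
          using c abs_ge_minus_self[of "c * (x \<bullet> D t)"] by (simp add: abs_mult)
        also have "\<dots> \<le> 1 * \<bar>x \<bullet> D t\<bar>" using c by (intro mult_right_mono) auto
        also have "\<dots> \<le> sqrt (1 - (x \<bullet> \<gamma> t)\<^sup>2) * norm (D t)" using tbound[OF True] by simp
        also have "\<dots> \<le> sqrt (1 - (c * (x \<bullet> \<gamma> t))\<^sup>2) * norm (D t)"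
          using sq by (intro mult_right_mono) auto
        finally have "F t \<le> norm (D t)"
          unfolding F_def pos_divide_le_eq[OF pos] by (simp only: mult.commute)
        then show ?thesis using True by simp
      qed auto
    qed
    moreover have "x \<bullet> \<gamma> 0 = 1" using nx by (simp add: x_def dot_square_norm)
    ultimately show ?thesis by simp
  qed
  define c where "c = (\<lambda>n. real n / real (Suc n))"
  have c: "0 \<le> c n" "c n < 1" for n by (auto simp: c_def)
  have clim: "c \<longlonglongrightarrow> 1" unfolding c_def by (rule LIMSEQ_n_over_Suc_n)
  have lim: "(\<lambda>n. arccos (c n * a)) \<longlonglongrightarrow> arccos a" if a: "\<bar>a\<bar> \<le> 1" for a
  proof (rule continuous_on_tendsto_compose[OF continuous_on_arccos'])
    show "(\<lambda>n. c n * a) \<longlonglongrightarrow> a" using tendsto_mult_right[OF clim, of a] by simp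
    show "a \<in> {-1..1}" using a by auto
    have "\<bar>c n * a\<bar> \<le> 1" for n
      unfolding abs_mult using c[of n] a by (intro mult_le_one) auto
    then show "\<forall>\<^sub>F n in sequentially. c n * a \<in> {-1..1}" by (auto simp: abs_le_iff minus_le_iff)
  qed
  have "(\<lambda>n. arccos (c n * (x \<bullet> \<gamma> 1)) - arccos (c n * 1)) \<longlonglongrightarrow> arccos (x \<bullet> \<gamma> 1) - arccos 1"
    by (intro tendsto_diff lim) (use bound[of 1] in auto)
  then have "arccos (x \<bullet> \<gamma> 1) - arccos 1 \<le> curve_length \<gamma>"
    by (rule LIMSEQ_le_const2) (use step c in auto)
  then show ?thesis by (simp add: x_def)
qed

lemma sphere_dist_eq_arccos:
  fixes x y :: "'a::euclidean_space"
  assumes x: "norm x = 1" and y: "norm y = 1" and dim: "2 \<le> DIM('a)"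
  shows "sphere_dist x y = arccos (x \<bullet> y)"
  unfolding sphere_dist_def
proof (rule cInf_eq_minimum)
  have xy: "\<bar>x \<bullet> y\<bar> \<le> 1" using Cauchy_Schwarz_ineq2[of x y] x y by simp
  define \<theta> where "\<theta> = arccos (x \<bullet> y)"
  have \<theta>: "cos \<theta> = x \<bullet> y" "0 \<le> \<theta>" "\<theta> \<le> pi"
    using xy by (auto simp: \<theta>_def abs_le_iff arccos_lbound arccos_ubound)
  have xx: "x \<bullet> x = 1" "y \<bullet> y = 1" using x y by (simp_all add: dot_square_norm)
  define z where "z = y - (x \<bullet> y) *\<^sub>R x"
  have zz: "x \<bullet> z = 0" by (simp add: z_def inner_diff_right xx)
  have "(norm z)\<^sup>2 = 1 - (x \<bullet> y)\<^sup>2"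
    unfolding power2_norm_eq_inner
    by (simp add: z_def inner_diff_left inner_diff_right xx inner_commute power2_eq_square)
  also have "\<dots> = (sin \<theta>)\<^sup>2" using \<theta>(1) sin_squared_eq[of \<theta>] by simp
  finally have nz: "norm z = sin \<theta>"
    using sin_ge_zero[OF \<theta>(2,3)] by (metis norm_ge_zero power2_eq_imp_eq)
  obtain w where w: "norm w = 1" "x \<bullet> w = 0" "z = sin \<theta> *\<^sub>R w"
  proof (cases "z = 0")
    case True
    obtain v where "v \<noteq> 0" "orthogonal x v" using orthogonal_to_vector_exists[OF dim] by blast
    then show thesis
      using True nz by (intro that[of "v /\<^sub>R norm v"]) (auto simp: orthogonal_def)
  next
    case False
    then have "sin \<theta> \<noteq> 0" using nz by auto
    then show thesis
      using nz zz sin_ge_zero[OF \<theta>(2,3)] by (intro that[of "(1 / sin \<theta>) *\<^sub>R z"]) simp_all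
  qed
  define \<gamma> where "\<gamma> = (\<lambda>t. cos (\<theta> * t) *\<^sub>R x + sin (\<theta> * t) *\<^sub>R w)"
  have d: "(\<gamma> has_vector_derivative \<theta> *\<^sub>R (cos (\<theta> * t + pi/2) *\<^sub>R x + sin (\<theta> * t + pi/2) *\<^sub>R w)) (at t)" for t
    unfolding \<gamma>_def has_vector_derivative_def
    by (auto intro!: derivative_eq_intros simp: cos_add sin_add algebra_simps)
  have "curve_length \<gamma> = integral {0..1} (\<lambda>t::real. \<theta>)"
    unfolding curve_length_def
    by (intro integral_cong)
      (use \<theta> in \<open>simp add: vector_derivative_at[OF d] great_circle_on_sphere[OF x w(1,2)]\<close>)
  then have len: "arccos (x \<bullet> y) = curve_length \<gamma>" by (simp add: \<theta>_def)
  have "\<gamma> C1_differentiable_on {0..1}"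
    unfolding C1_differentiable_on_def
    by (intro exI[of _ "\<lambda>t. \<theta> *\<^sub>R (cos (\<theta> * t + pi/2) *\<^sub>R x + sin (\<theta> * t + pi/2) *\<^sub>R w)"] conjI ballI d
        continuous_intros)
  moreover have "\<gamma> ` {0..1} \<subseteq> sphere 0 1"
    using great_circle_on_sphere[OF x w(1,2)] by (auto simp: \<gamma>_def)
  moreover have "\<gamma> 0 = x" by (simp add: \<gamma>_def)
  moreover have "\<gamma> 1 = y" using \<theta>(1) by (simp add: \<gamma>_def z_def flip: w(3))
  ultimately show "arccos (x \<bullet> y) \<in> {curve_length \<gamma> | \<gamma>. \<gamma> C1_differentiable_on {0..1} \<and>
      \<gamma> ` {0..1} \<subseteq> sphere 0 1 \<and> \<gamma> 0 = x \<and> \<gamma> 1 = y}"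
    using len by blast
next
  show "arccos (x \<bullet> y) \<le> l" if "l \<in> {curve_length \<gamma> | \<gamma>. \<gamma> C1_differentiable_on {0..1} \<and>
      \<gamma> ` {0..1} \<subseteq> sphere 0 1 \<and> \<gamma> 0 = x \<and> \<gamma> 1 = y}" for l
    using that arccos_le_curve_length by blast
qed


section \<open>The evolution equation\<close>

definition partial_derivative ::
    "'a::real_normed_vector \<Rightarrow> ('a \<Rightarrow> 'b::real_normed_vector) \<Rightarrow> 'a \<Rightarrow> 'b" where
  "partial_derivative b f x = vector_derivative (\<lambda>s. f (x + s *\<^sub>R b)) (at 0)"

definition laplacian :: "('a::euclidean_space \<Rightarrow> 'b::real_normed_vector) \<Rightarrow> 'a \<Rightarrow> 'b" where
  "laplacian f x = (\<Sum>b\<in>Basis. partial_derivative b (partial_derivative b f) x)"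

text \<open>Classical regularity: one time derivative and two spatial derivatives, all of them jointly
  continuous. The differentiability clauses are needed because \<^const>\<open>vector_derivative\<close> is
  an arbitrary value where the derivative does not exist.\<close>

definition C21_regular ::
    "('a::euclidean_space \<Rightarrow> real \<Rightarrow> 'b::real_normed_vector) \<Rightarrow> bool" where
  "C21_regular u \<longleftrightarrow>
     continuous_on UNIV (\<lambda>(x, t). u x t) \<and>
     (\<forall>x t. u x differentiable at t) \<and>
     continuous_on UNIV (\<lambda>(x, t). vector_derivative (u x) (at t)) \<and>
     (\<forall>b\<in>Basis.
        (\<forall>x t. (\<lambda>s. u (x + s *\<^sub>R b) t) differentiable at 0) \<and>
        continuous_on UNIV (\<lambda>(x, t). partial_derivative b (\<lambda>y. u y t) x) \<and>
        (\<forall>c\<in>Basis.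
           (\<forall>x t. (\<lambda>s. partial_derivative b (\<lambda>y. u y t) (x + s *\<^sub>R c)) differentiable at 0) \<and>
           continuous_on UNIV
             (\<lambda>(x, t). partial_derivative c (partial_derivative b (\<lambda>y. u y t)) x)))"

definition is_solution :: "(real^3 \<Rightarrow> real) \<Rightarrow> (real^2 \<Rightarrow> real \<Rightarrow> real^3) \<Rightarrow> bool" where
  "is_solution H u \<longleftrightarrow>
     C21_regular u \<and>
     (\<forall>x t. u x t \<in> sphere 0 1) \<and>
     (\<forall>x t. vector_derivative (u x) (at t) =
        cross3 (u x t) (laplacian (\<lambda>y. u y t) x - sphere_gradient H (u x t)))"

text \<open>The quantification over all polar coordinates \<open>r \<ge> 0\<close>, \<open>\<theta>\<close> of a point includes the origin,
  where \<open>\<theta>\<close> is arbitrary.\<close>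

definition has_equivariant_form ::
    "int \<Rightarrow> real \<Rightarrow> (real \<Rightarrow> real) \<Rightarrow> (real^2 \<Rightarrow> real \<Rightarrow> real^3) \<Rightarrow> bool" where
  "has_equivariant_form m \<omega> h u \<longleftrightarrow>
     (\<forall>r \<theta> t. 0 \<le> r \<longrightarrow>
        u (vector [r * cos \<theta>, r * sin \<theta>]) t =
          vector [sin (h r) * cos (of_int m * \<theta> + \<omega> * t),
                  sin (h r) * sin (of_int m * \<theta> + \<omega> * t),
                  cos (h r)])"


section \<open>Integrals with values in the extended reals\<close>

text \<open>Integral of the positive part minus integral of the negative part. This is only meaningful when
  at most one of the two is infinite, as \<open>\<infinity> - \<infinity> = \<infinity>\<close> in \<^typ>\<open>ereal\<close>.\<close>

definition set_integral_ereal :: "'a measure \<Rightarrow> 'a set \<Rightarrow> ('a \<Rightarrow> real) \<Rightarrow> ereal" where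
  "set_integral_ereal M A f =
     enn2ereal (\<integral>\<^sup>+x\<in>A. ennreal (f x) \<partial>M) - enn2ereal (\<integral>\<^sup>+x\<in>A. ennreal (- f x) \<partial>M)"

end

theory Submission
  imports Defs
begin

text \<open>
  With \<open>n = \<bar>m\<bar>\<close>, a solution of the required form is a connecting orbit, from \<open>0\<close> to \<open>\<pi>\<close>, of
  \<open>r (r h')' = n\<^sup>2 sin h cos h + r\<^sup>2 g(h)\<close>. The quantity \<open>Q = (r h')\<^sup>2 - n\<^sup>2 sin\<^sup>2 h\<close> satisfies
  \<open>dQ/dh = 2 r\<^sup>2 g(h)\<close>, and it vanishes identically on the harmonic maps \<open>h(r) = \<phi>\<^sub>1(r / c)\<close>.
  As long as \<open>Q > 0\<close>, \<open>h\<close> rises faster than the harmonic maps. If \<open>R\<close> is the inverse function of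
  \<open>\<phi>\<^sub>1\<close> and the harmonic map is scaled to agree with \<open>h\<close> where \<open>h = \<xi>\<close>, comparing the two gives
  \<open>Q > c\<^sup>2 \<integral>\<^sub>0\<^sup>h 2 R\<^sup>2 g\<close>. This integral becomes negative before \<open>\<pi>\<close> exactly when
  \<open>\<integral> G(\<phi>\<^sub>1(r)) r dr > 0\<close>. If it does not, \<open>Q\<close> stays bounded away from \<open>0\<close>, so \<open>r h'\<close> does too and
  \<open>h\<close> passes \<open>\<pi>\<close>.

  Conversely, take \<open>s = R(h)\<close> as independent variable and write \<open>r = \<surd>A s e\<^bsup>L(s)\<^esup>\<close>. The equation
  becomes a Volterra equation for \<open>L\<close> that has a global solution for every \<open>A > 0\<close>, depending
  continuously on \<open>A\<close>. The set of \<open>A\<close> for which \<open>Q\<close> becomes negative and the set of \<open>A\<close> for which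
  \<open>Q\<close> has a positive limit are open, disjoint and non-empty (small \<open>A\<close>, respectively large \<open>A\<close>),
  so some \<open>A > 0\<close> is in neither; for this \<open>A\<close> the variable \<open>r\<close> exhausts \<open>[0, \<infinity>)\<close>.
\<close>

section \<open>Calculus on the half line\<close>

text \<open>In the variable s the harmonic maps are exactly L = 0, the ratio of Q to n^2 sin^2 h is
  O(s^2) at the start, and replacing it by its positive part makes the equation globally Lipschitz
  on bounded ranges of s, so no solution breaks down before h = \<pi>. As A tends to 0, L tends to 0
  and Q / A to a positive multiple of the integral of t b(t) sin^2 h; this is how a negative value
  of that integral produces undershooting. For large A the radius is large at a fixed height, Q /
  r^2 - 2 G(h) is almost constant from there on, and G(0) < 0 = G(\<pi>) leaves positive energy at
  the end. For the critical A, a bounded r would force Q to be at most a multiple of 1 + cos h,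
  hence the ratio to be bounded near \<pi>, hence r to grow like a power of s, a contradiction. The
  passage to the plane uses v = r^2 with sin h = r^n K(v) and cos h = C(v): the horizontal part of
  the map is then a radial multiple of the harmonic polynomial z^n or its conjugate, and continuity
  of the second derivatives at the origin reduces to limits at v = 0.\<close>

lemma nondecreasing_on_Icc:
  fixes f :: "real \<Rightarrow> real"
  assumes "a \<le> b" "continuous_on {a..b} f"
    and "\<And>x. a < x \<Longrightarrow> x < b \<Longrightarrow> (f has_real_derivative f' x) (at x)"
    and "\<And>x. a < x \<Longrightarrow> x < b \<Longrightarrow> 0 \<le> f' x"
  shows "f a \<le> f b"
  by (rule DERIV_nonneg_imp_increasing_open[OF assms(1) _ assms(2)]) (use assms(3,4) in blast)

lemma increasing_on_Icc:
  fixes f :: "real \<Rightarrow> real"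
  assumes "a < b" "continuous_on {a..b} f"
    and "\<And>x. a < x \<Longrightarrow> x < b \<Longrightarrow> (f has_real_derivative f' x) (at x)"
    and "\<And>x. a < x \<Longrightarrow> x < b \<Longrightarrow> 0 < f' x"
  shows "f a < f b"
  by (rule DERIV_pos_imp_increasing_open[OF assms(1) _ assms(2)]) (use assms(3,4) in blast)

lemma continuous_on_primitive:
  fixes f :: "real \<Rightarrow> real"
  assumes "continuous_on {0..} f"
  shows "continuous_on {0..} (\<lambda>s. integral {0..s} f)"
  unfolding continuous_on_eq_continuous_within
proof
  fix s :: real assume s: "s \<in> {0..}"
  have "continuous_on {0..s+1} (\<lambda>s. integral {0..s} f)"
    by (intro indefinite_integral_continuous_1 integrable_continuous_real continuous_on_subset[OF assms]) auto
  then have "continuous (at s within {0..s+1}) (\<lambda>s. integral {0..s} f)"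
    using s by (auto simp: continuous_on_eq_continuous_within)
  moreover have "at s within {0..} = at s within {0..s+1}"
    by (rule at_within_nhd[of _ "{..<s+1}"]) (use s in auto)
  ultimately show "continuous (at s within {0..}) (\<lambda>s. integral {0..s} f)"
    by (simp add: continuous_within)
qed

lemma DERIV_primitive:
  fixes f :: "real \<Rightarrow> real"
  assumes "continuous_on {0..} f" "0 < s"
  shows "((\<lambda>s. integral {0..s} f) has_real_derivative f s) (at s)"
proof -
  have "((\<lambda>s. integral {0..s} f) has_real_derivative f s) (at s within {0..s+1})"
    by (intro integral_has_real_derivative continuous_on_subset[OF assms(1)]) (use assms(2) in auto)
  moreover have "at s within {0..s+1} = at s"
    by (rule at_within_interior) (use assms(2) in \<open>auto simp: interior_atLeastAtMost_real\<close>)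
  ultimately show ?thesis by simp
qed

text \<open>Both \<open>F\<close> minus and \<open>F\<close> plus the primitive of \<open>f\<close>
  are nondecreasing. The estimates for the Volterra operators below all come from this with an
  explicit \<open>F\<close>.\<close>

lemma abs_primitive_le:
  fixes f F F' :: "real \<Rightarrow> real"
  assumes f: "continuous_on {0..} f" and s: "0 \<le> s" and F: "continuous_on {0..s} F"
    and dF: "\<And>t. 0 < t \<Longrightarrow> t < s \<Longrightarrow> (F has_real_derivative F' t) (at t)"
    and le: "\<And>t. 0 < t \<Longrightarrow> t < s \<Longrightarrow> \<bar>f t\<bar> \<le> F' t"
  shows "\<bar>integral {0..s} f\<bar> \<le> F s - F 0"
proof -
  have c: "continuous_on {0..s} (\<lambda>s. integral {0..s} f)"
    by (rule continuous_on_subset[OF continuous_on_primitive[OF f]]) auto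
  have "(\<lambda>t. F t - integral {0..t} f) 0 \<le> (\<lambda>t. F t - integral {0..t} f) s"
  proof (rule nondecreasing_on_Icc[OF s continuous_on_diff[OF F c]])
    fix t assume t: "0 < t" "t < s"
    show "((\<lambda>t. F t - integral {0..t} f) has_real_derivative F' t - f t) (at t)"
      by (rule DERIV_diff[OF dF[OF t] DERIV_primitive[OF f t(1)]])
    show "0 \<le> F' t - f t" using le[OF t] by simp
  qed
  moreover have "(\<lambda>t. F t + integral {0..t} f) 0 \<le> (\<lambda>t. F t + integral {0..t} f) s"
  proof (rule nondecreasing_on_Icc[OF s continuous_on_add[OF F c]])
    fix t assume t: "0 < t" "t < s"
    show "((\<lambda>t. F t + integral {0..t} f) has_real_derivative F' t + f t) (at t)"
      by (rule DERIV_add[OF dF[OF t] DERIV_primitive[OF f t(1)]])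
    show "0 \<le> F' t + f t" using le[OF t] by simp
  qed
  ultimately show ?thesis by simp
qed

lemma continuous_on_locally_Lipschitz:
  fixes f :: "real \<Rightarrow> real"
  assumes "\<And>M. 0 < M \<Longrightarrow> \<exists>C. \<forall>x\<in>{0<..M}. \<forall>y\<in>{0<..M}. \<bar>f x - f y\<bar> \<le> C * \<bar>x - y\<bar>"
  shows "continuous_on {0<..} f"
proof -
  have "isCont f x" if x: "0 < x" for x
  proof -
    obtain C where C: "\<bar>f u - f v\<bar> \<le> C * \<bar>u - v\<bar>" if "u \<in> {0<..x+1}" "v \<in> {0<..x+1}" for u v
    proof -
      have "0 < x + 1" using x by simp
      from assms[OF this] that show thesis by blast
    qed
    have "(\<bar>C\<bar>)-lipschitz_on {0<..<x+1} f"
    proof (rule lipschitz_onI)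
      show "dist (f u) (f v) \<le> \<bar>C\<bar> * dist u v" if "u \<in> {0<..<x+1}" "v \<in> {0<..<x+1}" for u v
        using order_trans[OF C mult_right_mono[of C "\<bar>C\<bar>" "\<bar>u - v\<bar>"]] that
        by (auto simp: dist_real_def)
    qed auto
    then have "continuous_on {0<..<x+1} f" by (rule lipschitz_on_continuous_on)
    then show ?thesis using x by (simp add: continuous_on_eq_continuous_at)
  qed
  then show ?thesis by (simp add: continuous_on_eq_continuous_at)
qed

section \<open>The weight sin^2 h and the nonlinearity of the integral equation\<close>

definition sin2 :: "nat \<Rightarrow> real \<Rightarrow> real" where
  "sin2 n s = 4 * s ^ (2*n) / (1 + s ^ (2*n))\<^sup>2"

definition psi :: "real \<Rightarrow> real" where
  "psi y = 1 - 1 / sqrt (1 + max 0 y)"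

lemma one_plus_power_pos: "0 < 1 + (s::real) ^ (2*n)"
  by (simp add: add_pos_nonneg power_mult)

lemma one_plus_power_neq: "1 + (s::real) ^ (2*n) \<noteq> 0"
  using one_plus_power_pos[of s n] by linarith

lemma sin2_nonneg: "0 \<le> sin2 n s"
  by (simp add: sin2_def power_mult)

lemma sin2_pos: "0 < s \<Longrightarrow> 0 < sin2 n s"
  using one_plus_power_pos[of s n] by (simp add: sin2_def)

lemma continuous_on_sin2 [continuous_intros]:
  "continuous_on A f \<Longrightarrow> continuous_on A (\<lambda>x. sin2 n (f x))"
  unfolding sin2_def by (intro continuous_intros) (auto simp: one_plus_power_neq)

text \<open>\<open>sin2\<close> increases only up to s = 1, so on [0, R] monotonicity survives only
  up to a factor. The bound allows \<open>sin2 n s\<close> to be pulled out of integrals over [0, s]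
  and cancelled against the denominator of \<open>ratio\<close>.\<close>

lemma sin2_le:
  assumes "0 \<le> t" "t \<le> s" "s \<le> R"
  shows "sin2 n t \<le> (1 + R ^ (2*n))\<^sup>2 * sin2 n s"
proof -
  have "sin2 n t \<le> 4 * t ^ (2*n) / 1"
    unfolding sin2_def using assms by (intro divide_left_mono) (auto simp: one_plus_power_neq)
  also have "\<dots> \<le> 4 * s ^ (2*n)" using assms by (simp add: power_mono)
  also have "\<dots> = (1 + s ^ (2*n))\<^sup>2 * sin2 n s"
    using one_plus_power_neq[of s n] by (simp add: sin2_def)
  also have "\<dots> \<le> (1 + R ^ (2*n))\<^sup>2 * sin2 n s"
    using assms by (intro mult_right_mono power_mono sin2_nonneg add_left_mono) auto
  finally show ?thesis .
qed

lemma psi_nonneg: "0 \<le> psi y"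
  by (simp add: psi_def)

lemma psi_0 [simp]: "psi 0 = 0" by (simp add: psi_def)

text \<open>The positive part is 1-Lipschitz, and 1 / sqrt (1 + v) has slope of size at most 1/2 for
  v \<ge> 0.\<close>

lemma psi_diff: "\<bar>psi x - psi y\<bar> \<le> \<bar>x - y\<bar> / 2"
proof -
  have *: "\<bar>1 / sqrt (1 + v) - 1 / sqrt (1 + w)\<bar> \<le> \<bar>v - w\<bar> / 2" if "0 \<le> v" "0 \<le> w" for v w
  proof -
    have p: "1 \<le> sqrt (1+v)" "1 \<le> sqrt (1+w)" using that by auto
    define P where "P = sqrt (1+v)"
    define Q where "Q = sqrt (1+w)"
    have PQ: "1 \<le> P" "1 \<le> Q" "P\<^sup>2 = 1 + v" "Q\<^sup>2 = 1 + w" using that by (auto simp: P_def Q_def)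
    have "\<bar>1 / P - 1 / Q\<bar> = \<bar>P - Q\<bar> / (P * Q)"
      using PQ by (simp add: field_simps abs_minus_commute flip: abs_mult)
    also have "\<dots> \<le> \<bar>P - Q\<bar> / 1"
      using PQ mult_mono[of 1 P 1 Q] by (intro divide_left_mono) auto
    also have "\<dots> \<le> \<bar>P - Q\<bar> * ((P + Q) / 2)"
      using PQ mult_left_mono[of 1 "(P + Q) / 2" "\<bar>P - Q\<bar>"] by simp
    also have "\<dots> = \<bar>(P - Q) * (P + Q)\<bar> / 2" using PQ by (simp add: abs_mult)
    also have "(P - Q) * (P + Q) = v - w" using PQ by (simp add: algebra_simps power2_eq_square)
    finally show ?thesis by (simp add: P_def Q_def)
  qed
  have "\<bar>psi x - psi y\<bar> \<le> \<bar>max 0 x - max 0 y\<bar> / 2"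
    using *[of "max 0 y" "max 0 x"] by (simp add: psi_def abs_minus_commute)
  also have "\<dots> \<le> \<bar>x - y\<bar> / 2" by simp
  finally show ?thesis .
qed

lemma psi_le: "psi y \<le> \<bar>y\<bar> / 2"
  using psi_diff[of y 0] by simp

lemma continuous_on_psi [continuous_intros]:
  "continuous_on A f \<Longrightarrow> continuous_on A (\<lambda>x. psi (f x))"
  unfolding psi_def by (intro continuous_intros) auto

text \<open>On the nonpositive axis the exponential has slope at most 1, so the constant 2 needs no
  a priori bound on the arguments. This is why the iterates are kept nonpositive.\<close>

lemma exp_diff_le:
  assumes "x \<le> 0" "y \<le> (0::real)"
  shows "\<bar>exp (2 * x) - exp (2 * y)\<bar> \<le> 2 * \<bar>x - y\<bar>"
proof -
  have *: "exp (2 * w) - exp (2 * v) \<le> 2 * (w - v)" if "v \<le> w" "w \<le> 0" for v w :: real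
  proof -
    have "exp (2 * w) * (1 + 2 * (v - w)) \<le> exp (2 * w) * exp (2 * (v - w))"
      by (intro mult_left_mono exp_ge_add_one_self) auto
    also have "\<dots> = exp (2 * v)" by (simp add: algebra_simps flip: exp_add)
    finally have "exp (2 * w) - exp (2 * v) \<le> exp (2 * w) * (2 * (w - v))" by (simp add: algebra_simps)
    also have "\<dots> \<le> 1 * (2 * (w - v))" using that by (intro mult_right_mono) auto
    finally show ?thesis by simp
  qed
  show ?thesis
  proof (cases x y rule: linorder_le_cases)
    case le
    then show ?thesis using *[OF le assms(2)] by simp
  next
    case ge
    then show ?thesis using *[OF ge assms(1)] by simp
  qed
qed

section \<open>A Volterra equation depending on a parameter\<close>

text \<open>
  Here \<open>b = g(h) / sin h\<close> as a function of \<open>s\<close>, \<open>sin2 n s = sin\<^sup>2 h\<close> and \<open>r = \<surd>A s e\<^bsup>L(s)\<^esup>\<close>. The ratio is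
  \<open>Q / (n\<^sup>2 sin\<^sup>2 h)\<close>, and \<open>s L' = - psi (ratio)\<close> says \<open>r h' = n sin h \<surd>(1 + ratio)\<close>; the positive part in \<open>psi\<close>
  extends the equation beyond the zeros of \<open>r h'\<close>.
\<close>

locale volterra =
  fixes n :: nat and b :: "real \<Rightarrow> real" and \<beta> :: real
  assumes n: "1 \<le> n" and b_cont: "continuous_on {0..} b"
    and b_bound: "\<And>s. 0 \<le> s \<Longrightarrow> \<bar>b s\<bar> \<le> \<beta>"
begin

lemma beta_nonneg: "0 \<le> \<beta>" using b_bound[of 0] by simp

text \<open>For a solution L, 2 n A times this is Q: in the variable s one has dh/ds = n sin h / s,
  so dQ/ds = 2 r^2 g(h) dh/ds = 2 n A s exp (2 L) b sin^2 h.\<close>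

definition numer :: "(real \<Rightarrow> real) \<Rightarrow> real \<Rightarrow> real" where
  "numer L s = integral {0..s} (\<lambda>t. t * exp (2 * L t) * b t * sin2 n t)"

definition ratio :: "real \<Rightarrow> (real \<Rightarrow> real) \<Rightarrow> real \<Rightarrow> real" where
  "ratio A L s = 2 * A / n * (numer L s / sin2 n s)"

definition picard_step :: "real \<Rightarrow> (real \<Rightarrow> real) \<Rightarrow> real \<Rightarrow> real" where
  "picard_step A L s = - integral {0..s} (\<lambda>t. psi (ratio A L t) / t)"

text \<open>Chosen so that the ratio is at most A \<open>ratio_const R\<close> s^2 in size on
  [0, R], uniformly over all nonpositive L.\<close>

definition ratio_const :: "real \<Rightarrow> real" where
  "ratio_const R = \<beta> * (1 + R ^ (2*n))\<^sup>2 / n"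

lemma ratio_const_nonneg: "0 \<le> ratio_const R"
  by (simp add: ratio_const_def beta_nonneg)

text \<open>Nonpositivity gives exp (2 L) \<le> 1 and the Lipschitz bound for the exponential. The
  Picard map preserves it because \<open>psi\<close> is nonnegative.\<close>

definition admissible :: "(real \<Rightarrow> real) \<Rightarrow> bool" where
  "admissible L \<longleftrightarrow> continuous_on {0..} L \<and> (\<forall>s\<ge>0. L s \<le> 0)"

lemma continuous_on_integrand:
  "admissible L \<Longrightarrow> continuous_on {0..} (\<lambda>t. t * exp (2 * L t) * b t * sin2 n t)"
  unfolding admissible_def by (intro continuous_intros b_cont) auto

lemma continuous_on_numer: "admissible L \<Longrightarrow> continuous_on {0..} (numer L)"
  unfolding numer_def[abs_def] by (intro continuous_on_primitive continuous_on_integrand)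

lemma integrand_bound:
  assumes "0 \<le> t" "t \<le> s" "s \<le> R"
  shows "\<bar>t * w * b t * sin2 n t\<bar> \<le> (real n * ratio_const R * sin2 n s) * (t * \<bar>w\<bar>)"
proof -
  have "\<bar>t * w * b t * sin2 n t\<bar> = (t * \<bar>w\<bar>) * (\<bar>b t\<bar> * sin2 n t)"
    using assms sin2_nonneg[of n t] by (simp add: abs_mult)
  also have "\<dots> \<le> (t * \<bar>w\<bar>) * (\<beta> * ((1 + R ^ (2*n))\<^sup>2 * sin2 n s))"
    using assms b_bound[of t] sin2_le[OF assms, of n] beta_nonneg sin2_nonneg[of n t]
    by (intro mult_left_mono mult_mono) auto
  also have "\<dots> = (real n * ratio_const R * sin2 n s) * (t * \<bar>w\<bar>)"
    using n by (simp add: ratio_const_def)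
  finally show ?thesis .
qed

lemma numer_le:
  assumes L: "admissible L" and s: "0 \<le> s" "s \<le> R"
  shows "\<bar>numer L s\<bar> \<le> real n * ratio_const R * sin2 n s * s\<^sup>2 / 2"
proof -
  have "\<bar>numer L s\<bar> \<le> (\<lambda>t. (real n * ratio_const R * sin2 n s) * t\<^sup>2 / 2) s - (\<lambda>t. (real n * ratio_const R * sin2 n s) * t\<^sup>2 / 2) 0"
    unfolding numer_def
  proof (rule abs_primitive_le[OF continuous_on_integrand[OF L] s(1), where F' = "\<lambda>t. (real n * ratio_const R * sin2 n s) * t"])
    fix t assume t: "0 < t" "t < s"
    have "\<bar>t * exp (2 * L t) * b t * sin2 n t\<bar> \<le> (real n * ratio_const R * sin2 n s) * (t * \<bar>exp (2 * L t)\<bar>)"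
      by (rule integrand_bound) (use t s in auto)
    also have "\<dots> \<le> (real n * ratio_const R * sin2 n s) * (t * 1)"
      using t L ratio_const_nonneg sin2_nonneg by (intro mult_left_mono) (auto simp: admissible_def)
    finally show "\<bar>t * exp (2 * L t) * b t * sin2 n t\<bar> \<le> (real n * ratio_const R * sin2 n s) * t" by simp
  qed (auto intro!: derivative_eq_intros continuous_intros)
  then show ?thesis by simp
qed

text \<open>Differences are measured against exp (k t), that is in an exponentially weighted sup
  norm. With k large the Picard map contracts in this norm on a whole interval [0, R], so no gluing
  of short intervals is required.\<close>

lemma numer_diff:
  assumes L: "admissible L" "admissible L'" and s: "0 \<le> s" "s \<le> R" and d: "0 \<le> d" "0 \<le> k"
    and le: "\<And>t. 0 \<le> t \<Longrightarrow> t \<le> s \<Longrightarrow> \<bar>L t - L' t\<bar> \<le> d * exp (k * t)"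
  shows "\<bar>numer L s - numer L' s\<bar> \<le> real n * ratio_const R * sin2 n s * s\<^sup>2 * (d * exp (k * s))"
proof -
  note c = continuous_on_integrand[OF L(1)] continuous_on_integrand[OF L(2)]
  have i: "(\<lambda>t. t * exp (2 * L t) * b t * sin2 n t) integrable_on {0..s}"
          "(\<lambda>t. t * exp (2 * L' t) * b t * sin2 n t) integrable_on {0..s}"
    by (intro integrable_continuous_real continuous_on_subset[OF c(1)] continuous_on_subset[OF c(2)]; force)+
  have eq: "numer L s - numer L' s = integral {0..s} (\<lambda>t. t * exp (2 * L t) * b t * sin2 n t - t * exp (2 * L' t) * b t * sin2 n t)"
    unfolding numer_def using i by (simp add: Henstock_Kurzweil_Integration.integral_diff)
  define C where "C = real n * ratio_const R * sin2 n s * (d * exp (k * s))"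
  have "\<bar>numer L s - numer L' s\<bar> \<le> (\<lambda>t. C * t\<^sup>2) s - (\<lambda>t. C * t\<^sup>2) 0"
    unfolding eq
  proof (rule abs_primitive_le[OF continuous_on_diff[OF c] s(1), where F' = "\<lambda>t. C * (2 * t)"])
    fix t assume t: "0 < t" "t < s"
    have "\<bar>t * exp (2 * L t) * b t * sin2 n t - t * exp (2 * L' t) * b t * sin2 n t\<bar>
        = \<bar>t * (exp (2 * L t) - exp (2 * L' t)) * b t * sin2 n t\<bar>" by (simp add: algebra_simps)
    also have "\<dots> \<le> (real n * ratio_const R * sin2 n s) * (t * \<bar>exp (2 * L t) - exp (2 * L' t)\<bar>)"
      by (rule integrand_bound) (use t s in auto)
    also have "\<dots> \<le> (real n * ratio_const R * sin2 n s) * (t * (2 * (d * exp (k * s))))"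
    proof (intro mult_left_mono)
      have "\<bar>exp (2 * L t) - exp (2 * L' t)\<bar> \<le> 2 * \<bar>L t - L' t\<bar>"
        using L t by (intro exp_diff_le) (auto simp: admissible_def)
      also have "\<dots> \<le> 2 * (d * exp (k * t))" using le[of t] t by simp
      also have "\<dots> \<le> 2 * (d * exp (k * s))" using d t by (intro mult_left_mono) (auto intro: mult_left_mono)
      finally show "\<bar>exp (2 * L t) - exp (2 * L' t)\<bar> \<le> 2 * (d * exp (k * s))" .
    qed (use t ratio_const_nonneg sin2_nonneg in auto)
    finally show "\<bar>t * exp (2 * L t) * b t * sin2 n t - t * exp (2 * L' t) * b t * sin2 n t\<bar> \<le> C * (2 * t)"
      by (simp add: C_def mult_ac)
  qed (auto intro!: derivative_eq_intros continuous_intros)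
  then show ?thesis by (simp add: C_def mult_ac)
qed

lemma ratio_0 [simp]: "ratio A L 0 = 0"
  using n by (simp add: ratio_def sin2_def)

lemma ratio_le:
  assumes L: "admissible L" and s: "0 \<le> s" "s \<le> R" and A: "0 \<le> A"
  shows "\<bar>ratio A L s\<bar> \<le> A * ratio_const R * s\<^sup>2"
proof (cases "s = 0")
  case False
  with s sin2_pos have p: "0 < sin2 n s" by auto
  have "\<bar>ratio A L s\<bar> = 2 * A / n * (\<bar>numer L s\<bar> / sin2 n s)"
    using p A by (simp add: ratio_def abs_mult)
  also have "\<dots> \<le> 2 * A / n * ((real n * ratio_const R * sin2 n s * s\<^sup>2 / 2) / sin2 n s)"
    using p A numer_le[OF L s] by (intro mult_left_mono divide_right_mono) auto
  also have "\<dots> = A * ratio_const R * s\<^sup>2" using p n by simp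
  finally show ?thesis .
qed auto

lemma ratio_diff:
  assumes L: "admissible L" "admissible L'" and s: "0 \<le> s" "s \<le> R" and d: "0 \<le> d" "0 \<le> k" and A: "0 \<le> A"
    and le: "\<And>t. 0 \<le> t \<Longrightarrow> t \<le> s \<Longrightarrow> \<bar>L t - L' t\<bar> \<le> d * exp (k * t)"
  shows "\<bar>ratio A L s - ratio A L' s\<bar> \<le> 2 * A * ratio_const R * s\<^sup>2 * (d * exp (k * s))"
proof (cases "s = 0")
  case False
  with s sin2_pos have p: "0 < sin2 n s" by auto
  have "\<bar>ratio A L s - ratio A L' s\<bar> = 2 * A / n * (\<bar>numer L s - numer L' s\<bar> / sin2 n s)"
    using p A by (simp add: ratio_def abs_mult flip: diff_divide_distrib right_diff_distrib)
  also have "\<dots> \<le> 2 * A / n * ((real n * ratio_const R * sin2 n s * s\<^sup>2 * (d * exp (k * s))) / sin2 n s)"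
    using p A numer_diff[OF L s d le] by (intro mult_left_mono divide_right_mono) auto
  also have "\<dots> = 2 * A * ratio_const R * s\<^sup>2 * (d * exp (k * s))" using p n by simp
  finally show ?thesis .
qed auto

lemma continuous_on_ratio:
  assumes L: "admissible L"
  shows "continuous_on {0<..} (ratio A L)"
proof -
  have "continuous_on {0<..} (numer L)" by (rule continuous_on_subset[OF continuous_on_numer[OF L]]) auto
  moreover have "continuous_on {0<..} (sin2 n)" by (intro continuous_intros)
  ultimately show ?thesis
    unfolding ratio_def[abs_def] by (intro continuous_intros) (auto simp: less_imp_neq[OF sin2_pos, symmetric])
qed

text \<open>At t = 0 division by zero yields the value 0, which is the right one:
  \<open>ratio\<close> is O(t^2) and \<open>psi\<close> is at most half the size of its argument, so
  the quotient is O(t).\<close>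

lemma continuous_on_slope:
  assumes L: "admissible L" and A: "0 \<le> A"
  shows "continuous_on {0..} (\<lambda>t. psi (ratio A L t) / t)"
  unfolding continuous_on_eq_continuous_within
proof
  fix s :: real assume "s \<in> {0..}"
  then consider "s = 0" | "0 < s" by fastforce
  then show "continuous (at s within {0..}) (\<lambda>t. psi (ratio A L t) / t)"
  proof cases
    case 1
    have "((\<lambda>t. psi (ratio A L t) / t) \<longlongrightarrow> 0) (at 0 within {0..})"
    proof (rule Lim_null_comparison)
      have "eventually (\<lambda>t::real. t \<in> {..<1}) (at 0 within {0..})"
        unfolding eventually_at_topological by (intro exI[of _ "{..<1}"]) auto
      moreover have "eventually (\<lambda>t::real. t \<in> {0..} \<and> t \<noteq> 0) (at 0 within {0..})"
        by (auto simp: eventually_at_filter)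
      ultimately show "eventually (\<lambda>t. norm (psi (ratio A L t) / t) \<le> A * ratio_const 1 * t / 2) (at 0 within {0..})"
      proof eventually_elim
        case (elim t)
        have "psi (ratio A L t) \<le> (A * ratio_const 1 * t\<^sup>2) / 2"
          using psi_le[of "ratio A L t"] ratio_le[OF L, of t 1 A] elim A by auto
        then show ?case using elim psi_nonneg[of "ratio A L t"] by (simp add: field_simps power2_eq_square)
      qed
      have "((\<lambda>t. A * ratio_const 1 * t / 2) \<longlongrightarrow> A * ratio_const 1 * 0 / 2) (at 0 within {0..})"
        by (intro tendsto_intros) auto
      then show "((\<lambda>t. A * ratio_const 1 * t / 2) \<longlongrightarrow> 0) (at 0 within {0..})" by simp
    qed
    then show ?thesis by (simp add: continuous_within 1)
  next
    case 2
    have "continuous_on {0<..} (\<lambda>t. psi (ratio A L t) / t)"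
      by (intro continuous_intros continuous_on_ratio L) auto
    then have "continuous (at s) (\<lambda>t. psi (ratio A L t) / t)"
      using 2 by (simp add: continuous_on_eq_continuous_at)
    then show ?thesis by (rule continuous_at_imp_continuous_at_within)
  qed
qed

lemma admissible_picard_step:
  assumes L: "admissible L" and A: "0 \<le> A"
  shows "admissible (picard_step A L)"
  unfolding admissible_def
proof (intro conjI allI impI)
  show "continuous_on {0..} (picard_step A L)"
    unfolding picard_step_def[abs_def] by (intro continuous_intros continuous_on_primitive continuous_on_slope L A)
  show "picard_step A L s \<le> 0" if "0 \<le> s" for s
    unfolding picard_step_def using that
    by (simp, intro Henstock_Kurzweil_Integration.integral_nonneg integrable_continuous_real
        continuous_on_subset[OF continuous_on_slope[OF L A]] divide_nonneg_nonneg psi_nonneg) auto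
qed

lemma picard_step_le:
  assumes L: "admissible L" and s: "0 \<le> s" "s \<le> R" and A: "0 \<le> A"
  shows "\<bar>picard_step A L s\<bar> \<le> A * ratio_const R * s\<^sup>2 / 4"
proof -
  have "\<bar>integral {0..s} (\<lambda>t. psi (ratio A L t) / t)\<bar> \<le> (\<lambda>t. A * ratio_const R * t\<^sup>2 / 4) s - (\<lambda>t. A * ratio_const R * t\<^sup>2 / 4) 0"
  proof (rule abs_primitive_le[OF continuous_on_slope[OF L A] s(1), where F' = "\<lambda>t. A * ratio_const R * t / 2"])
    fix t assume t: "0 < t" "t < s"
    have "psi (ratio A L t) \<le> (A * ratio_const R * t\<^sup>2) / 2"
      using psi_le[of "ratio A L t"] ratio_le[OF L, of t R A] t s A by auto
    then show "\<bar>psi (ratio A L t) / t\<bar> \<le> A * ratio_const R * t / 2"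
      using t psi_nonneg[of "ratio A L t"] by (simp add: field_simps power2_eq_square)
  qed (auto intro!: derivative_eq_intros continuous_intros)
  then show ?thesis by (simp add: picard_step_def)
qed

text \<open>Integrating k exp (k t) gives back exp (k t), a gain of 1 / k against the Lipschitz
  constant A' \<open>ratio_const R\<close> R; the lower bound on k turns this into the contraction
  factor 1/2. The upper bound \<open>A'\<close> lets one k serve a whole range of
  parameters.\<close>

lemma picard_step_diff:
  assumes L: "admissible L" "admissible L'" and s: "0 \<le> s" "s \<le> R" and d: "0 \<le> d" "0 < k"
    and A: "0 \<le> A" "A \<le> A'" and k: "2 * (A' * ratio_const R * R) \<le> k"
    and le: "\<And>t. 0 \<le> t \<Longrightarrow> t \<le> s \<Longrightarrow> \<bar>L t - L' t\<bar> \<le> d * exp (k * t)"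
  shows "\<bar>picard_step A L s - picard_step A L' s\<bar> \<le> d * exp (k * s) / 2"
proof -
  note c = continuous_on_slope[OF L(1) A(1)] continuous_on_slope[OF L(2) A(1)]
  have i: "(\<lambda>t. psi (ratio A L t) / t) integrable_on {0..s}" "(\<lambda>t. psi (ratio A L' t) / t) integrable_on {0..s}"
    by (intro integrable_continuous_real continuous_on_subset[OF c(1)] continuous_on_subset[OF c(2)]; force)+
  have eq: "- (picard_step A L s - picard_step A L' s) = integral {0..s} (\<lambda>t. psi (ratio A L t) / t - psi (ratio A L' t) / t)"
    unfolding picard_step_def using i by (simp add: Henstock_Kurzweil_Integration.integral_diff)
  have "\<bar>- (picard_step A L s - picard_step A L' s)\<bar> \<le> (\<lambda>t. d * exp (k * t) / 2) s - (\<lambda>t. d * exp (k * t) / 2) 0"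
    unfolding eq
  proof (rule abs_primitive_le[OF continuous_on_diff[OF c] s(1), where F' = "\<lambda>t. d * (k * exp (k * t)) / 2"])
    fix t assume t: "0 < t" "t < s"
    have "\<bar>psi (ratio A L t) / t - psi (ratio A L' t) / t\<bar> = \<bar>psi (ratio A L t) - psi (ratio A L' t)\<bar> / t"
      using t by (simp flip: diff_divide_distrib)
    also have "\<dots> \<le> (\<bar>ratio A L t - ratio A L' t\<bar> / 2) / t"
      using t psi_diff by (intro divide_right_mono) auto
    also have "\<dots> \<le> ((2 * A * ratio_const R * t\<^sup>2 * (d * exp (k * t))) / 2) / t"
      using t s d A le by (intro divide_right_mono ratio_diff L) auto
    also have "\<dots> = (A * ratio_const R * t) * (d * exp (k * t))" using t by (simp add: power2_eq_square)
    also have "\<dots> \<le> (A' * ratio_const R * R) * (d * exp (k * t))"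
      using t s d A ratio_const_nonneg[of R] by (intro mult_right_mono mult_mono) auto
    also have "\<dots> \<le> (k / 2) * (d * exp (k * t))"
      using k d by (intro mult_right_mono) auto
    finally show "\<bar>psi (ratio A L t) / t - psi (ratio A L' t) / t\<bar> \<le> d * (k * exp (k * t)) / 2" by (simp add: mult_ac)
  qed (use d in \<open>auto intro!: derivative_eq_intros continuous_intros\<close>)
  then have "\<bar>picard_step A L s - picard_step A L' s\<bar> \<le> d * exp (k * s) / 2 - d / 2"
    by (simp add: abs_minus_commute)
  then show ?thesis using d by linarith
qed

text \<open>For fixed L the ratio is linear in the parameter, so the difference of two ratios is A -
  B times the ratio at parameter 1, which \<open>ratio_le\<close> controls.\<close>

lemma picard_step_param_diff:
  assumes L: "admissible L" and s: "0 \<le> s" "s \<le> R" and A: "0 \<le> A" "0 \<le> B"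
  shows "\<bar>picard_step A L s - picard_step B L s\<bar> \<le> \<bar>A - B\<bar> * (ratio_const R * R\<^sup>2)"
proof -
  note c = continuous_on_slope[OF L A(1)] continuous_on_slope[OF L A(2)]
  have i: "(\<lambda>t. psi (ratio A L t) / t) integrable_on {0..s}" "(\<lambda>t. psi (ratio B L t) / t) integrable_on {0..s}"
    by (intro integrable_continuous_real continuous_on_subset[OF c(1)] continuous_on_subset[OF c(2)]; force)+
  have eq: "- (picard_step A L s - picard_step B L s) = integral {0..s} (\<lambda>t. psi (ratio A L t) / t - psi (ratio B L t) / t)"
    unfolding picard_step_def using i by (simp add: Henstock_Kurzweil_Integration.integral_diff)
  have "\<bar>- (picard_step A L s - picard_step B L s)\<bar> \<le> (\<lambda>t. \<bar>A - B\<bar> * ratio_const R * t\<^sup>2) s - (\<lambda>t. \<bar>A - B\<bar> * ratio_const R * t\<^sup>2) 0"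
    unfolding eq
  proof (rule abs_primitive_le[OF continuous_on_diff[OF c] s(1), where F' = "\<lambda>t. \<bar>A - B\<bar> * ratio_const R * (2 * t)"])
    fix t assume t: "0 < t" "t < s"
    have "\<bar>ratio A L t - ratio B L t\<bar> = \<bar>(A - B) * ratio 1 L t\<bar>"
      by (simp add: ratio_def algebra_simps diff_divide_distrib)
    also have "\<dots> \<le> \<bar>A - B\<bar> * (1 * ratio_const R * t\<^sup>2)"
      unfolding abs_mult using t s L by (intro mult_left_mono ratio_le) auto
    finally have r: "\<bar>ratio A L t - ratio B L t\<bar> \<le> \<bar>A - B\<bar> * ratio_const R * t\<^sup>2" by simp
    have "\<bar>psi (ratio A L t) / t - psi (ratio B L t) / t\<bar> = \<bar>psi (ratio A L t) - psi (ratio B L t)\<bar> / t"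
      using t by (simp flip: diff_divide_distrib)
    also have "\<dots> \<le> (2 * (\<bar>A - B\<bar> * ratio_const R * t\<^sup>2)) / t"
      using t order_trans[OF psi_diff[of "ratio A L t" "ratio B L t"], of "2 * (\<bar>A - B\<bar> * ratio_const R * t\<^sup>2)"] r
      by (intro divide_right_mono) auto
    also have "\<dots> = \<bar>A - B\<bar> * ratio_const R * (2 * t)" using t by (simp add: power2_eq_square)
    finally show "\<bar>psi (ratio A L t) / t - psi (ratio B L t) / t\<bar> \<le> \<bar>A - B\<bar> * ratio_const R * (2 * t)" .
  qed (auto intro!: derivative_eq_intros continuous_intros)
  then have "\<bar>picard_step A L s - picard_step B L s\<bar> \<le> \<bar>A - B\<bar> * (ratio_const R * s\<^sup>2)" by simp
  also have "\<dots> \<le> \<bar>A - B\<bar> * (ratio_const R * R\<^sup>2)"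
    using s ratio_const_nonneg[of R] by (intro mult_left_mono power_mono) auto
  finally show ?thesis .
qed

section \<open>Picard iteration and its limit\<close>

definition picard :: "real \<Rightarrow> nat \<Rightarrow> real \<Rightarrow> real" where
  "picard A j = (picard_step A ^^ j) (\<lambda>_. 0)"

text \<open>The limit of the Picard iterates, written as a telescoping series so that the
  Weierstrass M-test applies.\<close>

definition sol :: "real \<Rightarrow> real \<Rightarrow> real" where
  "sol A s = (\<Sum>i. picard A (Suc i) s - picard A i s)"

lemma picard_Suc: "picard A (Suc j) = picard_step A (picard A j)" and picard_0: "picard A 0 = (\<lambda>_. 0)"
  by (simp_all add: picard_def)

lemma admissible_picard: "0 \<le> A \<Longrightarrow> admissible (picard A j)"
proof (induction j)
  case 0 then show ?case by (auto simp: picard_0 admissible_def)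
qed (simp add: picard_Suc admissible_picard_step)

text \<open>An exponent k meeting the requirement of \<open>picard_step_diff\<close> for all
  parameters up to M; the added 1 keeps it positive even when M or R is 0.\<close>

definition rate :: "real \<Rightarrow> real \<Rightarrow> real" where
  "rate M R = 2 * (M * ratio_const R * R) + 1"

lemma rate_pos: "0 \<le> M \<Longrightarrow> 0 \<le> R \<Longrightarrow> 0 < rate M R"
  using ratio_const_nonneg[of R] by (simp add: rate_def add_nonneg_pos)

text \<open>The first increment is at most A \<open>ratio_const R\<close> R^2 / 4, and the
  contraction halves every later one in the weighted norm.\<close>

lemma picard_Suc_diff:
  assumes A: "0 \<le> A"
  shows "0 \<le> s \<Longrightarrow> s \<le> R \<Longrightarrow> \<bar>picard A (Suc j) s - picard A j s\<bar> \<le> A * ratio_const R * R\<^sup>2 / 4 * (1/2)^j * exp (rate A R * s)"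
proof (induction j arbitrary: s)
  case 0
  have "\<bar>picard_step A (\<lambda>_. 0) s\<bar> \<le> A * ratio_const R * s\<^sup>2 / 4"
    using 0 A by (intro picard_step_le) (auto simp: admissible_def)
  also have "\<dots> \<le> A * ratio_const R * R\<^sup>2 / 4 * 1"
    using 0 A ratio_const_nonneg[of R] by (simp add: mult_left_mono power_mono)
  also have "\<dots> \<le> A * ratio_const R * R\<^sup>2 / 4 * exp (rate A R * s)"
    using 0 A ratio_const_nonneg[of R] rate_pos[of A R] by (intro mult_left_mono) auto
  finally show ?case by (simp add: picard_Suc picard_0)
next
  case (Suc j)
  have "\<bar>picard_step A (picard A (Suc j)) s - picard_step A (picard A j) s\<bar> \<le> (A * ratio_const R * R\<^sup>2 / 4 * (1/2)^j) * exp (rate A R * s) / 2"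
    using Suc A ratio_const_nonneg[of R] rate_pos[of A R]
    by (intro picard_step_diff[where R = R and A' = A] admissible_picard) (auto simp: rate_def)
  then show ?case by (simp only: picard_Suc) (simp add: mult_ac)
qed

lemma uniform_limit_sol:
  assumes A: "0 \<le> A" and R: "0 \<le> R"
  shows "uniform_limit {0..R} (picard A) (sol A) sequentially"
proof -
  define M where "M = (\<lambda>j::nat. A * ratio_const R * R\<^sup>2 / 4 * exp (rate A R * R) * (1/2)^j)"
  have sM: "summable M" unfolding M_def by (intro summable_mult summable_geometric) auto
  have "norm (picard A (Suc j) s - picard A j s) \<le> M j" if "s \<in> {0..R}" for j s
  proof -
    have "\<bar>picard A (Suc j) s - picard A j s\<bar> \<le> A * ratio_const R * R\<^sup>2 / 4 * (1/2)^j * exp (rate A R * s)"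
      using that by (intro picard_Suc_diff A) auto
    also have "\<dots> \<le> A * ratio_const R * R\<^sup>2 / 4 * (1/2)^j * exp (rate A R * R)"
      using that A R ratio_const_nonneg[of R] rate_pos[of A R] by (intro mult_left_mono) auto
    finally show ?thesis by (simp add: M_def mult_ac)
  qed
  then have "uniform_limit {0..R} (\<lambda>j s. \<Sum>i<j. picard A (Suc i) s - picard A i s) (\<lambda>s. \<Sum>i. picard A (Suc i) s - picard A i s) sequentially"
    by (rule Weierstrass_m_test) (auto intro: sM)
  moreover have "(\<Sum>i<j. picard A (Suc i) s - picard A i s) = picard A j s" for j s
    using sum_lessThan_telescope[of "\<lambda>j. picard A j s" j] by (simp add: picard_0)
  ultimately show ?thesis by (simp add: sol_def[abs_def])
qed

lemma LIMSEQ_picard: "0 \<le> A \<Longrightarrow> 0 \<le> s \<Longrightarrow> (\<lambda>j. picard A j s) \<longlonglongrightarrow> sol A s"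
  using tendsto_uniform_limitI[OF uniform_limit_sol, of A s s] by auto

lemma admissible_sol:
  assumes A: "0 \<le> A"
  shows "admissible (sol A)"
  unfolding admissible_def
proof (intro conjI allI impI)
  \<comment> \<open>The even extension turns every point, including 0, into an interior point of an
    interval on which the convergence is uniform.\<close>
  have "isCont (\<lambda>s. sol A \<bar>s\<bar>) s" for s
  proof -
    have "continuous_on {0..\<bar>s\<bar>+1} (sol A)"
    proof (rule uniform_limit_theorem[OF _ uniform_limit_sol])
      show "\<forall>\<^sub>F j in sequentially. continuous_on {0..\<bar>s\<bar>+1} (picard A j)"
      proof (intro always_eventually allI)
        fix j
        have "continuous_on {0..} (picard A j)" using admissible_picard[OF A] by (simp add: admissible_def)
        then show "continuous_on {0..\<bar>s\<bar>+1} (picard A j)" by (rule continuous_on_subset) auto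
      qed
    qed (use A in auto)
    moreover have "continuous_on {-(\<bar>s\<bar>+1)<..<\<bar>s\<bar>+1} (\<lambda>s::real. \<bar>s\<bar>)"
      by (intro continuous_intros)
    moreover have "abs ` {-(\<bar>s\<bar>+1)<..<\<bar>s\<bar>+1} \<subseteq> {0..\<bar>s\<bar>+1}" by auto
    ultimately have "continuous_on {-(\<bar>s\<bar>+1)<..<\<bar>s\<bar>+1} (\<lambda>s. sol A \<bar>s\<bar>)"
      by (rule continuous_on_compose2)
    moreover have "s \<in> {-(\<bar>s\<bar>+1)<..<\<bar>s\<bar>+1}" by auto
    ultimately show ?thesis
      using continuous_on_eq_continuous_at[OF open_greaterThanLessThan] by blast
  qed
  then have "continuous_on {0..} (\<lambda>s. sol A \<bar>s\<bar>)" by (simp add: continuous_at_imp_continuous_on)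
  then show "continuous_on {0..} (sol A)" by (rule continuous_on_eq) auto
  show "sol A s \<le> 0" if "0 \<le> s" for s
    using admissible_picard[OF A] that
    by (intro LIMSEQ_le_const2[OF LIMSEQ_picard[OF A that]]) (auto simp: admissible_def)
qed

text \<open>The Picard map is continuous under uniform convergence on [0, s], so the limit of the
  iterates is a fixed point.\<close>

lemma picard_step_sol:
  assumes A: "0 \<le> A" and s: "0 \<le> s"
  shows "picard_step A (sol A) s = sol A s"
proof -
  have "(\<lambda>j. picard A (Suc j) s) \<longlonglongrightarrow> picard_step A (sol A) s"
  proof (rule LIMSEQ_I)
    fix e :: real assume e: "0 < e"
    define k where "k = rate A s"
    have k: "0 < k" using rate_pos[OF A s] by (simp add: k_def)
    \<comment> \<open>The tolerance carries the factor 1 / exp (k s) because the weighted estimate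
      multiplies by exp (k s) at the right end point.\<close>
    obtain N where N: "\<And>j t. N \<le> j \<Longrightarrow> t \<in> {0..s} \<Longrightarrow> dist (picard A j t) (sol A t) < e / exp (k * s)"
    proof -
      have "0 < e / exp (k * s)" using e by simp
      from uniform_limitD[OF uniform_limit_sol[OF A s] this] that show thesis
        unfolding eventually_sequentially by blast
    qed
    have "norm (picard A (Suc j) s - picard_step A (sol A) s) < e" if j: "N \<le> j" for j
    proof -
      have "\<bar>picard_step A (picard A j) s - picard_step A (sol A) s\<bar> \<le> (e / exp (k * s)) * exp (k * s) / 2"
      proof (rule picard_step_diff[where R = s and A' = A])
        fix t assume t: "0 \<le> t" "t \<le> s"
        have "\<bar>picard A j t - sol A t\<bar> \<le> e / exp (k * s) * 1"
          using N[OF j, of t] t by (simp add: dist_real_def)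
        also have "\<dots> \<le> e / exp (k * s) * exp (k * t)"
          using e k t by (intro mult_left_mono) auto
        finally show "\<bar>picard A j t - sol A t\<bar> \<le> e / exp (k * s) * exp (k * t)" .
      qed (use A s e k in \<open>auto simp: admissible_picard admissible_sol k_def rate_def\<close>)
      then show ?thesis using e by (simp add: picard_Suc)
    qed
    then show "\<exists>N. \<forall>j\<ge>N. norm (picard A (Suc j) s - picard_step A (sol A) s) < e" by blast
  qed
  with LIMSEQ_Suc[OF LIMSEQ_picard[OF A s]] show ?thesis by (rule LIMSEQ_unique[symmetric])
qed

section \<open>Dependence on the parameter A\<close>

text \<open>Changing the parameter in one step costs at most D, and the contraction halves the
  inherited error, so the bound 2 D reproduces itself: 2 D / 2 + D = 2 D.\<close>

lemma picard_param_diff: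
  assumes A: "0 \<le> A" "A \<le> M" and B: "0 \<le> B" "B \<le> M"
  shows "0 \<le> s \<Longrightarrow> s \<le> R \<Longrightarrow>
    \<bar>picard A j s - picard B j s\<bar> \<le> 2 * (\<bar>A - B\<bar> * (ratio_const R * R\<^sup>2)) * exp (rate M R * s)"
proof (induction j arbitrary: s)
  case 0 then show ?case using ratio_const_nonneg[of R] by (simp add: picard_0)
next
  case (Suc j)
  define D where "D = \<bar>A - B\<bar> * (ratio_const R * R\<^sup>2)"
  have D: "0 \<le> D" using ratio_const_nonneg[of R] by (simp add: D_def)
  have r: "0 < rate M R" using A Suc by (intro rate_pos) auto
  have "\<bar>picard_step A (picard A j) s - picard_step A (picard B j) s\<bar> \<le> (2 * D) * exp (rate M R * s) / 2"
    using Suc A B D r unfolding D_def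
    by (intro picard_step_diff[where R = R and A' = M] admissible_picard) (auto simp: rate_def)
  moreover have "\<bar>picard_step A (picard B j) s - picard_step B (picard B j) s\<bar> \<le> D"
    using Suc A B unfolding D_def by (intro picard_step_param_diff admissible_picard) auto
  moreover have "D * 1 \<le> D * exp (rate M R * s)"
    using D r Suc by (intro mult_left_mono) auto
  ultimately show ?case unfolding picard_Suc D_def[symmetric] by (simp add: abs_le_iff)
qed

lemma sol_param_diff:
  assumes A: "0 \<le> A" "A \<le> M" and B: "0 \<le> B" "B \<le> M" and s: "0 \<le> s" "s \<le> R"
  shows "\<bar>sol A s - sol B s\<bar> \<le> 2 * (\<bar>A - B\<bar> * (ratio_const R * R\<^sup>2)) * exp (rate M R * s)"
proof (rule LIMSEQ_le_const2)
  show "(\<lambda>j. \<bar>picard A j s - picard B j s\<bar>) \<longlonglongrightarrow> \<bar>sol A s - sol B s\<bar>"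
    using A B s by (intro tendsto_intros LIMSEQ_picard) auto
qed (use picard_param_diff[OF A B s] in auto)

lemma continuous_sol_param:
  assumes s: "0 \<le> s"
  shows "continuous_on {0<..} (\<lambda>A. sol A s)"
proof (rule continuous_on_locally_Lipschitz)
  fix M :: real assume "0 < M"
  show "\<exists>C. \<forall>A\<in>{0<..M}. \<forall>B\<in>{0<..M}. \<bar>sol A s - sol B s\<bar> \<le> C * \<bar>A - B\<bar>"
  proof (intro exI ballI)
    fix A B assume "A \<in> {0<..M}" "B \<in> {0<..M}"
    then show "\<bar>sol A s - sol B s\<bar> \<le> (2 * (ratio_const s * s\<^sup>2) * exp (rate M s * s)) * \<bar>A - B\<bar>"
      using sol_param_diff[of A M B s s] s by (auto simp: mult_ac)
  qed
qed

lemma numer_param_Lipschitz: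
  assumes s: "0 \<le> s" and M: "0 \<le> M"
  shows "\<exists>C. \<forall>A\<in>{0..M}. \<forall>B\<in>{0..M}. \<bar>numer (sol A) s - numer (sol B) s\<bar> \<le> C * \<bar>A - B\<bar>"
proof (intro exI ballI)
  fix A B assume AB: "A \<in> {0..M}" "B \<in> {0..M}"
  have "\<bar>numer (sol A) s - numer (sol B) s\<bar>
      \<le> real n * ratio_const s * sin2 n s * s\<^sup>2 * ((2 * (\<bar>A - B\<bar> * (ratio_const s * s\<^sup>2))) * exp (rate M s * s))"
    using AB s M ratio_const_nonneg[of s] sol_param_diff[of A M B _ s] rate_pos[of M s]
    by (intro numer_diff[where R = s] admissible_sol) auto
  then show "\<bar>numer (sol A) s - numer (sol B) s\<bar>
      \<le> (real n * ratio_const s * sin2 n s * s\<^sup>2 * (2 * (ratio_const s * s\<^sup>2) * exp (rate M s * s))) * \<bar>A - B\<bar>"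
    by (simp add: mult_ac)
qed

lemma continuous_numer_param:
  assumes s: "0 \<le> s"
  shows "continuous_on {0<..} (\<lambda>A. numer (sol A) s)"
proof (rule continuous_on_locally_Lipschitz)
  fix M :: real assume M: "0 < M"
  obtain C where "\<forall>A\<in>{0..M}. \<forall>B\<in>{0..M}. \<bar>numer (sol A) s - numer (sol B) s\<bar> \<le> C * \<bar>A - B\<bar>"
    using numer_param_Lipschitz[OF s, of M] M by auto
  then show "\<exists>C. \<forall>A\<in>{0<..M}. \<forall>B\<in>{0<..M}. \<bar>numer (sol A) s - numer (sol B) s\<bar> \<le> C * \<bar>A - B\<bar>"
    by (intro exI[of _ C]) auto
qed

text \<open>At A = 0 the ratio vanishes and L = 0 describes the harmonic map. This end of the
  parameter range is what decides the behaviour for small A.\<close>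

lemma sol_zero_param: "sol 0 s = 0"
proof -
  have "picard 0 j = (\<lambda>_. 0)" for j
    by (induction j) (auto simp: picard_0 picard_Suc picard_step_def[abs_def] ratio_def)
  then show ?thesis by (simp add: sol_def)
qed

end

section \<open>The harmonic map\<close>

definition cosn :: "nat \<Rightarrow> real \<Rightarrow> real" where
  "cosn n s = (1 - s ^ (2*n)) / (1 + s ^ (2*n))"

definition angle :: "nat \<Rightarrow> real \<Rightarrow> real" where
  "angle n s = 2 * arctan (s ^ n)"

lemma sin_angle: "sin (angle n s) = 2 * s ^ n / (1 + s ^ (2*n))"
proof -
  have p: "0 < 1 + (s ^ n)\<^sup>2" by (simp add: add_pos_nonneg)
  have "sin (angle n s) = 2 * sin (arctan (s ^ n)) * cos (arctan (s ^ n))"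
    by (simp add: angle_def sin_double)
  also have "\<dots> = 2 * s ^ n / (1 + (s ^ n)\<^sup>2)"
    using p by (simp add: sin_arctan cos_arctan)
  finally show ?thesis by (simp add: power_mult mult.commute)
qed

lemma cos_angle: "cos (angle n s) = cosn n s"
proof -
  have p: "0 < 1 + (s ^ n)\<^sup>2" by (simp add: add_pos_nonneg)
  have "cos (angle n s) = 2 * (cos (arctan (s ^ n)))\<^sup>2 - 1"
    by (simp add: angle_def cos_double_cos)
  also have "\<dots> = 2 / (1 + (s ^ n)\<^sup>2) - 1"
    using p by (simp add: cos_arctan power_divide)
  also have "\<dots> = cosn n s"
    using p by (simp add: cosn_def power_mult mult.commute[of 2 n] field_simps)
  finally show ?thesis .
qed

lemma sin2_eq: "sin2 n s = (sin (angle n s))\<^sup>2"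
  by (simp add: sin2_def sin_angle power_divide power_mult_distrib power_mult[symmetric] mult.commute)

lemma sin2_cosn: "sin2 n s = 1 - (cosn n s)\<^sup>2"
  by (simp add: sin2_eq sin_squared_eq cos_angle)

lemma sqrt_sin2: "0 \<le> s \<Longrightarrow> sqrt (sin2 n s) = 2 * s ^ n / (1 + s ^ (2*n))"
  by (simp add: sin2_eq sin_angle one_plus_power_pos less_imp_le)

lemma angle_bounds: "0 < s \<Longrightarrow> 0 < angle n s" "angle n s < pi"
  using arctan_ubound[of "s ^ n"] by (auto simp: angle_def)

lemma angle_0 [simp]: "0 < n \<Longrightarrow> angle n 0 = 0" and cosn_0 [simp]: "0 < n \<Longrightarrow> cosn n 0 = 1"
  and sin2_0 [simp]: "0 < n \<Longrightarrow> sin2 n 0 = 0"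
  by (simp_all add: angle_def cosn_def sin2_def power_0_left)

lemma DERIV_cosn:
  assumes s: "0 < s" and n: "1 \<le> n"
  shows "(cosn n has_real_derivative - (n * sin2 n s / s)) (at s)"
proof -
  have e: "s ^ (2*n) = s * s ^ (2*n-1)"
    using n by (cases n) auto
  have "(cosn n has_real_derivative
      (- (real (2*n) * s ^ (2*n-1)) * (1 + s^(2*n)) - (1 - s^(2*n)) * (real (2*n) * s ^ (2*n-1))) / ((1 + s^(2*n)) * (1 + s^(2*n)))) (at s)"
    unfolding cosn_def[abs_def]
    by (rule derivative_eq_intros refl | simp add: one_plus_power_neq)+
  moreover have "(- (real (2*n) * s ^ (2*n-1)) * (1 + s^(2*n)) - (1 - s^(2*n)) * (real (2*n) * s ^ (2*n-1))) / ((1 + s^(2*n)) * (1 + s^(2*n)))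
      = - (n * sin2 n s / s)"
  proof -
    have "- (real (2*n) * s ^ (2*n-1)) * (1 + s^(2*n)) - (1 - s^(2*n)) * (real (2*n) * s ^ (2*n-1)) = - (4 * n * s ^ (2*n-1))"
      by (simp add: algebra_simps)
    moreover have "n * sin2 n s / s = 4 * n * s ^ (2*n-1) / ((1 + s^(2*n)) * (1 + s^(2*n)))"
      using s by (simp add: sin2_def e power2_eq_square)
    ultimately show ?thesis by simp
  qed
  ultimately show ?thesis by simp
qed

lemma DERIV_sin2:
  fixes s :: real
  assumes s: "0 < s" and n: "1 \<le> n"
  shows "(sin2 n has_real_derivative 2 * real n * cosn n s * sin2 n s / s) (at s)"
proof -
  have "((\<lambda>s. 1 - (cosn n s)\<^sup>2) has_real_derivative 0 - (real 2 * (- (n * sin2 n s / s) * cosn n s ^ (2 - Suc 0)))) (at s)"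
    by (intro DERIV_diff DERIV_const DERIV_power DERIV_cosn s n)
  moreover have "(\<lambda>s. 1 - (cosn n s)\<^sup>2) = sin2 n" by (simp add: sin2_cosn fun_eq_iff)
  ultimately show ?thesis by (simp add: mult_ac)
qed

lemma DERIV_angle:
  assumes s: "0 < s" and n: "1 \<le> n"
  shows "(angle n has_real_derivative n * sqrt (sin2 n s) / s) (at s)"
proof -
  have e: "s ^ n = s * s ^ (n-1)"
    using n by (cases n) auto
  have "(angle n has_real_derivative 2 * (inverse (1 + (s ^ n)\<^sup>2) * (real n * s ^ (n - 1)))) (at s)"
    unfolding angle_def[abs_def]
    by (rule derivative_eq_intros refl | simp)+
  moreover have "2 * (inverse (1 + (s ^ n)\<^sup>2) * (real n * s ^ (n - 1))) = n * sqrt (sin2 n s) / s"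
    using s by (simp add: sqrt_sin2 e power_mult[symmetric] mult.commute[of 2 n] divide_inverse)
      (simp add: e power_mult_distrib power_mult mult.commute[of 2 n])
  ultimately show ?thesis by simp
qed

lemma continuous_cosn [continuous_intros]:
  "continuous_on A f \<Longrightarrow> continuous_on A (\<lambda>x. cosn n (f x))"
  unfolding cosn_def by (intro continuous_intros) (auto simp: one_plus_power_neq)

lemma continuous_angle [continuous_intros]:
  "continuous_on A f \<Longrightarrow> continuous_on A (\<lambda>x. angle n (f x))"
  unfolding angle_def by (intro continuous_intros)

lemma cosn_le: "-1 \<le> cosn n s" "cosn n s \<le> 1"
  by (simp_all flip: cos_angle)

lemma one_minus_cosn: "1 - cosn n s = sin2 n s * (1 + s ^ (2*n)) / 2"
proof -
  define P where "P = 1 + s ^ (2*n)"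
  have P: "P \<noteq> 0" "s ^ (2*n) = P - 1" using one_plus_power_neq[of s n] by (auto simp: P_def)
  show ?thesis
    unfolding cosn_def sin2_def P_def[symmetric] P(2) using P(1)
    by (simp add: power2_eq_square divide_simps)
qed

text \<open>For s \<ge> 1 the cosine is nonpositive, so 1 + cos h \<le> (1 + cos h) (1 - cos h) =
  sin^2 h. A bound on Q by a multiple of 1 + cos h thereby becomes a bound on the ratio, whose
  denominator is n^2 sin^2 h.\<close>

lemma one_plus_cosn_le: "1 \<le> s \<Longrightarrow> 1 + cosn n s \<le> sin2 n s"
proof -
  assume "1 \<le> s"
  then have "cosn n s \<le> 0"
    using one_plus_power_pos[of s n] by (simp add: cosn_def divide_nonpos_pos)
  then have "(1 + cosn n s) * 1 \<le> (1 + cosn n s) * (1 - cosn n s)"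
    using cosn_le[of n s] by (intro mult_left_mono) auto
  also have "\<dots> = sin2 n s" by (simp add: sin2_cosn power2_eq_square algebra_simps)
  finally show ?thesis by simp
qed

lemma filterlim_power_at_top: "1 \<le> n \<Longrightarrow> filterlim (\<lambda>s::real. s ^ n) at_top at_top"
  by (intro filterlim_pow_at_top filterlim_ident) auto

lemma angle_at_top: "1 \<le> n \<Longrightarrow> (angle n \<longlongrightarrow> pi) at_top"
proof -
  assume "1 \<le> n"
  then have "((\<lambda>s. 2 * arctan (s ^ n)) \<longlongrightarrow> 2 * (pi / 2)) at_top"
    by (intro tendsto_intros filterlim_compose[OF tendsto_arctan_at_top] filterlim_power_at_top)
  then show ?thesis by (simp add: angle_def[abs_def])
qed

lemma cosn_at_top: "1 \<le> n \<Longrightarrow> (cosn n \<longlongrightarrow> -1) at_top"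
  using tendsto_cos[OF angle_at_top] by (simp add: cos_angle)

lemma nondecreasing_limit_le:
  fixes f :: "real \<Rightarrow> real"
  assumes lim: "(f \<longlongrightarrow> l) at_top" and mono: "\<And>t. s \<le> t \<Longrightarrow> f s \<le> f t"
  shows "f s \<le> l"
  by (rule tendsto_lowerbound[OF lim eventually_mono[OF eventually_ge_at_top[of s] mono]]) auto

section \<open>Shooting\<close>

text \<open>\<open>\<Gamma>\<close> stands for G(h) as a function of s, with derivative g(h) dh/ds,
  and \<open>\<sigma>\<close> is the value of s at which h = \<xi>. \<open>Gamma_0\<close> expresses
  that the integral of g over [0, \<pi>] is positive.\<close>

locale shooting = volterra +
  fixes \<Gamma> :: "real \<Rightarrow> real" and \<sigma> :: real
  assumes \<sigma>: "0 < \<sigma>"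
    and b_pos: "\<And>s. 0 < s \<Longrightarrow> s < \<sigma> \<Longrightarrow> 0 < b s" and b_neg: "\<And>s. \<sigma> < s \<Longrightarrow> b s < 0"
    and continuous_Gamma: "continuous_on {0..} \<Gamma>"
    and DERIV_Gamma: "\<And>s. 0 < s \<Longrightarrow> (\<Gamma> has_real_derivative n * b s * sin2 n s / s) (at s)"
    and Gamma_at_top: "(\<Gamma> \<longlongrightarrow> 0) at_top"
    and Gamma_0: "\<Gamma> 0 < 0"
begin

lemma continuous_Gamma_Icc: "0 \<le> u \<Longrightarrow> continuous_on {u..v} \<Gamma>"
  by (rule continuous_on_subset[OF continuous_Gamma]) auto

lemma n_pos: "0 < n" using n by simp

lemma Gamma_decreasing:
  assumes "\<sigma> \<le> s" "s \<le> t"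
  shows "\<Gamma> t \<le> \<Gamma> s"
proof -
  have "- \<Gamma> s \<le> - \<Gamma> t"
  proof (rule nondecreasing_on_Icc[OF assms(2), where f' = "\<lambda>s. - (n * b s * sin2 n s / s)"])
    show "continuous_on {s..t} (\<lambda>s. - \<Gamma> s)"
      using assms \<sigma> by (intro continuous_intros continuous_Gamma_Icc) auto
    fix x assume x: "s < x" "x < t"
    show "((\<lambda>s. - \<Gamma> s) has_real_derivative - (n * b x * sin2 n x / x)) (at x)"
      using x assms \<sigma> by (intro DERIV_minus DERIV_Gamma) auto
    have "n * b x * sin2 n x \<le> 0"
      using b_neg[of x] x assms sin2_nonneg[of n x] by (intro mult_nonpos_nonneg mult_nonneg_nonpos) auto
    then show "0 \<le> - (n * b x * sin2 n x / x)"
      using x assms \<sigma> by (simp add: divide_nonpos_pos)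
  qed
  then show ?thesis by simp
qed

lemma Gamma_nonneg:
  assumes "\<sigma> \<le> s"
  shows "0 \<le> \<Gamma> s"
proof -
  have "- \<Gamma> s \<le> - 0"
    by (rule nondecreasing_limit_le[where f = "\<lambda>s. - \<Gamma> s", OF tendsto_minus[OF Gamma_at_top]])
      (use assms Gamma_decreasing in auto)
  then show ?thesis by simp
qed

lemma Gamma_increasing:
  assumes "0 \<le> s" "s \<le> t" "t \<le> \<sigma>"
  shows "\<Gamma> s \<le> \<Gamma> t"
proof (rule nondecreasing_on_Icc[OF assms(2) continuous_Gamma_Icc[OF assms(1)], where f' = "\<lambda>s. n * b s * sin2 n s / s"])
  fix x assume x: "s < x" "x < t"
  then show "(\<Gamma> has_real_derivative n * b x * sin2 n x / x) (at x)"
    using assms by (intro DERIV_Gamma) auto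
  show "0 \<le> n * b x * sin2 n x / x"
    using b_pos[of x] x assms sin2_nonneg[of n x] by auto
qed

lemma Gamma_ge:
  assumes "0 \<le> s"
  shows "\<Gamma> 0 \<le> \<Gamma> s"
  using Gamma_increasing[of 0 s] Gamma_nonneg[of s] Gamma_0 assms by force

text \<open>From |g| \<le> \<beta> sin h it follows that G - \<beta> (1 + cos h) is nondecreasing in
  h, and it tends to 0 at h = \<pi>.\<close>

lemma Gamma_le:
  assumes "0 < s"
  shows "\<Gamma> s \<le> \<beta> * (1 + cosn n s)"
proof -
  have "\<Gamma> s - \<beta> * (1 + cosn n s) \<le> 0 - \<beta> * (1 + (-1))"
  proof (rule nondecreasing_limit_le[where f = "\<lambda>s. \<Gamma> s - \<beta> * (1 + cosn n s)"])
    show "((\<lambda>s. \<Gamma> s - \<beta> * (1 + cosn n s)) \<longlongrightarrow> 0 - \<beta> * (1 + (-1))) at_top"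
      by (intro tendsto_intros Gamma_at_top cosn_at_top n)
    fix t assume "s \<le> t"
    then show "\<Gamma> s - \<beta> * (1 + cosn n s) \<le> \<Gamma> t - \<beta> * (1 + cosn n t)"
    proof (rule nondecreasing_on_Icc[where f' = "\<lambda>s. n * b s * sin2 n s / s - \<beta> * (0 + (- (n * sin2 n s / s)))"])
      show "continuous_on {s..t} (\<lambda>s. \<Gamma> s - \<beta> * (1 + cosn n s))"
        using assms by (intro continuous_intros continuous_Gamma_Icc) auto
      fix x assume x: "s < x" "x < t"
      show "((\<lambda>s. \<Gamma> s - \<beta> * (1 + cosn n s)) has_real_derivative
          n * b x * sin2 n x / x - \<beta> * (0 + (- (n * sin2 n x / x)))) (at x)"
        using x assms n by (intro derivative_intros DERIV_cmult DERIV_Gamma DERIV_cosn) auto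
      have "0 \<le> (b x + \<beta>) * (n * sin2 n x / x)"
        using b_bound[of x] x assms sin2_nonneg[of n x] by (intro mult_nonneg_nonneg divide_nonneg_nonneg) auto
      then show "0 \<le> n * b x * sin2 n x / x - \<beta> * (0 + (- (n * sin2 n x / x)))"
        by (simp add: algebra_simps add_divide_distrib diff_divide_distrib)
    qed
  qed
  then show ?thesis by simp
qed

text \<open>The same comparison started at h = 0: \<beta> (1 - cos h) - G is nondecreasing in
  h.\<close>

lemma Gamma_diff_le:
  assumes "0 \<le> s"
  shows "\<Gamma> s - \<Gamma> 0 \<le> \<beta> * (1 - cosn n s)"
proof -
  have "\<beta> * (1 - cosn n 0) - \<Gamma> 0 \<le> \<beta> * (1 - cosn n s) - \<Gamma> s"
  proof (rule nondecreasing_on_Icc[OF assms, where f' = "\<lambda>s. \<beta> * (0 - (- (n * sin2 n s / s))) - n * b s * sin2 n s / s"])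
    show "continuous_on {0..s} (\<lambda>s. \<beta> * (1 - cosn n s) - \<Gamma> s)"
      by (intro continuous_intros continuous_Gamma_Icc) auto
    fix x assume x: "0 < x" "x < s"
    show "((\<lambda>s. \<beta> * (1 - cosn n s) - \<Gamma> s) has_real_derivative
        \<beta> * (0 - (- (n * sin2 n x / x))) - n * b x * sin2 n x / x) (at x)"
      using x n by (intro derivative_intros DERIV_cmult DERIV_Gamma DERIV_cosn) auto
    have "0 \<le> (\<beta> - b x) * (n * sin2 n x / x)"
      using b_bound[of x] x sin2_nonneg[of n x] by (intro mult_nonneg_nonneg divide_nonneg_nonneg) auto
    then show "0 \<le> \<beta> * (0 - (- (n * sin2 n x / x))) - n * b x * sin2 n x / x"
      by (simp add: algebra_simps add_divide_distrib diff_divide_distrib)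
  qed
  then show ?thesis using n_pos by simp
qed

section \<open>The quantities r^2, Q and r h' / (n sin h) along a solution\<close>

definition rho :: "real \<Rightarrow> real \<Rightarrow> real" where
  "rho A s = A * s\<^sup>2 * exp (2 * sol A s)"

definition excess :: "real \<Rightarrow> real \<Rightarrow> real" where
  "excess A s = 2 * real n * A * numer (sol A) s"

definition wroot :: "real \<Rightarrow> real \<Rightarrow> real" where
  "wroot A s = sqrt (1 + max 0 (ratio A (sol A) s))"

lemma wroot_ge: "1 \<le> wroot A s" by (simp add: wroot_def)

lemma wroot_pos: "0 < wroot A s" using wroot_ge[of A s] by linarith

lemma psi_wroot: "psi (ratio A (sol A) s) = 1 - 1 / wroot A s"
  by (simp add: psi_def wroot_def)

lemma ratio_excess: "ratio A (sol A) s = excess A s / (n\<^sup>2 * sin2 n s)"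
  using n by (simp add: ratio_def excess_def power2_eq_square)

lemma rho_pos: "0 < A \<Longrightarrow> 0 < s \<Longrightarrow> 0 < rho A s" by (simp add: rho_def)

lemma rho_0 [simp]: "rho A 0 = 0" by (simp add: rho_def)

lemma sol_0 [simp]: "0 \<le> A \<Longrightarrow> sol A 0 = 0"
  by (simp add: picard_step_sol[symmetric] picard_step_def)

lemma excess_0 [simp]: "excess A 0 = 0"
  by (simp add: excess_def numer_def)

lemma continuous_sol: "0 \<le> A \<Longrightarrow> continuous_on {0..} (sol A)"
  using admissible_sol by (simp add: admissible_def)

lemma continuous_rho: "0 \<le> A \<Longrightarrow> continuous_on {0..} (rho A)"
  unfolding rho_def[abs_def] by (intro continuous_intros continuous_sol)

lemma continuous_excess: "0 \<le> A \<Longrightarrow> continuous_on {0..} (excess A)"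
  unfolding excess_def[abs_def] by (intro continuous_intros continuous_on_numer admissible_sol)

lemma DERIV_sol:
  assumes A: "0 \<le> A" and s: "0 < s"
  shows "(sol A has_real_derivative - (1 - 1 / wroot A s) / s) (at s)"
proof -
  have "(picard_step A (sol A) has_real_derivative - (psi (ratio A (sol A) s) / s)) (at s)"
    unfolding picard_step_def[abs_def]
    by (intro DERIV_minus DERIV_primitive continuous_on_slope admissible_sol A s)
  then have "(picard_step A (sol A) has_real_derivative - (1 - 1 / wroot A s) / s) (at s)"
    unfolding psi_wroot minus_divide_left .
  moreover have "\<forall>\<^sub>F x in nhds s. picard_step A (sol A) x = sol A x"
    using eventually_nhds_in_open[of "{0<..}" s] s by (auto elim!: eventually_mono simp: picard_step_sol A)
  ultimately show ?thesis using DERIV_cong_ev[OF refl _ refl] by blast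
qed

lemma DERIV_rho:
  assumes A: "0 < A" and s: "0 < s"
  shows "(rho A has_real_derivative 2 * rho A s / (s * wroot A s)) (at s)"
proof -
  have "(rho A has_real_derivative A * (2 * s) * exp (2 * sol A s)
      + exp (2 * sol A s) * (2 * (- (1 - 1 / wroot A s) / s)) * (A * s\<^sup>2)) (at s)"
    unfolding rho_def[abs_def]
    by (rule derivative_eq_intros DERIV_sol refl | use A s in simp)+
  moreover have "A * (2 * s) * exp (2 * sol A s) + exp (2 * sol A s) * (2 * (- (1 - 1 / wroot A s) / s)) * (A * s\<^sup>2)
      = 2 * rho A s / (s * wroot A s)"
    using s wroot_pos[of A s] by (simp add: rho_def field_simps power2_eq_square)
  ultimately show ?thesis by simp
qed

lemma DERIV_excess:
  assumes A: "0 < A" and s: "0 < s"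
  shows "(excess A has_real_derivative 2 * rho A s * (n * b s * sin2 n s / s)) (at s)"
proof -
  have "(excess A has_real_derivative 2 * real n * A * (s * exp (2 * sol A s) * b s * sin2 n s)) (at s)"
    unfolding excess_def[abs_def] numer_def[abs_def]
    using A by (intro DERIV_cmult DERIV_primitive continuous_on_integrand admissible_sol s) auto
  moreover have "2 * real n * A * (s * exp (2 * sol A s) * b s * sin2 n s) = 2 * rho A s * (n * b s * sin2 n s / s)"
    using s by (simp add: rho_def power2_eq_square)
  ultimately show ?thesis by simp
qed

lemma rho_mono:
  assumes A: "0 < A" and s: "0 \<le> s" "s < t"
  shows "rho A s < rho A t"
proof (rule increasing_on_Icc[OF s(2), where f' = "\<lambda>s. 2 * rho A s / (s * wroot A s)"])
  show "continuous_on {s..t} (rho A)"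
    using A s by (intro continuous_on_subset[OF continuous_rho]) auto
  fix x assume x: "s < x" "x < t"
  show "(rho A has_real_derivative 2 * rho A x / (x * wroot A x)) (at x)"
    using x A s by (intro DERIV_rho) auto
  show "0 < 2 * rho A x / (x * wroot A x)"
    using x A s rho_pos[of A x] wroot_pos[of A x] by (intro divide_pos_pos mult_pos_pos) auto
qed

lemma rho_mono_le: "0 < A \<Longrightarrow> 0 \<le> s \<Longrightarrow> s \<le> t \<Longrightarrow> rho A s \<le> rho A t"
  using rho_mono[of A s t] by fastforce

lemma excess_decreasing:
  assumes A: "0 < A" and s: "\<sigma> \<le> s" "s < t"
  shows "excess A t < excess A s"
proof -
  have "- excess A s < - excess A t"
  proof (rule increasing_on_Icc[OF s(2), where f' = "\<lambda>s. - (2 * rho A s * (n * b s * sin2 n s / s))"])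
    show "continuous_on {s..t} (\<lambda>s. - excess A s)"
      using A s \<sigma> by (intro continuous_on_minus continuous_on_subset[OF continuous_excess]) auto
    fix x assume x: "s < x" "x < t"
    show "((\<lambda>s. - excess A s) has_real_derivative - (2 * rho A x * (n * b x * sin2 n x / x))) (at x)"
      using x A s \<sigma> by (intro DERIV_minus DERIV_excess) auto
    have "n * b x * sin2 n x / x < 0"
      using b_neg[of x] x s \<sigma> sin2_pos[of x n] n_pos
      by (intro divide_neg_pos mult_neg_pos mult_pos_neg) auto
    then show "0 < - (2 * rho A x * (n * b x * sin2 n x / x))"
      using x A s \<sigma> rho_pos[of A x] mult_pos_neg[of "2 * rho A x" "n * b x * sin2 n x / x"] by simp
  qed
  then show ?thesis by simp
qed

lemma excess_pos:
  assumes A: "0 < A" and s: "0 < s" "s \<le> \<sigma>"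
  shows "0 < excess A s"
proof -
  have "excess A 0 < excess A s"
  proof (rule increasing_on_Icc[OF s(1), where f' = "\<lambda>s. 2 * rho A s * (n * b s * sin2 n s / s)"])
    show "continuous_on {0..s} (excess A)"
      using A s by (intro continuous_on_subset[OF continuous_excess]) auto
    fix x assume x: "0 < x" "x < s"
    show "(excess A has_real_derivative 2 * rho A x * (n * b x * sin2 n x / x)) (at x)"
      using x A s by (intro DERIV_excess) auto
    show "0 < 2 * rho A x * (n * b x * sin2 n x / x)"
      using b_pos[of x] x s sin2_pos[of x n] rho_pos[of A x] A n_pos by simp
  qed
  then show ?thesis by simp
qed

text \<open>Integration by parts in dQ = 2 r^2 dG. The remaining term is minus the integral of 2 (G
  - G(0)) d(r^2), which is nonpositive as r^2 increases and G is smallest at h = 0.\<close>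

lemma excess_le:
  assumes A: "0 < A" and s: "0 \<le> s"
  shows "excess A s \<le> 2 * rho A s * (\<Gamma> s - \<Gamma> 0)"
proof -
  have "2 * rho A 0 * (\<Gamma> 0 - \<Gamma> 0) - excess A 0 \<le> 2 * rho A s * (\<Gamma> s - \<Gamma> 0) - excess A s"
  proof (rule nondecreasing_on_Icc[OF s, where f' = "\<lambda>s. (2 * (2 * rho A s / (s * wroot A s))) * (\<Gamma> s - \<Gamma> 0)
      + (n * b s * sin2 n s / s - 0) * (2 * rho A s) - 2 * rho A s * (n * b s * sin2 n s / s)"])
    show "continuous_on {0..s} (\<lambda>s. 2 * rho A s * (\<Gamma> s - \<Gamma> 0) - excess A s)"
      using A s by (intro continuous_intros continuous_Gamma_Icc
          continuous_on_subset[OF continuous_excess, of A "{0..s}"] continuous_on_subset[OF continuous_rho, of A "{0..s}"]) auto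
    fix x assume x: "0 < x" "x < s"
    show "((\<lambda>s. 2 * rho A s * (\<Gamma> s - \<Gamma> 0) - excess A s) has_real_derivative
       (2 * (2 * rho A x / (x * wroot A x))) * (\<Gamma> x - \<Gamma> 0)
      + (n * b x * sin2 n x / x - 0) * (2 * rho A x) - 2 * rho A x * (n * b x * sin2 n x / x)) (at x)"
      using x A s by (intro DERIV_diff DERIV_mult DERIV_cmult DERIV_rho DERIV_excess DERIV_Gamma DERIV_const) auto
    have "0 \<le> (2 * (2 * rho A x / (x * wroot A x))) * (\<Gamma> x - \<Gamma> 0)"
      using x A rho_pos[of A x] wroot_pos[of A x] Gamma_ge[of x]
      by (intro mult_nonneg_nonneg divide_nonneg_nonneg) auto
    then show "0 \<le> (2 * (2 * rho A x / (x * wroot A x))) * (\<Gamma> x - \<Gamma> 0)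
      + (n * b x * sin2 n x / x - 0) * (2 * rho A x) - 2 * rho A x * (n * b x * sin2 n x / x)" by simp
  qed
  then show ?thesis by simp
qed

section \<open>The energy Q / r^2 and its damping\<close>

text \<open>This is h'^2 - n^2 sin^2 h / r^2. By the equation, energy - 2 G changes only through the
  damping term - energy d(r^2) / r^2.\<close>

definition energy :: "real \<Rightarrow> real \<Rightarrow> real" where
  "energy A s = excess A s / rho A s"

text \<open>Twice an upper bound for \<Gamma> - \<Gamma> 0, since \<Gamma> \<le> \<beta> (1 + cos h)
  \<le> 2 \<beta>.\<close>

definition emax :: real where "emax = 2 * (2 * \<beta> - \<Gamma> 0)"

lemma emax_pos: "0 < emax" using beta_nonneg Gamma_0 by (simp add: emax_def)

lemma energy_le:
  assumes A: "0 < A" and s: "0 < s"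
  shows "energy A s \<le> emax"
proof -
  have "\<Gamma> s \<le> \<beta> * 2"
    using order_trans[OF Gamma_le[OF s] mult_left_mono[of "1 + cosn n s" 2 \<beta>]] cosn_le[of n s] beta_nonneg by auto
  moreover have "energy A s \<le> 2 * (\<Gamma> s - \<Gamma> 0)"
    using excess_le[OF A, of s] s rho_pos[OF A s] by (simp add: energy_def field_simps)
  ultimately show ?thesis by (simp add: emax_def)
qed

text \<open>The damping is 2 / s times the left-hand side. Where the energy is positive,
  \<open>wroot\<close> is at least the root of the ratio, which absorbs one square root of the
  energy. What remains contains n sin h = s dh/ds, so the total loss is controlled by the change of
  the angle, divided by r.\<close>

lemma energy_damping:
  assumes A: "0 < A" and s: "0 < s"
  shows "energy A s / wroot A s \<le> sqrt emax * (n * sqrt (sin2 n s)) / sqrt (rho A s)"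
proof (cases "0 < energy A s")
  case False
  then have "energy A s / wroot A s \<le> 0" using wroot_pos[of A s] by (simp add: divide_nonpos_pos)
  also have "0 \<le> sqrt emax * (n * sqrt (sin2 n s)) / sqrt (rho A s)"
    using emax_pos sin2_nonneg rho_pos[OF A s] by simp
  finally show ?thesis .
next
  case True
  define e where "e = energy A s"
  define r where "r = rho A s"
  define S where "S = sin2 n s"
  have p: "0 < e" "0 < r" "0 < S" "e \<le> emax"
    using True rho_pos[OF A s] sin2_pos[OF s] energy_le[OF A s] by (auto simp: e_def r_def S_def)
  have ra: "ratio A (sol A) s = r * e / (n\<^sup>2 * S)"
    using p by (simp add: ratio_excess e_def energy_def r_def S_def)
  have "sqrt (r * e / (n\<^sup>2 * S)) \<le> wroot A s"
    unfolding wroot_def ra by (intro real_sqrt_le_mono) auto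
  then have "sqrt r * sqrt e / (n * sqrt S) \<le> wroot A s"
    by (simp add: real_sqrt_divide real_sqrt_mult)
  moreover have "0 < sqrt r * sqrt e / (n * sqrt S)" using p n_pos by simp
  ultimately have "e / wroot A s \<le> e / (sqrt r * sqrt e / (n * sqrt S))"
    using p mult_pos_pos[OF wroot_pos[of A s]] by (intro divide_left_mono) (simp_all del: times_divide_eq_right)
  also have "\<dots> = (sqrt e * sqrt e) / (sqrt r * sqrt e / (n * sqrt S))" using p by simp
  also have "\<dots> = sqrt e * (n * sqrt S) / sqrt r"
    using p n_pos by (simp add: field_simps del: real_sqrt_mult_self)
  also have "\<dots> \<le> sqrt emax * (n * sqrt S) / sqrt r"
    using p by (intro divide_right_mono mult_right_mono) auto
  finally show ?thesis by (simp add: e_def r_def S_def)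
qed

text \<open>By \<open>energy_ge_margin\<close>, a positive margin at a single point forces a positive limit of \<open>excess\<close>. This makes
  overshooting an open condition on the parameter.\<close>

definition margin :: "real \<Rightarrow> real \<Rightarrow> real" where
  "margin A s = energy A s - 2 * \<Gamma> s - 2 * sqrt emax * (pi - angle n s) / sqrt (rho A s)"

lemma energy_ge_margin:
  assumes A: "0 < A" and s: "0 < s" "s \<le> t"
  shows "margin A s + 2 * \<Gamma> t \<le> energy A t"
proof -
  \<comment> \<open>From s on r^2 is at least \<open>rho A s\<close>, so the energy lost per unit of
    angle is at most K; adding K times the angle compensates the damping.\<close>
  define K where "K = 2 * sqrt emax / sqrt (rho A s)"
  have K: "0 \<le> K" using emax_pos rho_pos[OF A s(1)] by (simp add: K_def)
  define F' where "F' = (\<lambda>x. ((2 * rho A x * (n * b x * sin2 n x / x)) * rho A x - excess A x * (2 * rho A x / (x * wroot A x)))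
      / (rho A x * rho A x) - 2 * (n * b x * sin2 n x / x) + K * (n * sqrt (sin2 n x) / x))"
  have "energy A s - 2 * \<Gamma> s + K * angle n s \<le> energy A t - 2 * \<Gamma> t + K * angle n t"
  proof (rule nondecreasing_on_Icc[OF s(2), where f' = F'])
    have p: "rho A x \<noteq> 0" if "x \<in> {s..t}" for x
      using rho_pos[OF A, of x] that s by auto
    have "continuous_on {s..t} (excess A)" "continuous_on {s..t} (rho A)"
      using A s by (auto intro: continuous_on_subset[OF continuous_excess] continuous_on_subset[OF continuous_rho])
    then show "continuous_on {s..t} (\<lambda>t. energy A t - 2 * \<Gamma> t + K * angle n t)"
      unfolding energy_def using p s by (intro continuous_intros continuous_Gamma_Icc) auto
    fix x assume x: "s < x" "x < t"
    then have x0: "0 < x" using s by simp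
    note r = rho_pos[OF A x0]
    show "((\<lambda>t. energy A t - 2 * \<Gamma> t + K * angle n t) has_real_derivative F' x) (at x)"
      unfolding energy_def F'_def
      by (intro DERIV_add DERIV_diff DERIV_cmult DERIV_divide DERIV_excess DERIV_rho DERIV_Gamma DERIV_angle A x0 n)
        (use r in auto)
    have "F' x = K * (n * sqrt (sin2 n x) / x) - 2 / x * (energy A x / wroot A x)"
      using r x0 wroot_pos[of A x] by (simp add: F'_def energy_def field_simps)
    moreover have "2 / x * (energy A x / wroot A x) \<le> 2 / x * (sqrt emax * (n * sqrt (sin2 n x)) / sqrt (rho A s))"
    proof -
      have "energy A x / wroot A x \<le> sqrt emax * (n * sqrt (sin2 n x)) / sqrt (rho A x)"
        by (rule energy_damping[OF A x0])
      also have "\<dots> \<le> sqrt emax * (n * sqrt (sin2 n x)) / sqrt (rho A s)"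
        using rho_mono_le[OF A, of s x] rho_pos[OF A s(1)] s x emax_pos sin2_nonneg[of n x] r
        by (intro divide_left_mono) auto
      finally show ?thesis using x0 by (intro mult_left_mono) auto
    qed
    moreover have "2 / x * (sqrt emax * (n * sqrt (sin2 n x)) / sqrt (rho A s)) = K * (n * sqrt (sin2 n x) / x)"
      by (simp add: K_def mult.commute)
    ultimately show "0 \<le> F' x" by simp
  qed
  moreover have "K * angle n t \<le> K * pi" using K angle_bounds(2)[of n t] by (intro mult_left_mono) auto
  moreover have "2 * sqrt emax * (pi - angle n s) / sqrt (rho A s) = K * pi - K * angle n s"
    by (simp add: K_def diff_divide_distrib right_diff_distrib)
  ultimately show ?thesis by (simp add: margin_def)
qed

section \<open>Overshooting and undershooting parameters\<close>

definition overshoot :: "real set" where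
  "overshoot = {A\<in>{0<..}. \<exists>s>0. 0 < margin A s}"

definition undershoot :: "real set" where
  "undershoot = {A\<in>{0<..}. \<exists>s>0. numer (sol A) s < 0}"

lemma excess_neg_iff: "0 < A \<Longrightarrow> excess A s < 0 \<longleftrightarrow> numer (sol A) s < 0"
  using n_pos by (simp add: excess_def mult_less_0_iff)

text \<open>Q is positive up to \<sigma> and decreases afterwards, so once negative it stays
  negative. A positive margin makes it positive at all late points, where \<Gamma> is
  nonnegative.\<close>

lemma overshoot_undershoot_disjoint: "overshoot \<inter> undershoot = {}"
proof (rule ccontr)
  assume "overshoot \<inter> undershoot \<noteq> {}"
  then obtain A s u where A: "0 < A" and s: "0 < s" "0 < margin A s" and u: "0 < u" "excess A u < 0"
    by (auto simp: overshoot_def undershoot_def excess_neg_iff)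
  define t where "t = max (max s u) \<sigma> + 1"
  have t: "s \<le> t" "u < t" "\<sigma> \<le> t" by (auto simp: t_def)
  have "0 < energy A t"
    using energy_ge_margin[OF A s(1) t(1)] Gamma_nonneg[OF t(3)] s by simp
  then have "0 < excess A t" using rho_pos[OF A, of t] s t by (simp add: energy_def zero_less_divide_iff)
  moreover have "\<sigma> < u" using excess_pos[OF A u(1)] u(2) by fastforce
  then have "excess A t < excess A u" using t by (intro excess_decreasing A) auto
  ultimately show False using u by simp
qed

lemma open_overshoot: "open overshoot"
proof -
  have "overshoot = (\<Union>s\<in>{0<..}. {0<..} \<inter> (\<lambda>A. margin A s) -` {0<..})"
    by (auto simp: overshoot_def)
  moreover have op: "open ({0<..} \<inter> (\<lambda>A. margin A s) -` {0<..})" if s: "0 < s" for s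
  proof (rule continuous_open_preimage)
    have "rho A s \<noteq> 0" "sqrt (rho A s) \<noteq> 0" if "0 < A" for A using rho_pos[OF that s] by auto
    then show "continuous_on {0<..} (\<lambda>A. margin A s)"
      unfolding margin_def energy_def excess_def rho_def using s
      by (intro continuous_intros continuous_numer_param continuous_sol_param) auto
  qed auto
  ultimately show ?thesis by (simp only:) (rule open_UN, rule ballI, rule op, simp)
qed

lemma open_undershoot: "open undershoot"
proof -
  have "undershoot = (\<Union>s\<in>{0<..}. {0<..} \<inter> (\<lambda>A. numer (sol A) s) -` {..<0})"
    by (auto simp: undershoot_def)
  moreover have op: "open ({0<..} \<inter> (\<lambda>A. numer (sol A) s) -` {..<0})" if s: "0 < s" for s
    by (rule continuous_open_preimage)
      (use s in \<open>auto intro!: continuous_numer_param\<close>)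
  ultimately show ?thesis by (simp only:) (rule open_UN, rule ballI, rule op, simp)
qed

text \<open>As A tends to 0, \<open>numer (sol A) s\<close> tends to its value for L = 0, which is
  the integral in the hypothesis.\<close>

lemma undershoot_nonempty:
  assumes s: "0 < s" and neg: "integral {0..s} (\<lambda>t. t * b t * sin2 n t) < 0"
  shows "undershoot \<noteq> {}"
proof -
  have z: "numer (sol 0) s < 0" using neg by (simp add: numer_def sol_zero_param)
  obtain C where C: "\<forall>A\<in>{0..1}. \<forall>B\<in>{0..1}. \<bar>numer (sol A) s - numer (sol B) s\<bar> \<le> C * \<bar>A - B\<bar>"
    using numer_param_Lipschitz[of s 1] s by auto
  \<comment> \<open>Small enough that the Lipschitz error is at most half the size of
    \<open>numer (sol 0) s\<close>.\<close>
  define A where "A = min 1 (- numer (sol 0) s / (2 * (\<bar>C\<bar> + 1)))"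
  have A: "0 < A" "A \<le> 1" "A \<le> - numer (sol 0) s / (2 * (\<bar>C\<bar> + 1))"
    using z by (auto simp: A_def divide_neg_pos)
  have "\<bar>numer (sol A) s - numer (sol 0) s\<bar> \<le> C * A" using C[rule_format, of A 0] A(1,2) by simp
  also have "\<dots> \<le> (\<bar>C\<bar> + 1) * A" using A by (intro mult_right_mono) auto
  also have "\<dots> \<le> (\<bar>C\<bar> + 1) * (- numer (sol 0) s / (2 * (\<bar>C\<bar> + 1)))" using A by (intro mult_left_mono) auto
  also have "\<dots> = - numer (sol 0) s / 2" by (simp add: field_simps)
  finally have "numer (sol A) s < 0" using z by (simp add: abs_le_iff)
  then show ?thesis using A s by (auto simp: undershoot_def)
qed

text \<open>At a fixed s, L is bounded below by - C r^2 / 2. If r^2 were below B for some large A,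
  then r^2 = A s^2 exp (2 L) \<ge> A s^2 exp (- C |B|) would exceed B.\<close>

lemma rho_unbounded_param:
  assumes s: "0 < s"
  shows "\<exists>A>0. B \<le> rho A s"
proof -
  define C where "C = \<beta> * (1 + s ^ (2*n)) / n\<^sup>2"
  have C: "0 \<le> C" using beta_nonneg s by (simp add: C_def)
  have ratio: "ratio A (sol A) x \<le> C * rho A x" if A: "0 < A" and x: "0 < x" "x \<le> s" for A x
  proof -
    have "excess A x \<le> 2 * rho A x * (\<Gamma> x - \<Gamma> 0)" using excess_le[OF A, of x] x by simp
    also have "\<dots> \<le> 2 * rho A x * (\<beta> * (1 - cosn n x))"
      using x A rho_pos[OF A x(1)] by (intro mult_left_mono Gamma_diff_le) auto
    also have "\<dots> = rho A x * (\<beta> * (1 + x ^ (2*n))) * sin2 n x"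
      by (simp add: one_minus_cosn)
    also have "\<dots> \<le> rho A x * (\<beta> * (1 + s ^ (2*n))) * sin2 n x"
      using x rho_pos[OF A x(1)] beta_nonneg sin2_nonneg[of n x]
      by (intro mult_left_mono mult_right_mono add_left_mono power_mono) auto
    also have "\<dots> = C * rho A x * (n\<^sup>2 * sin2 n x)" using n_pos by (simp add: C_def)
    finally show ?thesis
      using n_pos sin2_pos[OF x(1), of n] by (simp add: ratio_excess pos_divide_le_eq)
  qed
  \<comment> \<open>The function 2 L + C r^2 vanishes at 0 and is nondecreasing. The sign of its
    derivative amounts to \<open>wroot\<close> \<le> 1 + C r^2, a consequence of ratio \<le> C
    r^2.\<close>
  have key: "0 \<le> 2 * sol A s + C * rho A s" if A: "0 < A" for A
  proof -
    have "2 * sol A 0 + C * rho A 0 \<le> 2 * sol A s + C * rho A s"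
    proof (rule nondecreasing_on_Icc[where f = "\<lambda>s. 2 * sol A s + C * rho A s" and f' = "\<lambda>s. 2 * (- (1 - 1 / wroot A s) / s) + C * (2 * rho A s / (s * wroot A s))"])
      have "continuous_on {0..s} (sol A)" "continuous_on {0..s} (rho A)"
        using A s by (auto intro: continuous_on_subset[OF continuous_sol] continuous_on_subset[OF continuous_rho])
      then show "continuous_on {0..s} (\<lambda>s. 2 * sol A s + C * rho A s)" by (intro continuous_intros)
      fix x assume x: "0 < x" "x < s"
      show "((\<lambda>s. 2 * sol A s + C * rho A s) has_real_derivative
          2 * (- (1 - 1 / wroot A x) / x) + C * (2 * rho A x / (x * wroot A x))) (at x)"
        using A x by (intro DERIV_add DERIV_cmult DERIV_sol DERIV_rho) auto
      have "wroot A x \<le> 1 + C * rho A x"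
      proof -
        define z where "z = C * rho A x"
        have z: "0 \<le> z" "ratio A (sol A) x \<le> z" using C rho_pos[OF A x(1)] ratio[OF A x(1)] x by (auto simp: z_def)
        have "max 0 (ratio A (sol A) x) \<le> z" using z by simp
        then have "1 + max 0 (ratio A (sol A) x) \<le> 1 + 2 * z + z\<^sup>2"
          using z(1) zero_le_power2[of z] by linarith
        also have "\<dots> = (1 + z)\<^sup>2" by (simp add: power2_eq_square algebra_simps)
        finally show ?thesis using z unfolding wroot_def z_def[symmetric] by (intro real_le_lsqrt) auto
      qed
      then have "0 \<le> (2 / (x * wroot A x)) * (1 + C * rho A x - wroot A x)"
        using x wroot_pos[of A x] by (intro mult_nonneg_nonneg) auto
      also have "\<dots> = 2 * (- (1 - 1 / wroot A x) / x) + C * (2 * rho A x / (x * wroot A x))"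
        using x wroot_pos[of A x] by (simp add: field_simps)
      finally show "0 \<le> 2 * (- (1 - 1 / wroot A x) / x) + C * (2 * rho A x / (x * wroot A x))" .
    qed (use s in auto)
    then show ?thesis using A by simp
  qed
  \<comment> \<open>Makes A s^2 exp (- C |B|) equal to |B| + 1.\<close>
  define A where "A = (\<bar>B\<bar> + 1) * exp (C * \<bar>B\<bar>) / s\<^sup>2"
  have A: "0 < A" using s by (simp add: A_def add_nonneg_pos)
  have "B \<le> rho A s"
  proof (rule ccontr)
    assume "\<not> B \<le> rho A s"
    then have "C * rho A s \<le> C * \<bar>B\<bar>" using C by (intro mult_left_mono) auto
    then have "exp (- (C * \<bar>B\<bar>)) \<le> exp (2 * sol A s)" using key[OF A] by simp
    then have "A * s\<^sup>2 * exp (- (C * \<bar>B\<bar>)) \<le> rho A s"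
      unfolding rho_def using A by (intro mult_left_mono) auto
    moreover have "A * s\<^sup>2 * exp (- (C * \<bar>B\<bar>)) = \<bar>B\<bar> + 1"
      using s by (simp add: A_def exp_minus)
    ultimately show False using \<open>\<not> B \<le> rho A s\<close> by simp
  qed
  then show ?thesis using A by blast
qed

text \<open>Before \<sigma> the energy is positive, and at a height where \<Gamma> < 0 the term - 2
  \<Gamma> of the margin is a gain independent of A. For large A the damping term does not exceed
  this gain.\<close>

lemma overshoot_nonempty: "overshoot \<noteq> {}"
proof -
  obtain s where s: "0 < s" "s < \<sigma>" "\<Gamma> s < 0"
  proof -
    have "(\<Gamma> \<longlongrightarrow> \<Gamma> 0) (at 0 within {0..})"
      using continuous_Gamma by (auto simp: continuous_on)
    then have "(\<Gamma> \<longlongrightarrow> \<Gamma> 0) (at_right 0)" by (rule tendsto_within_subset) auto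
    from order_tendstoD(2)[OF this Gamma_0] obtain d where d: "0 < d" "\<And>x. 0 < x \<Longrightarrow> x < d \<Longrightarrow> \<Gamma> x < 0"
      by (auto simp: eventually_at_right_field)
    show thesis
      by (rule that[of "min d \<sigma> / 2"]) (use d \<sigma> in \<open>auto simp: min_def\<close>)
  qed
  obtain A where A: "0 < A" "(sqrt emax * pi / (- \<Gamma> s))\<^sup>2 \<le> rho A s"
    using rho_unbounded_param[OF s(1)] by blast
  have e: "0 < energy A s"
    using excess_pos[OF A(1) s(1)] s rho_pos[OF A(1) s(1)] by (simp add: energy_def)
  have "sqrt emax * pi / (- \<Gamma> s) \<le> sqrt (rho A s)" using A(2) by (rule real_le_rsqrt)
  then have "sqrt emax * pi \<le> - \<Gamma> s * sqrt (rho A s)" using s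
    using pos_divide_le_eq[of "- \<Gamma> s" "sqrt emax * pi" "sqrt (rho A s)"] by (simp add: mult.commute)
  moreover have "sqrt emax * (pi - angle n s) \<le> sqrt emax * pi"
    using angle_bounds(1)[OF s(1), of n] emax_pos by (intro mult_left_mono) auto
  ultimately have "sqrt emax * (pi - angle n s) / sqrt (rho A s) \<le> - \<Gamma> s"
    using rho_pos[OF A(1) s(1)] by (simp add: pos_divide_le_eq)
  then have "0 < margin A s" using e by (simp add: margin_def mult.assoc)
  then show ?thesis using A s by (auto simp: overshoot_def)
qed

text \<open>If r^2 \<le> B throughout, then Q \<le> 2 B \<beta> (1 + cos h): a surplus over this
  bound would persist, keep the energy away from 0 and finally make the margin positive. The bound
  on Q keeps \<open>wroot\<close> bounded for s \<ge> 1, so ln (r^2) grows at least like a multiple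
  of ln s.\<close>

lemma rho_unbounded:
  assumes A: "0 < A" and no: "A \<notin> overshoot"
  shows "\<exists>s>0. B < rho A s"
proof (rule ccontr)
  assume "\<not> ?thesis"
  then have le: "rho A s \<le> B" if "0 < s" for s using that by force
  have B: "0 < B" using le[of 1] rho_pos[OF A, of 1] by simp
  have d: "excess A s \<le> 2 * B * (\<beta> * (1 + cosn n s))" if s: "0 < s" for s
  proof (rule ccontr)
    define D where "D = (\<lambda>s. excess A s - 2 * B * (\<beta> * (1 + cosn n s)))"
    assume "\<not> excess A s \<le> 2 * B * (\<beta> * (1 + cosn n s))"
    then have Ds: "0 < D s" by (simp add: D_def)
    have mono: "D s \<le> D t" if "s \<le> t" for t
      using that
    proof (rule nondecreasing_on_Icc[where f' = "\<lambda>s. 2 * rho A s * (n * b s * sin2 n s / s) - 2 * B * (\<beta> * (0 + (- (n * sin2 n s / s))))"])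
      show "continuous_on {s..t} D"
        using A s unfolding D_def by (intro continuous_intros continuous_on_subset[OF continuous_excess, of A "{s..t}"]) auto
      fix x assume x: "s < x" "x < t"
      then have x0: "0 < x" using s by simp
      show "(D has_real_derivative 2 * rho A x * (n * b x * sin2 n x / x) - 2 * B * (\<beta> * (0 + (- (n * sin2 n x / x))))) (at x)"
        unfolding D_def by (intro DERIV_diff DERIV_cmult DERIV_add DERIV_const DERIV_excess DERIV_cosn A x0 n)
      have "- (B * \<beta>) \<le> rho A x * b x"
      proof -
        have "rho A x * \<bar>b x\<bar> \<le> B * \<beta>"
          using le[OF x0] b_bound[of x] x0 rho_pos[OF A x0] B by (intro mult_mono) auto
        moreover have "\<bar>rho A x * b x\<bar> = rho A x * \<bar>b x\<bar>" using rho_pos[OF A x0] by (simp add: abs_mult)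
        ultimately show ?thesis by linarith
      qed
      then have "0 \<le> (2 * n * sin2 n x / x) * (rho A x * b x + B * \<beta>)"
        using x0 sin2_nonneg[of n x] by (intro mult_nonneg_nonneg divide_nonneg_nonneg) auto
      then show "0 \<le> 2 * rho A x * (n * b x * sin2 n x / x) - 2 * B * (\<beta> * (0 + (- (n * sin2 n x / x))))"
        by (simp add: algebra_simps add_divide_distrib)
    qed
    \<comment> \<open>As t grows, \<Gamma> tends to 0 and the angle to \<pi>, so only the persistent
      surplus is left. The fixed \<open>rho A s\<close> replaces \<open>rho A t\<close>, which can
      only make the damping term larger.\<close>
    have "((\<lambda>t. D s / B - 2 * \<Gamma> t - 2 * sqrt emax * (pi - angle n t) / sqrt (rho A s))
        \<longlongrightarrow> D s / B - 2 * 0 - 2 * sqrt emax * (pi - pi) / sqrt (rho A s)) at_top"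
      using rho_pos[OF A s] by (intro tendsto_intros Gamma_at_top angle_at_top n) auto
    then have "\<forall>\<^sub>F t in at_top. 0 < D s / B - 2 * \<Gamma> t - 2 * sqrt emax * (pi - angle n t) / sqrt (rho A s)"
      by (rule order_tendstoD(1)) (use Ds B in simp)
    from eventually_happens'[OF _ eventually_conj[OF this eventually_ge_at_top[of s]]] obtain t where
      t: "0 < D s / B - 2 * \<Gamma> t - 2 * sqrt emax * (pi - angle n t) / sqrt (rho A s)" "s \<le> t" by auto
    have t0: "0 < t" using t s by simp
    have "D s / B \<le> energy A t"
    proof -
      have "D s \<le> excess A t"
      proof -
        have "0 \<le> 2 * B * (\<beta> * (1 + cosn n t))" using B beta_nonneg cosn_le[of n t] by simp
        then show ?thesis using mono[OF t(2)] by (simp add: D_def)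
      qed
      then have "D s / B \<le> excess A t / B" using B by (intro divide_right_mono) auto
      also have "\<dots> \<le> excess A t / rho A t"
        using \<open>D s \<le> excess A t\<close> Ds B le[OF t0] rho_pos[OF A t0] by (intro divide_left_mono) auto
      finally show ?thesis by (simp add: energy_def)
    qed
    moreover have "2 * sqrt emax * (pi - angle n t) / sqrt (rho A t) \<le> 2 * sqrt emax * (pi - angle n t) / sqrt (rho A s)"
      using emax_pos angle_bounds(2)[of n t] rho_mono_le[OF A, of s t] s t rho_pos[OF A s] rho_pos[OF A t0]
      by (intro divide_left_mono) auto
    ultimately have "0 < margin A t" using t by (simp add: margin_def)
    then show False using no A t0 by (auto simp: overshoot_def)
  qed
  define w where "w = sqrt (1 + 2 * B * \<beta> / n\<^sup>2)"
  have w: "0 < w" using B beta_nonneg by (auto simp: w_def intro!: add_pos_nonneg)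
  have root: "wroot A s \<le> w" if s: "1 \<le> s" for s
  proof -
    have "excess A s \<le> 2 * B * (\<beta> * (1 + cosn n s))" using d[of s] s by simp
    also have "\<dots> \<le> 2 * B * (\<beta> * sin2 n s)"
      using B beta_nonneg one_plus_cosn_le[OF s] by (intro mult_left_mono) auto
    finally have "ratio A (sol A) s \<le> 2 * B * \<beta> / n\<^sup>2"
      using sin2_pos[of s n] s n_pos by (simp add: ratio_excess field_simps)
    moreover have "0 \<le> 2 * B * \<beta> / n\<^sup>2" using B beta_nonneg by simp
    ultimately show ?thesis by (simp add: wroot_def w_def)
  qed
  \<comment> \<open>With e the fraction in the exponent, e + 1 + |e| is at least 1 and exceeds e, so
    that s \<ge> 1 and ln s > e whatever the sign of e.\<close>
  define s where "s = exp (w * (ln B - ln (rho A 1) + 1) / 2 + 1 + \<bar>w * (ln B - ln (rho A 1) + 1) / 2\<bar>)"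
  have s: "1 \<le> s" by (simp add: s_def)
  have "ln (rho A 1) - 2 / w * ln 1 \<le> ln (rho A s) - 2 / w * ln s"
  proof (rule nondecreasing_on_Icc[OF s, where f = "\<lambda>s. ln (rho A s) - 2 / w * ln s" and f' = "\<lambda>s. 1 / rho A s * (2 * rho A s / (s * wroot A s)) - 2 / w * (1 / s)"])
    show "continuous_on {1..s} (\<lambda>s. ln (rho A s) - 2 / w * ln s)"
    proof (intro continuous_intros)
      show "continuous_on {1..s} (rho A)" using A by (intro continuous_on_subset[OF continuous_rho]) auto
      show "\<forall>x\<in>{1..s}. rho A x \<noteq> 0"
      proof
        fix x assume "x \<in> {1..s}"
        then show "rho A x \<noteq> 0" using rho_pos[OF A, of x] by simp
      qed
    qed (use w in auto)
    fix x assume x: "1 < x" "x < s"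
    show "((\<lambda>s. ln (rho A s) - 2 / w * ln s) has_real_derivative
       1 / rho A x * (2 * rho A x / (x * wroot A x)) - 2 / w * (1 / x)) (at x)"
    proof (intro DERIV_diff DERIV_cmult)
      show "((\<lambda>s. ln (rho A s)) has_real_derivative 1 / rho A x * (2 * rho A x / (x * wroot A x))) (at x)"
        by (rule DERIV_chain2[OF DERIV_ln_divide DERIV_rho]) (use A x rho_pos[of A x] in auto)
      show "(ln has_real_derivative 1 / x) (at x)" using x by (intro DERIV_ln_divide) auto
    qed
    have "2 / (x * w) \<le> 2 / (x * wroot A x)"
      using x root[of x] w wroot_pos[of A x] by (intro divide_left_mono mult_left_mono mult_pos_pos) auto
    then show "0 \<le> 1 / rho A x * (2 * rho A x / (x * wroot A x)) - 2 / w * (1 / x)"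
      using rho_pos[OF A, of x] x by (simp add: mult.commute)
  qed
  then have "ln (rho A 1) + 2 / w * ln s \<le> ln (rho A s)" by simp
  also have "\<dots> \<le> ln B" using le[of s] s rho_pos[OF A, of s] by simp
  finally have "2 / w * ln s \<le> ln B - ln (rho A 1)" by simp
  then have "ln s \<le> w * (ln B - ln (rho A 1)) / 2" using w by (simp add: field_simps)
  moreover have "w * (ln B - ln (rho A 1) + 1) / 2 < ln s" by (simp add: s_def)
  moreover have "w * (ln B - ln (rho A 1)) / 2 \<le> w * (ln B - ln (rho A 1) + 1) / 2" using w by (simp add: mult_left_mono)
  ultimately show False by simp
qed

theorem balanced_parameter:
  assumes s: "0 < s" and neg: "integral {0..s} (\<lambda>t. t * b t * sin2 n t) < 0"
  obtains A where "0 < A" "\<And>s. 0 \<le> s \<Longrightarrow> 0 \<le> excess A s" "\<And>B. \<exists>s>0. B < rho A s"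
proof -
  have "\<not> {0<..} \<subseteq> overshoot \<union> undershoot"
  proof
    assume sub: "{0<..} \<subseteq> overshoot \<union> undershoot"
    have "overshoot \<inter> {0<..} = {} \<or> undershoot \<inter> {0<..} = {}"
      using overshoot_undershoot_disjoint
      by (intro connectedD[OF connected_Ioi open_overshoot open_undershoot _ sub]) auto
    moreover have "overshoot \<subseteq> {0<..}" "undershoot \<subseteq> {0<..}"
      by (auto simp: overshoot_def undershoot_def)
    ultimately show False using overshoot_nonempty undershoot_nonempty[OF s neg] by auto
  qed
  then obtain A where A: "0 < A" "A \<notin> overshoot" "A \<notin> undershoot" by auto
  show thesis
  proof (rule that[OF A(1)])
    show "0 \<le> excess A s" if "0 \<le> s" for s
    proof (cases "s = 0")
      case False
      then show ?thesis
        using A that excess_neg_iff[OF A(1), of s] by (fastforce simp: undershoot_def)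
    qed simp
    show "\<exists>s>0. B < rho A s" for B by (rule rho_unbounded[OF A(1,2)])
  qed
qed

end

section \<open>The profile as a function of the squared radius\<close>

lemma at_within_Ici_0: "at (0::real) within {0..} = at_right 0"
  by (rule at_within_Ici_at_right)

lemma at_right_pos: "\<forall>\<^sub>F v in at_right 0. 0 < (v::real)"
  by (simp add: eventually_at_right_less)

lemma tendsto_at_right_0:
  "continuous_on {0..} f \<Longrightarrow> (f \<longlongrightarrow> f (0::real)) (at_right 0)"
  unfolding continuous_on by (auto simp flip: at_within_Ici_0)

text \<open>L'Hospital's rule for the difference quotient. It yields one-sided derivatives at 0 from
  limits, where the formulas themselves are singular.\<close>

lemma DERIV_at_0_by_limit:
  fixes f :: "real \<Rightarrow> real"
  assumes cont: "continuous_on {0..} f"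
    and der: "\<And>x. 0 < x \<Longrightarrow> (f has_real_derivative f' x) (at x)"
    and lim: "(f' \<longlongrightarrow> l) (at_right 0)"
  shows "(f has_real_derivative l) (at 0 within {0..})"
proof -
  have ev: "\<forall>\<^sub>F x in at_right 0. 0 < (x::real)" by (simp add: eventually_at_right_less)
  have "(f \<longlongrightarrow> f 0) (at_right 0)"
    using cont unfolding continuous_on by (auto simp flip: at_within_Ici_0)
  then have l0: "((\<lambda>x. f x - f 0) \<longlongrightarrow> 0) (at_right 0)" by (rule LIM_zero)
  have "((\<lambda>x. (f x - f 0) / x) \<longlongrightarrow> l) (at_right 0)"
  proof (rule lhopital_right_0[where ?f0.0 = "\<lambda>x. f x - f 0" and ?g0.0 = "\<lambda>x. x" and f' = f' and g' = "\<lambda>_. 1", OF l0])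
    show "\<forall>\<^sub>F x in at_right 0. ((\<lambda>x. f x - f 0) has_real_derivative f' x) (at x)"
      using ev
    proof eventually_elim
      case (elim x)
      show ?case using DERIV_diff[OF der[OF elim] DERIV_const[of "f 0"]] by simp
    qed
    show "\<forall>\<^sub>F x in at_right 0. x \<noteq> (0::real)" using ev by eventually_elim simp
    show "((\<lambda>x. f' x / 1) \<longlongrightarrow> l) (at_right 0)" using lim by simp
  qed (auto intro: tendsto_ident_at)
  then show ?thesis unfolding has_field_derivative_iff at_within_Ici_0 by simp
qed

text \<open>Regularity of a radial profile as a function of \<open>\<bar>x\<bar>\<^sup>2\<close> that makes it \<open>C\<^sup>2\<close> on the plane.\<close>

definition radial_C2 :: "(real \<Rightarrow> real) \<Rightarrow> (real \<Rightarrow> real) \<Rightarrow> (real \<Rightarrow> real) \<Rightarrow> bool" where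
  "radial_C2 f f1 f2 \<longleftrightarrow>
     (\<forall>x\<ge>0. (f has_real_derivative f1 x) (at x within {0..})) \<and> continuous_on {0..} f1 \<and>
     (\<forall>x>0. (f1 has_real_derivative f2 x) (at x)) \<and> continuous_on {0<..} f2 \<and>
     ((\<lambda>x. x * f2 x) \<longlongrightarrow> 0) (at_right 0)"

lemma continuous_on_Ici:
  fixes f :: "real \<Rightarrow> real"
  assumes "continuous_on {0<..} f" "(f \<longlongrightarrow> f 0) (at_right 0)"
  shows "continuous_on {0..} f"
  unfolding continuous_on_eq_continuous_within
proof
  fix x :: real assume "x \<in> {0..}"
  then consider "x = 0" | "0 < x" by fastforce
  then show "continuous (at x within {0..}) f"
  proof cases
    case 1
    then show ?thesis using assms(2) by (simp add: continuous_within at_within_Ici_0)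
  next
    case 2
    then have "continuous (at x) f" using assms(1) by (simp add: continuous_on_eq_continuous_at)
    then show ?thesis by (rule continuous_at_imp_continuous_at_within)
  qed
qed

text \<open>The algebra behind \<open>K_C_equation\<close>, with R = r^2 and N = n. The relations
  are multiplied by powers of R so that they contain no division by it. On the left, 4 R C2 + 4 C1
  is the planar Laplacian of C(r^2); on the right stands the radial factor of the Laplacian of
  K(r^2) z^n.\<close>

lemma profile_equation:
  fixes R K C Y b P N :: real
  assumes R: "R \<noteq> 0" "N \<noteq> 0" and P: "P = 1 - C\<^sup>2"
    and X: "X = C * Y - 1"
    and Y1: "R * Y1 = R * b / (2 * N) - N * C * (Y\<^sup>2 - 1) / 2"
    and X1: "R * X1 = - (N / 2) * P * Y * Y + C * (R * Y1)"
    and C1: "R * C1 = - (N / 2) * P * Y"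
    and C2: "R * (R * C2) = - (N / 2) * (N * P * X * Y + (N - 1) * P * Y + P * (R * Y1))"
    and K1: "R * K1 = N / 2 * K * X"
    and K2: "R * (R * K2) = N / 2 * (N / 2 * K * X * X + K * (R * X1 - X))"
  shows "K * (4 * R * C2 + 4 * C1 + b) = C * (4 * R * K2 + 4 * (N + 1) * K1)"
proof -
  have "R * (K * (4 * R * C2 + 4 * C1 + b)) = K * (4 * (R * (R * C2)) + 4 * (R * C1) + R * b)"
    by (simp add: algebra_simps)
  also have "\<dots> = C * (4 * (R * (R * K2)) + 4 * (N + 1) * (R * K1))"
    unfolding C2 C1 K2 K1 X1 Y1 X P using R by (simp add: field_simps power2_eq_square)
  also have "\<dots> = R * (C * (4 * R * K2 + 4 * (N + 1) * K1))" by (simp add: algebra_simps)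
  finally show ?thesis using R by simp
qed

locale profile = shooting +
  fixes A :: real
  assumes A: "0 < A" and excess_nonneg: "\<And>s. 0 \<le> s \<Longrightarrow> 0 \<le> excess A s"
    and rho_unbounded_at_top: "\<And>B. \<exists>s>0. B < rho A s"
begin

section \<open>Inverting r^2 as a function of s\<close>

definition eta :: "real \<Rightarrow> real" where
  "eta v = (THE s. 0 \<le> s \<and> rho A s = v)"

lemma rho_inj: "0 \<le> s \<Longrightarrow> 0 \<le> t \<Longrightarrow> rho A s = rho A t \<Longrightarrow> s = t"
  using rho_mono[OF A, of s t] rho_mono[OF A, of t s] by (cases s t rule: linorder_cases) auto

lemma eta_unique: "0 \<le> s \<Longrightarrow> eta (rho A s) = s"
  unfolding eta_def by (rule the_equality) (auto intro: rho_inj)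

lemma eta:
  assumes "0 \<le> v"
  shows "0 \<le> eta v" "rho A (eta v) = v"
proof -
  obtain t where t: "0 < t" "v < rho A t" using rho_unbounded_at_top by blast
  have "continuous_on {0..t} (rho A)"
    using A by (intro continuous_on_subset[OF continuous_rho]) auto
  then obtain s where "0 \<le> s" "s \<le> t" "rho A s = v"
    using IVT'[of "rho A" 0 v t] t assms by auto
  then show "0 \<le> eta v" "rho A (eta v) = v" using eta_unique[of s] by auto
qed

lemma eta_0 [simp]: "eta 0 = 0" using eta_unique[of 0] by simp

lemma eta_pos: "0 < v \<Longrightarrow> 0 < eta v"
  using eta[of v] by (cases "eta v = 0") auto

lemma eta_mono: "0 \<le> v \<Longrightarrow> v < w \<Longrightarrow> eta v < eta w"
  using rho_mono_le[OF A, of "eta w" "eta v"] eta[of v] eta[of w] by force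

lemma continuous_at_eta:
  assumes v: "0 < v"
  shows "isCont eta v"
proof -
  have s: "0 < eta v" by (rule eta_pos[OF v])
  have "isCont eta (rho A (eta v))"
  proof (rule isCont_inverse_function[where f = "rho A" and x = "eta v" and d = "eta v / 2"])
    show "0 < eta v / 2" using s by simp
    fix z assume "\<bar>z - eta v\<bar> \<le> eta v / 2"
    then have "eta v - z \<le> eta v / 2" using abs_ge_minus_self[of "z - eta v"] by linarith
    then have z: "0 < z" using s by linarith
    then show "eta (rho A z) = z" by (simp add: eta_unique)
    show "isCont (rho A) z" by (rule DERIV_isCont[OF DERIV_rho[OF A z]])
  qed
  then show ?thesis using eta v by simp
qed

lemma eta_tendsto_0: "filterlim eta (at_right 0) (at_right 0)"
proof -
  have ev: "\<forall>\<^sub>F v in at_right 0. 0 < (v::real)" by (simp add: eventually_at_right_less)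
  then have pos: "\<forall>\<^sub>F v in at_right 0. 0 < eta v" by eventually_elim (rule eta_pos)
  have "(eta \<longlongrightarrow> 0) (at_right 0)"
  proof (rule order_tendstoI)
    fix a :: real assume a: "a < 0"
    show "\<forall>\<^sub>F v in at_right 0. a < eta v" using pos by eventually_elim (use a in simp)
  next
    fix a :: real assume a: "0 < a"
    show "\<forall>\<^sub>F v in at_right 0. eta v < a"
      using eventually_at_right_real[OF rho_pos[OF A a]]
    proof eventually_elim
      case (elim v)
      then show ?case using eta_mono[of v "rho A a"] eta_unique[of a] a by simp
    qed
  qed
  with pos show ?thesis by (simp add: filterlim_at eventually_mono)
qed

lemma continuous_eta: "continuous_on {0..} eta"
proof (rule continuous_on_Ici)
  show "continuous_on {0<..} eta" by (simp add: continuous_on_eq_continuous_at continuous_at_eta)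
  show "(eta \<longlongrightarrow> eta 0) (at_right 0)"
    using eta_tendsto_0 by (auto simp: filterlim_at)
qed

lemma eta_at_top: "filterlim eta at_top at_top"
  unfolding filterlim_at_top
proof
  fix Z :: real
  have "\<forall>\<^sub>F v in at_top. rho A \<bar>Z\<bar> < v" by (rule eventually_gt_at_top)
  then show "\<forall>\<^sub>F v in at_top. Z \<le> eta v"
  proof eventually_elim
    case (elim v)
    have "0 \<le> rho A \<bar>Z\<bar>" using A by (simp add: rho_def)
    then show ?case using eta_mono[OF _ elim] eta_unique[of "\<bar>Z\<bar>"] by simp
  qed
qed

text \<open>At v = r^2, \<open>Y\<close>, \<open>C\<close> and \<open>K\<close> are r h' / (n sin
  h), cos h and sin h / r^n. The last is written without division by r, using s / r = exp (- L) /
  sqrt A, so that it has the right value at v = 0 as well.\<close>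

definition Y :: "real \<Rightarrow> real" where "Y v = wroot A (eta v)"
definition C :: "real \<Rightarrow> real" where "C v = cosn n (eta v)"
definition K :: "real \<Rightarrow> real" where
  "K v = 2 * (exp (- sol A (eta v)) / sqrt A) ^ n / (1 + eta v ^ (2*n))"

lemma K_power:
  assumes v: "0 \<le> v"
  shows "K v * sqrt v ^ n = sin (angle n (eta v))"
proof -
  have "sqrt v = sqrt (A * (eta v)\<^sup>2 * exp (2 * sol A (eta v)))"
    using eta(2)[OF v] by (simp add: rho_def)
  also have "\<dots> = sqrt A * eta v * exp (sol A (eta v))"
  proof -
    have "exp (2 * sol A (eta v)) = (exp (sol A (eta v)))\<^sup>2" by (simp add: power2_eq_square flip: exp_add)
    then show ?thesis using eta(1)[OF v] by (simp add: real_sqrt_mult)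
  qed
  finally have "(exp (- sol A (eta v)) / sqrt A) * sqrt v = eta v"
    using A by (simp add: exp_minus)
  then have "(exp (- sol A (eta v)) / sqrt A) ^ n * sqrt v ^ n = eta v ^ n"
    by (metis power_mult_distrib)
  moreover have "K v * sqrt v ^ n = 2 * ((exp (- sol A (eta v)) / sqrt A) ^ n * sqrt v ^ n) / (1 + eta v ^ (2*n))"
    by (simp add: K_def)
  ultimately show ?thesis by (simp add: sin_angle)
qed

lemma K_squared: "0 \<le> v \<Longrightarrow> (K v)\<^sup>2 * v ^ n = 1 - (C v)\<^sup>2"
proof -
  assume v: "0 \<le> v"
  have "(K v)\<^sup>2 * v ^ n = (K v * sqrt v ^ n)\<^sup>2"
    using v by (simp add: power_mult_distrib power_mult[symmetric] mult.commute[of n 2] power_mult real_sqrt_pow2)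
  also have "\<dots> = 1 - (C v)\<^sup>2" using K_power[OF v] by (simp add: C_def sin2_eq[symmetric] sin2_cosn)
  finally show ?thesis .
qed

lemma ratio_nonneg: "0 \<le> s \<Longrightarrow> 0 \<le> ratio A (sol A) s"
  using excess_nonneg[of s] sin2_nonneg[of n s] by (simp add: ratio_excess)

lemma Y_squared: "0 \<le> v \<Longrightarrow> (Y v)\<^sup>2 = 1 + ratio A (sol A) (eta v)"
  using ratio_nonneg[of "eta v"] eta(1)[of v] by (simp add: Y_def wroot_def max_def)

lemma Y_pos: "0 < Y v" by (simp add: Y_def wroot_pos)

lemma DERIV_eta:
  assumes v: "0 < v"
  shows "(eta has_real_derivative eta v * Y v / (2 * v)) (at v)"
proof -
  have s: "0 < eta v" by (rule eta_pos[OF v])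
  have "(eta has_real_derivative inverse (2 * rho A (eta v) / (eta v * wroot A (eta v)))) (at v)"
  proof (rule DERIV_inverse_function[where f = "rho A" and g = eta and a = 0 and b = "v + 1", OF DERIV_rho[OF A s]])
    show "2 * rho A (eta v) / (eta v * wroot A (eta v)) \<noteq> 0"
      using s v eta(2)[of v] wroot_pos[of A "eta v"] by simp
  qed (use v eta continuous_at_eta in auto)
  then show ?thesis using v eta(2)[of v] by (simp add: Y_def)
qed

lemma DERIV_ratio:
  fixes s :: real
  assumes s: "0 < s"
  shows "(ratio A (sol A) has_real_derivative
    2 * rho A s * b s / (n * s) - 2 * n * cosn n s * ratio A (sol A) s / s) (at s)"
proof -
  define S where "S = sin2 n s"
  have S: "0 < S" using sin2_pos[OF s] by (simp add: S_def)
  have dS: "(sin2 n has_real_derivative 2 * n * cosn n s * S / s) (at s)"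
    using DERIV_sin2[OF s n] by (simp add: S_def)
  have "((\<lambda>s. excess A s / (n\<^sup>2 * sin2 n s)) has_real_derivative
     ((2 * rho A s * (n * b s * S / s)) * (n\<^sup>2 * S) - excess A s * (n\<^sup>2 * (2 * n * cosn n s * S / s)))
       / ((n\<^sup>2 * S) * (n\<^sup>2 * S))) (at s)"
    using n_pos S unfolding S_def
    by (intro DERIV_divide DERIV_cmult DERIV_excess A s dS[unfolded S_def]) auto
  moreover have "((2 * rho A s * (n * b s * S / s)) * (n\<^sup>2 * S) - excess A s * (n\<^sup>2 * (2 * n * cosn n s * S / s)))
       / ((n\<^sup>2 * S) * (n\<^sup>2 * S)) = 2 * rho A s * b s / (n * s) - 2 * n * cosn n s * ratio A (sol A) s / s"
    using n_pos S s by (simp add: ratio_excess S_def[symmetric] field_simps power2_eq_square)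
  ultimately show ?thesis by (simp add: ratio_excess[abs_def])
qed

definition Y1 :: "real \<Rightarrow> real" where
  "Y1 v = b (eta v) / (2 * n) - n * C v * ((Y v)\<^sup>2 - 1) / (2 * v)"

text \<open>From dh/dv = n sin h Y / (2 v) and sin^2 h = K^2 v^n. Cancelling one power of v in
  advance makes the formula continuous at 0.\<close>

definition C1 :: "real \<Rightarrow> real" where
  "C1 v = - (n / 2) * (K v)\<^sup>2 * v ^ (n - 1) * Y v"

lemma DERIV_Y:
  assumes v: "0 < v"
  shows "(Y has_real_derivative Y1 v) (at v)"
proof -
  define s where "s = eta v"
  define y where "y = ratio A (sol A) s"
  have s: "0 < s" "rho A s = v" using eta_pos[OF v] eta(2) v by (auto simp: s_def)
  have y: "0 \<le> y" using ratio_nonneg[of s] s by (simp add: y_def)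
  have "((\<lambda>v. sqrt (1 + ratio A (sol A) (eta v))) has_real_derivative
     inverse (sqrt (1 + y)) / 2 * (0 + (2 * rho A s * b s / (n * s) - 2 * n * cosn n s * y / s) * (s * Y v / (2 * v)))) (at v)"
    unfolding s_def y_def
    by (rule DERIV_chain2[OF DERIV_real_sqrt] DERIV_add DERIV_const DERIV_chain2[OF DERIV_ratio DERIV_eta] v
        | use y in \<open>simp add: y_def s_def eta_pos v add_pos_nonneg\<close>)+
  moreover have "inverse (sqrt (1 + y)) / 2 * (0 + (2 * rho A s * b s / (n * s) - 2 * n * cosn n s * y / s) * (s * Y v / (2 * v))) = Y1 v"
  proof -
    have Yv: "Y v = sqrt (1 + y)" "(Y v)\<^sup>2 = 1 + y"
      using y Y_squared[of v] v by (auto simp: Y_def wroot_def y_def s_def)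
    have Ypos: "Y v \<noteq> 0" using Y_pos[of v] by simp
    show ?thesis
      unfolding Yv(1)[symmetric] Y1_def Yv(2) using s v n_pos Ypos
      by (simp add: C_def s_def[symmetric] field_simps)
  qed
  ultimately have d: "((\<lambda>v. sqrt (1 + ratio A (sol A) (eta v))) has_real_derivative Y1 v) (at v)" by simp
  show ?thesis
  proof (rule has_field_derivative_transform_within_open[OF d, of "{0<..}"])
    fix x :: real assume "x \<in> {0<..}"
    then show "sqrt (1 + ratio A (sol A) (eta x)) = Y x"
      using ratio_nonneg[of "eta x"] eta(1)[of x] by (simp add: Y_def wroot_def max_def)
  qed (use v in auto)
qed

lemma power_split: "v ^ n = v * v ^ (n - 1)"
  using n by (cases n) auto

lemma DERIV_C:
  assumes v: "0 < v"
  shows "(C has_real_derivative C1 v) (at v)"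
proof -
  have "(C has_real_derivative - (n * sin2 n (eta v) / eta v) * (eta v * Y v / (2 * v))) (at v)"
    unfolding C_def[abs_def] by (rule DERIV_chain2[OF DERIV_cosn DERIV_eta]) (use v eta_pos n in auto)
  also have "- (n * sin2 n (eta v) / eta v) * (eta v * Y v / (2 * v)) = - (n / 2) * ((K v)\<^sup>2 * v ^ n) * Y v / v"
  proof -
    have "- (n * S / w) * (w * y / (2 * v)) = - (n / 2) * S * y / v" if "w \<noteq> 0" for S w y :: real
      using that v by simp
    from this[of "eta v"] show ?thesis
      using eta_pos[OF v] v K_squared[of v] by (simp only: sin2_cosn C_def)
  qed
  also have "\<dots> = C1 v" using v by (simp add: C1_def power_split)
  ultimately show ?thesis by simp
qed

lemma DERIV_K:
  assumes v: "0 < v"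
  shows "(K has_real_derivative n / 2 * K v * (C v * Y v - 1) / v) (at v)"
proof -
  define k where "k = (\<lambda>s. 2 * (exp (- sol A s) / sqrt A) ^ n / (1 + s ^ (2*n)))"
  define s where "s = eta v"
  have s: "0 < s" using eta_pos[OF v] by (simp add: s_def)
  define P where "P = 1 + s ^ (2*n)"
  have P: "P \<noteq> 0" using one_plus_power_neq[of s n] by (simp add: P_def)
  define E where "E = exp (- sol A s) / sqrt A"
  have pw: "s ^ (2*n) = s * s ^ (2*n-1)" "E ^ n = E * E ^ (n - 1)"
    using n by (simp_all flip: power_Suc)
  have "((\<lambda>s. exp (- sol A s) / sqrt A) has_real_derivative exp (- sol A s) * - (- (1 - 1 / wroot A s) / s) / sqrt A) (at s)"
    using A s by (intro DERIV_cdivide DERIV_chain2[OF DERIV_exp] DERIV_minus DERIV_sol) auto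
  moreover have "exp (- sol A s) * - (- (1 - 1 / wroot A s) / s) / sqrt A = E * ((1 - 1 / wroot A s) / s)"
    by (simp add: E_def right_diff_distrib diff_divide_distrib mult.commute)
  ultimately have "((\<lambda>s. exp (- sol A s) / sqrt A) has_real_derivative E * ((1 - 1 / wroot A s) / s)) (at s)"
    by metis
  from DERIV_cmult[OF DERIV_power[OF this, of n], of 2]
  have "((\<lambda>s. 2 * (exp (- sol A s) / sqrt A) ^ n) has_real_derivative
     2 * (real n * (E * ((1 - 1 / wroot A s) / s) * E ^ (n - 1)))) (at s)"
    by (simp add: E_def)
  moreover have "((\<lambda>s. 1 + s ^ (2*n)) has_real_derivative real (2*n) * s ^ (2*n-1)) (at s)"
    by (auto intro!: derivative_eq_intros)
  ultimately have "(k has_real_derivative ((2 * (real n * (E * ((1 - 1 / wroot A s) / s) * E ^ (n - 1)))) * P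
      - (2 * E ^ n) * (real (2*n) * s ^ (2*n-1))) / (P * P)) (at s)"
    unfolding k_def P_def E_def by (rule DERIV_divide) (use P in \<open>simp add: P_def\<close>)
  moreover have "((2 * (real n * (E * ((1 - 1 / wroot A s) / s) * E ^ (n - 1)))) * P
      - (2 * E ^ n) * (real (2*n) * s ^ (2*n-1))) / (P * P) = n / s * k s * (cosn n s - 1 / wroot A s)"
  proof -
    define W where "W = 1 / wroot A s"
    have ks: "k s = 2 * E ^ n / P" by (simp add: k_def E_def P_def)
    have cs: "cosn n s = (2 - P) / P" by (simp add: cosn_def P_def)
    have sp: "s ^ (2*n-1) = (P - 1) / s" using s by (simp add: P_def pw)
    have "((2 * (real n * (E * ((1 - W) / s) * E ^ (n - 1)))) * P - (2 * E ^ n) * (real (2*n) * s ^ (2*n-1))) / (P * P)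
        = ((2 * (real n * (E ^ n * ((1 - W) / s)))) * P - (2 * E ^ n) * (real (2*n) * ((P - 1) / s))) / (P * P)"
      unfolding sp pw(2) by (simp add: mult_ac)
    also have "\<dots> = n / s * (2 * E ^ n / P) * ((2 - P) / P - W)"
      using s P by (simp add: divide_simps) (simp add: algebra_simps)
    finally show ?thesis unfolding ks cs W_def .
  qed
  ultimately have "(k has_real_derivative n / s * k s * (cosn n s - 1 / wroot A s)) (at s)" by simp
  then have "((\<lambda>v. k (eta v)) has_real_derivative (n / s * k s * (cosn n s - 1 / wroot A s)) * (s * Y v / (2 * v))) (at v)"
    unfolding s_def by (rule DERIV_chain2[OF _ DERIV_eta[OF v]])
  moreover have "(n / s * k s * (cosn n s - 1 / wroot A s)) * (s * Y v / (2 * v)) = n / 2 * K v * (C v * Y v - 1) / v"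
  proof -
    have "(n / s * x * (c - 1 / W)) * (s * W / (2 * v)) = n / 2 * x * (c * W - 1) / v" if "W \<noteq> 0" for x c W :: real
      using s v that by (simp add: field_simps)
    from this[OF less_imp_neq[OF wroot_pos, symmetric]] show ?thesis
      by (simp only: Y_def C_def K_def k_def s_def[symmetric])
  qed
  moreover have "(\<lambda>v. k (eta v)) = K" by (simp add: k_def K_def fun_eq_iff)
  ultimately show ?thesis by metis
qed

section \<open>Limits at the origin of the plane\<close>

text \<open>L'Hospital's rule: s^2 sin^2 h has derivative 2 s sin^2 h (1 + n cos h), so
  \<open>numer\<close> divided by s^2 sin^2 h tends to b 0 / (2 (n + 1)). The factor 2 A / n of the
  ratio and r^2 = A s^2 exp (2 L) give the stated constant.\<close>

lemma ratio_over_rho: "((\<lambda>s. ratio A (sol A) s / rho A s) \<longlongrightarrow> b 0 / (n * (n + 1))) (at_right 0)"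
proof -
  define num' where "num' = (\<lambda>s. s * exp (2 * sol A s) * b s * sin2 n s)"
  define den' where "den' = (\<lambda>s. 2 * s * sin2 n s * (1 + n * cosn n s))"
  have A0: "0 \<le> A" using A by simp
  note lims = tendsto_at_right_0[OF b_cont] tendsto_at_right_0[OF continuous_sol[OF A0]]
    tendsto_at_right_0[OF continuous_cosn[OF continuous_on_id]]
    tendsto_at_right_0[OF continuous_on_sin2[OF continuous_on_id]]
  have cpos: "\<forall>\<^sub>F s in at_right 0. 0 < cosn n s"
    by (rule order_tendstoD(1)[OF lims(3)]) (use n_pos in simp)
  have q: "((\<lambda>s. numer (sol A) s / (s\<^sup>2 * sin2 n s)) \<longlongrightarrow> b 0 / (2 * (1 + n))) (at_right 0)"
  proof (rule lhopital_right_0[where f' = num' and g' = den'])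
    show "(numer (sol A) \<longlongrightarrow> 0) (at_right 0)"
      using tendsto_at_right_0[OF continuous_on_numer[OF admissible_sol[OF A0]]] by (simp add: numer_def)
    have "((\<lambda>s. s\<^sup>2 * sin2 n s) \<longlongrightarrow> 0\<^sup>2 * sin2 n 0) (at_right 0)"
      by (intro tendsto_intros lims)
    then show "((\<lambda>s. s\<^sup>2 * sin2 n s) \<longlongrightarrow> 0) (at_right 0)" by simp
    show "\<forall>\<^sub>F s in at_right 0. s\<^sup>2 * sin2 n s \<noteq> 0"
      using at_right_pos
    proof eventually_elim
      case (elim s)
      then show ?case using sin2_pos[OF elim, of n] by simp
    qed
    show "\<forall>\<^sub>F s in at_right 0. den' s \<noteq> 0"
      using at_right_pos cpos
    proof eventually_elim
      case (elim s)
      have "0 < 1 + n * cosn n s" using elim by (intro add_pos_nonneg) auto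
      then show ?case using elim sin2_pos[OF elim(1), of n] by (simp add: den'_def)
    qed
    show "\<forall>\<^sub>F s in at_right 0. (numer (sol A) has_real_derivative num' s) (at s)"
      using at_right_pos
    proof eventually_elim
      case (elim s)
      then show ?case unfolding numer_def[abs_def] num'_def
        by (rule DERIV_primitive[OF continuous_on_integrand[OF admissible_sol[OF A0]]])
    qed
    show "\<forall>\<^sub>F s in at_right 0. ((\<lambda>s. s\<^sup>2 * sin2 n s) has_real_derivative den' s) (at s)"
      using at_right_pos
    proof eventually_elim
      case (elim s)
      have "((\<lambda>s. s\<^sup>2 * sin2 n s) has_real_derivative (2 * s) * sin2 n s + 2 * real n * cosn n s * sin2 n s / s * s\<^sup>2) (at s)"
        by (rule DERIV_mult[OF _ DERIV_sin2[OF elim n]]) (auto intro!: derivative_eq_intros)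
      moreover have "(2 * s) * sin2 n s + 2 * real n * cosn n s * sin2 n s / s * s\<^sup>2 = den' s"
        using elim by (simp add: den'_def power2_eq_square algebra_simps)
      ultimately show ?case by simp
    qed
    have "((\<lambda>s. exp (2 * sol A s) * b s / (2 * (1 + n * cosn n s))) \<longlongrightarrow>
        exp (2 * sol A 0) * b 0 / (2 * (1 + n * cosn n 0))) (at_right 0)"
      using n_pos by (intro tendsto_intros lims) auto
    then have "((\<lambda>s. exp (2 * sol A s) * b s / (2 * (1 + n * cosn n s))) \<longlongrightarrow> b 0 / (2 * (1 + n))) (at_right 0)"
      using A n_pos by simp
    then show "((\<lambda>s. num' s / den' s) \<longlongrightarrow> b 0 / (2 * (1 + n))) (at_right 0)"
    proof (rule Lim_transform_eventually)
      show "\<forall>\<^sub>F s in at_right 0. exp (2 * sol A s) * b s / (2 * (1 + n * cosn n s)) = num' s / den' s"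
        using at_right_pos
      proof eventually_elim
        case (elim s)
        have "x * y * z * S / (2 * x * S * w) = y * z / (2 * w)" if "S \<noteq> 0" "x \<noteq> 0" for x y z S w :: real
          using that by simp
        from this[of "sin2 n s" s] show ?case
          unfolding num'_def den'_def using elim sin2_pos[OF elim, of n] by simp
      qed
    qed
  qed
  have "((\<lambda>s. 2 / n * (numer (sol A) s / (s\<^sup>2 * sin2 n s)) / exp (2 * sol A s)) \<longlongrightarrow>
      2 / n * (b 0 / (2 * (1 + n))) / exp (2 * sol A 0)) (at_right 0)"
    by (rule tendsto_divide[OF tendsto_mult_left[OF q] tendsto_exp[OF tendsto_mult_left[OF lims(2)]]]) simp
  then have "((\<lambda>s. 2 / n * (numer (sol A) s / (s\<^sup>2 * sin2 n s)) / exp (2 * sol A s)) \<longlongrightarrow> b 0 / (n * (n + 1))) (at_right 0)"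
  proof (rule back_subst[where P = "\<lambda>l. (_ \<longlongrightarrow> l) (at_right 0)"])
    have e: "exp (2 * sol A 0) = 1" using A by simp
    have "2 / N * (B / (2 * (1 + N))) = B / (N * (N + 1))" if "0 < N" for N B :: real
    proof -
      have nz: "N * (2 * (1 + N)) \<noteq> 0" "N * (N + 1) \<noteq> 0" using that by auto
      show ?thesis
        unfolding times_divide_times_eq frac_eq_eq[OF nz] by (simp add: algebra_simps)
    qed
    from this[of "real n" "b 0"] n_pos
    show "2 / n * (b 0 / (2 * (1 + n))) / exp (2 * sol A 0) = b 0 / (n * (n + 1))"
      by (simp only: e div_by_1 of_nat_mult of_nat_add of_nat_1 of_nat_numeral of_nat_0_less_iff)
  qed
  then show ?thesis
  proof (rule Lim_transform_eventually)
    show "\<forall>\<^sub>F s in at_right 0. 2 / n * (numer (sol A) s / (s\<^sup>2 * sin2 n s)) / exp (2 * sol A s) = ratio A (sol A) s / rho A s"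
      using at_right_pos by eventually_elim (use A in \<open>simp add: ratio_def rho_def\<close>)
  qed
qed

lemma Y_limit_quotient: "((\<lambda>v. ((Y v)\<^sup>2 - 1) / v) \<longlongrightarrow> b 0 / (n * (n + 1))) (at_right 0)"
  using filterlim_compose[OF ratio_over_rho eta_tendsto_0]
proof (rule Lim_transform_eventually)
  show "\<forall>\<^sub>F v in at_right 0. ratio A (sol A) (eta v) / rho A (eta v) = ((Y v)\<^sup>2 - 1) / v"
    using at_right_pos by eventually_elim (simp add: Y_squared eta)
qed

lemma continuous_C: "continuous_on {0..} C"
  unfolding C_def[abs_def] by (intro continuous_intros continuous_eta)

lemma continuous_K: "continuous_on {0..} K"
proof -
  have "continuous_on {0..} (\<lambda>v. sol A (eta v))"
    using A by (intro continuous_on_compose2[OF continuous_sol continuous_eta]) (auto simp: eta)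
  then show ?thesis
    unfolding K_def[abs_def] using A
    by (intro continuous_intros continuous_eta) (auto simp: one_plus_power_neq)
qed

lemma continuous_b_eta: "continuous_on {0..} (\<lambda>v. b (eta v))"
  by (intro continuous_on_compose2[OF b_cont continuous_eta]) (auto simp: eta)

lemma Y_0: "Y 0 = 1" by (simp add: Y_def wroot_def)

lemma C_0: "C 0 = 1" using n_pos by (simp add: C_def)

lemma continuous_Y: "continuous_on {0..} Y"
proof (rule continuous_on_Ici)
  show "continuous_on {0<..} Y"
    by (intro continuous_at_imp_continuous_on ballI DERIV_isCont[OF DERIV_Y]) auto
  have "((\<lambda>v. sqrt (1 + v * (((Y v)\<^sup>2 - 1) / v))) \<longlongrightarrow> sqrt (1 + 0 * (b 0 / (n * (n + 1))))) (at_right 0)"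
    by (intro tendsto_intros Y_limit_quotient)
  then have "((\<lambda>v. sqrt (1 + v * (((Y v)\<^sup>2 - 1) / v))) \<longlongrightarrow> Y 0) (at_right 0)" by (simp add: Y_0)
  then show "(Y \<longlongrightarrow> Y 0) (at_right 0)"
  proof (rule Lim_transform_eventually)
    show "\<forall>\<^sub>F v in at_right 0. sqrt (1 + v * (((Y v)\<^sup>2 - 1) / v)) = Y v"
      using at_right_pos by eventually_elim (use Y_pos in \<open>simp add: less_imp_le\<close>)
  qed
qed

text \<open>The derivative of Y at 0: the formula for \<open>Y1\<close> with C = 1 and the limit of
  (Y^2 - 1) / v inserted.\<close>

definition y1 :: real where
  "y1 = b 0 / (2 * n) - n * 1 * (b 0 / (n * (n + 1))) / 2"

lemma Y1_tendsto: "(Y1 \<longlongrightarrow> y1) (at_right 0)"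
proof -
  have "((\<lambda>v. b (eta v) / (2 * n) - n * C v * (((Y v)\<^sup>2 - 1) / v) / 2) \<longlongrightarrow>
     b (eta 0) / (2 * n) - n * C 0 * (b 0 / (n * (n + 1))) / 2) (at_right 0)"
    using n_pos
    by (intro tendsto_intros Y_limit_quotient tendsto_at_right_0[OF continuous_b_eta] tendsto_at_right_0[OF continuous_C]) auto
  moreover have "(\<lambda>v. b (eta v) / (2 * n) - n * C v * (((Y v)\<^sup>2 - 1) / v) / 2) = Y1"
    by (simp add: Y1_def fun_eq_iff mult.commute)
  ultimately show ?thesis by (simp add: y1_def C_0)
qed

lemma continuous_C1: "continuous_on {0..} C1"
  unfolding C1_def[abs_def] by (intro continuous_intros continuous_K continuous_Y)

text \<open>X / v is 2 / n times the logarithmic derivative of K. It has a limit at 0 because C and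
  Y are 1 there, so X vanishes; \<open>x1\<close> is that limit.\<close>

definition X :: "real \<Rightarrow> real" where "X v = C v * Y v - 1"
definition X1 :: "real \<Rightarrow> real" where "X1 v = C1 v * Y v + C v * Y1 v"
definition x1 :: real where "x1 = C1 0 + y1"

lemma DERIV_X: "0 < v \<Longrightarrow> (X has_real_derivative X1 v) (at v)"
  unfolding X_def[abs_def] X1_def
  using DERIV_diff[OF DERIV_mult[OF DERIV_C DERIV_Y] DERIV_const[of 1], of v] by (simp add: mult.commute)

lemma continuous_X: "continuous_on {0..} X"
  unfolding X_def[abs_def] by (intro continuous_intros continuous_C continuous_Y)

lemma X1_tendsto: "(X1 \<longlongrightarrow> x1) (at_right 0)"
proof -
  have "((\<lambda>v. C1 v * Y v + C v * Y1 v) \<longlongrightarrow> C1 0 * Y 0 + C 0 * y1) (at_right 0)"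
    by (intro tendsto_intros Y1_tendsto tendsto_at_right_0 continuous_C1 continuous_Y continuous_C)
  then show ?thesis by (simp add: X1_def[abs_def] x1_def Y_0 C_0)
qed

lemma X_quotient: "((\<lambda>v. X v / v) \<longlongrightarrow> x1) (at_right 0)"
  using DERIV_at_0_by_limit[OF continuous_X DERIV_X X1_tendsto]
  by (simp add: has_field_derivative_iff at_within_Ici_0 X_def Y_0 C_0)

definition K1 :: "real \<Rightarrow> real" where
  "K1 v = n / 2 * K v * (if v = 0 then x1 else X v / v)"

definition K2 :: "real \<Rightarrow> real" where
  "K2 v = n / 2 * (K1 v * (X v / v) + K v * ((X1 v - X v / v) / v))"

definition C2 :: "real \<Rightarrow> real" where
  "C2 v = - (n / 2) * (2 * K v * K1 v * v ^ (n - 1) * Y v + (K v)\<^sup>2 * (real (n - 1) * v ^ (n - 1) / v) * Y v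
      + (K v)\<^sup>2 * v ^ (n - 1) * Y1 v)"

lemma K1_tendsto: "(K1 \<longlongrightarrow> K1 0) (at_right 0)"
proof -
  have "((\<lambda>v. n / 2 * K v * (X v / v)) \<longlongrightarrow> n / 2 * K 0 * x1) (at_right 0)"
    by (intro tendsto_intros X_quotient tendsto_at_right_0 continuous_K)
  then have "((\<lambda>v. n / 2 * K v * (X v / v)) \<longlongrightarrow> K1 0) (at_right 0)" by (simp add: K1_def)
  then show ?thesis
  proof (rule Lim_transform_eventually)
    show "\<forall>\<^sub>F v in at_right 0. n / 2 * K v * (X v / v) = K1 v"
      using at_right_pos by eventually_elim (simp add: K1_def)
  qed
qed

lemma DERIV_K': "0 < v \<Longrightarrow> (K has_real_derivative K1 v) (at v)"
  using DERIV_K[of v] by (simp add: K1_def X_def)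

lemma DERIV_K1:
  assumes v: "0 < v"
  shows "(K1 has_real_derivative K2 v) (at v)"
proof -
  have "((\<lambda>v. X v / v) has_real_derivative (X1 v * v - X v * 1) / (v * v)) (at v)"
    by (rule DERIV_divide[OF DERIV_X[OF v] DERIV_ident]) (use v in simp)
  then have "((\<lambda>v. n / 2 * K v * (X v / v)) has_real_derivative
     n / 2 * K1 v * (X v / v) + (X1 v * v - X v * 1) / (v * v) * (n / 2 * K v)) (at v)"
    by (intro DERIV_mult DERIV_cmult DERIV_K' v)
  moreover have "n / 2 * K1 v * (X v / v) + (X1 v * v - X v * 1) / (v * v) * (n / 2 * K v) = K2 v"
    using v by (simp add: K2_def field_simps)
  ultimately have "((\<lambda>v. n / 2 * K v * (X v / v)) has_real_derivative K2 v) (at v)" by simp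
  then show ?thesis
    by (rule has_field_derivative_transform_within_open[of _ _ _ "{0<..}"]) (use v in \<open>auto simp: K1_def\<close>)
qed

lemma DERIV_C1:
  assumes v: "0 < v"
  shows "(C1 has_real_derivative C2 v) (at v)"
proof -
  have p: "((\<lambda>v. v ^ (n - 1)) has_real_derivative real (n - 1) * v ^ (n - 1) / v) (at v)"
  proof -
    have "((\<lambda>v. v ^ (n - 1)) has_real_derivative real (n - 1) * v ^ (n - 1 - 1)) (at v)"
      by (auto intro!: derivative_eq_intros)
    moreover have "real (n - 1) * v ^ (n - 1 - 1) = real (n - 1) * v ^ (n - 1) / v"
    proof (cases "n - 1 = 0")
      case False
      then have "v ^ (n - 1) = v * v ^ (n - 1 - 1)" by (metis power_eq_if)
      then show ?thesis using v by simp
    qed simp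
    ultimately show ?thesis by metis
  qed
  have "((\<lambda>v. - (n / 2) * (K v)\<^sup>2 * v ^ (n - 1) * Y v) has_real_derivative
     ((- (n / 2) * (real 2 * (K1 v * K v ^ (2 - Suc 0)))) * v ^ (n - 1) + real (n - 1) * v ^ (n - 1) / v * (- (n / 2) * (K v)\<^sup>2)) * Y v
     + Y1 v * (- (n / 2) * (K v)\<^sup>2 * v ^ (n - 1))) (at v)"
    by (intro DERIV_mult DERIV_cmult DERIV_power DERIV_K' DERIV_Y p v)
  moreover have "((- (n / 2) * (real 2 * (K1 v * K v ^ (2 - Suc 0)))) * v ^ (n - 1) + real (n - 1) * v ^ (n - 1) / v * (- (n / 2) * (K v)\<^sup>2)) * Y v
     + Y1 v * (- (n / 2) * (K v)\<^sup>2 * v ^ (n - 1)) = C2 v"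
    by (simp add: C2_def algebra_simps)
  ultimately show ?thesis by (simp add: C1_def[abs_def])
qed

lemma continuous_Y1: "continuous_on {0<..} Y1"
  unfolding Y1_def[abs_def]
  by (intro continuous_intros continuous_on_subset[OF continuous_b_eta, of "{0<..}"]
      continuous_on_subset[OF continuous_C, of "{0<..}"] continuous_on_subset[OF continuous_Y, of "{0<..}"])
    (use n_pos in auto)

lemma continuous_K1: "continuous_on {0..} K1"
  by (rule continuous_on_Ici[OF _ K1_tendsto])
    (intro continuous_at_imp_continuous_on ballI DERIV_isCont[OF DERIV_K1], simp)

lemma radial_C2_K: "radial_C2 K K1 K2"
  unfolding radial_C2_def
proof (intro conjI allI impI)
  fix v :: real
  show "(K has_real_derivative K1 v) (at v within {0..})" if "0 \<le> v"
  proof (cases "v = 0")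
    case True
    then show ?thesis using DERIV_at_0_by_limit[OF continuous_K DERIV_K' K1_tendsto] by simp
  next
    case False
    then show ?thesis using that DERIV_K'[of v] by (simp add: has_field_derivative_at_within)
  qed
  show "(K1 has_real_derivative K2 v) (at v)" if "0 < v" using DERIV_K1[OF that] .
next
  show "continuous_on {0..} K1" by (rule continuous_K1)
  have sub: "continuous_on {0<..} f" if "continuous_on {0..} f" for f :: "real \<Rightarrow> real"
    by (rule continuous_on_subset[OF that]) auto
  show "continuous_on {0<..} K2"
    unfolding K2_def[abs_def] X1_def
    by (intro continuous_intros continuous_Y1 sub[OF continuous_K] sub[OF continuous_C] sub[OF continuous_Y]
        sub[OF continuous_X] sub[OF continuous_K1] sub[OF continuous_C1]) auto
  \<comment> \<open>In v K2 the difference X1 - X / v appears, whose two terms have the same limit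
    \<open>x1\<close>; no limit of \<open>K2\<close> itself is used.\<close>
  have "((\<lambda>v. n / 2 * (K1 v * X v + K v * (X1 v - X v / v))) \<longlongrightarrow> n / 2 * (K1 0 * X 0 + K 0 * (x1 - x1))) (at_right 0)"
    by (intro tendsto_intros K1_tendsto X1_tendsto X_quotient tendsto_at_right_0 continuous_K continuous_X)
  then have "((\<lambda>v. n / 2 * (K1 v * X v + K v * (X1 v - X v / v))) \<longlongrightarrow> 0) (at_right 0)"
    by (simp add: X_def Y_0 C_0)
  then show "((\<lambda>v. v * K2 v) \<longlongrightarrow> 0) (at_right 0)"
  proof (rule Lim_transform_eventually)
    show "\<forall>\<^sub>F v in at_right 0. n / 2 * (K1 v * X v + K v * (X1 v - X v / v)) = v * K2 v"
      using at_right_pos by eventually_elim (simp add: K2_def field_simps)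
  qed
qed

lemma radial_C2_C: "radial_C2 C C1 C2"
  unfolding radial_C2_def
proof (intro conjI allI impI)
  fix v :: real
  show "(C has_real_derivative C1 v) (at v within {0..})" if "0 \<le> v"
  proof (cases "v = 0")
    case True
    then show ?thesis using DERIV_at_0_by_limit[OF continuous_C DERIV_C tendsto_at_right_0[OF continuous_C1]] by simp
  next
    case False
    then show ?thesis using that DERIV_C[of v] by (simp add: has_field_derivative_at_within)
  qed
  show "(C1 has_real_derivative C2 v) (at v)" if "0 < v" using DERIV_C1[OF that] .
next
  show "continuous_on {0..} C1" by (rule continuous_C1)
  have sub: "continuous_on {0<..} f" if "continuous_on {0..} f" for f :: "real \<Rightarrow> real"
    by (rule continuous_on_subset[OF that]) auto
  show "continuous_on {0<..} C2"
    unfolding C2_def[abs_def]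
    by (intro continuous_intros continuous_Y1 sub[OF continuous_K] sub[OF continuous_Y] sub[OF continuous_K1]) auto
  have "((\<lambda>v. - (n / 2) * (2 * K v * K1 v * v ^ (n - 1) * Y v * v + (K v)\<^sup>2 * (real (n - 1) * v ^ (n - 1)) * Y v
      + (K v)\<^sup>2 * v ^ (n - 1) * Y1 v * v)) \<longlongrightarrow>
     - (n / 2) * (2 * K 0 * K1 0 * 0 ^ (n - 1) * Y 0 * 0 + (K 0)\<^sup>2 * (real (n - 1) * 0 ^ (n - 1)) * Y 0
      + (K 0)\<^sup>2 * 0 ^ (n - 1) * y1 * 0)) (at_right 0)"
    by (intro tendsto_intros K1_tendsto Y1_tendsto tendsto_at_right_0 continuous_K continuous_Y)
  \<comment> \<open>The middle term is killed by the factor n - 1 if n = 1 and by the power of 0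
    otherwise.\<close>
  moreover have "- (n / 2) * (2 * K 0 * K1 0 * 0 ^ (n - 1) * Y 0 * 0 + (K 0)\<^sup>2 * (real (n - 1) * 0 ^ (n - 1)) * Y 0
      + (K 0)\<^sup>2 * 0 ^ (n - 1) * y1 * 0) = 0"
    by (cases "n = 1") (use n in \<open>simp_all add: power_0_left\<close>)
  ultimately have "((\<lambda>v. - (n / 2) * (2 * K v * K1 v * v ^ (n - 1) * Y v * v + (K v)\<^sup>2 * (real (n - 1) * v ^ (n - 1)) * Y v
      + (K v)\<^sup>2 * v ^ (n - 1) * Y1 v * v)) \<longlongrightarrow> 0) (at_right 0)" by (simp only:)
  then show "((\<lambda>v. v * C2 v) \<longlongrightarrow> 0) (at_right 0)"
  proof (rule Lim_transform_eventually)
    show "\<forall>\<^sub>F v in at_right 0. - (n / 2) * (2 * K v * K1 v * v ^ (n - 1) * Y v * v + (K v)\<^sup>2 * (real (n - 1) * v ^ (n - 1)) * Y v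
      + (K v)\<^sup>2 * v ^ (n - 1) * Y1 v * v) = v * C2 v"
      using at_right_pos by eventually_elim (simp add: C2_def algebra_simps)
  qed
qed

text \<open>The second-order equation of h in terms of K and C. It is free of singular terms and is
  the form in which the ordinary differential equation enters the verification of the flow
  equation.\<close>

lemma K_C_equation:
  assumes v: "0 < v"
  shows "K v * (4 * v * C2 v + 4 * C1 v + b (eta v)) = C v * (4 * v * K2 v + 4 * (real n + 1) * K1 v)"
proof (rule profile_equation[where P = "1 - (C v)\<^sup>2" and X = "X v" and Y = "Y v" and ?Y1.0 = "Y1 v" and ?X1.0 = "X1 v"])
  have P: "1 - (C v)\<^sup>2 = (K v)\<^sup>2 * v ^ n" using K_squared[of v] v by simp
  show "v \<noteq> 0" "real n \<noteq> 0" using v n_pos by auto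
  show "v * Y1 v = v * b (eta v) / (2 * real n) - n * C v * ((Y v)\<^sup>2 - 1) / 2"
    using v by (simp add: Y1_def field_simps)
  show vC1: "v * C1 v = - (n / 2) * (1 - (C v)\<^sup>2) * Y v"
    unfolding P power_split by (simp add: C1_def)
  have "v * X1 v = (v * C1 v) * Y v + C v * (v * Y1 v)" by (simp add: X1_def distrib_left)
  then show "v * X1 v = - (n / 2) * (1 - (C v)\<^sup>2) * Y v * Y v + C v * (v * Y1 v)"
    unfolding vC1 .
  show vK1: "v * K1 v = n / 2 * K v * X v" using v by (simp add: K1_def)
  have *: "v * (v * (- N * (2 * k * k1 * V * y + k\<^sup>2 * (m * V / v) * y + k\<^sup>2 * V * w)))
      = - N * (2 * k * (v * k1) * (v * V) * y + m * (k\<^sup>2 * (v * V)) * y + k\<^sup>2 * (v * V) * (v * w))" for N k k1 V y m w :: real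
    using v by (simp add: field_simps)
  have m: "real (n - 1) = real n - 1" using n by (simp add: of_nat_diff)
  have "v * (v * C2 v) = - (n / 2) * (2 * K v * (v * K1 v) * (v * v ^ (n - 1)) * Y v
      + (real n - 1) * ((K v)\<^sup>2 * (v * v ^ (n - 1))) * Y v + (K v)\<^sup>2 * (v * v ^ (n - 1)) * (v * Y1 v))"
    unfolding C2_def m by (rule *)
  also have "\<dots> = - (n / 2) * (n * ((K v)\<^sup>2 * v ^ n) * X v * Y v + (real n - 1) * ((K v)\<^sup>2 * v ^ n) * Y v + ((K v)\<^sup>2 * v ^ n) * (v * Y1 v))"
    unfolding vK1 power_split by (simp add: power2_eq_square algebra_simps)
  finally show "v * (v * C2 v) = - (n / 2) * (n * (1 - (C v)\<^sup>2) * X v * Y v + (real n - 1) * (1 - (C v)\<^sup>2) * Y v + (1 - (C v)\<^sup>2) * (v * Y1 v))"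
    unfolding P .
  have "v * (v * K2 v) = n / 2 * ((v * K1 v) * X v + K v * (v * X1 v - X v))"
    using v by (simp add: K2_def field_simps)
  then show "v * (v * K2 v) = n / 2 * (n / 2 * K v * X v * X v + K v * (v * X1 v - X v))"
    unfolding vK1 .
qed (simp_all add: X_def)

end

section \<open>Equivariant maps of the plane into the sphere\<close>

definition has_partial :: "'a::euclidean_space \<Rightarrow> ('a \<Rightarrow> 'b::real_normed_vector) \<Rightarrow> ('a \<Rightarrow> 'b) \<Rightarrow> bool" where
  "has_partial b F F' \<longleftrightarrow> (\<forall>x. ((\<lambda>s. F (x + s *\<^sub>R b)) has_vector_derivative F' x) (at 0))"

lemma has_partialD: "has_partial b F F' \<Longrightarrow> ((\<lambda>s. F (x + s *\<^sub>R b)) has_vector_derivative F' x) (at 0)"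
  by (simp add: has_partial_def)

lemma partial_derivative_eq: "has_partial b F F' \<Longrightarrow> partial_derivative b F = F'"
  unfolding partial_derivative_def has_partial_def by (auto intro: vector_derivative_at)

lemma has_partial_add:
  "has_partial b F F' \<Longrightarrow> has_partial b G G' \<Longrightarrow> has_partial b (\<lambda>x. F x + G x) (\<lambda>x. F' x + G' x)"
  unfolding has_partial_def by (auto intro: has_vector_derivative_add)

lemma DERIV_inner_line: "((\<lambda>s. (x + s *\<^sub>R b) \<bullet> (x + s *\<^sub>R b)) has_real_derivative 2 * (x \<bullet> b)) (at 0)"
proof -
  have "(\<lambda>s. (x + s *\<^sub>R b) \<bullet> (x + s *\<^sub>R b)) = (\<lambda>s. x \<bullet> x + s * (2 * (x \<bullet> b)) + s\<^sup>2 * (b \<bullet> b))"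
    by (simp add: fun_eq_iff inner_add_left inner_add_right inner_commute power2_eq_square algebra_simps)
  then show ?thesis by (auto intro!: derivative_eq_intros)
qed

lemma DERIV_radial:
  assumes "\<And>v. 0 \<le> v \<Longrightarrow> (k has_real_derivative k1 v) (at v within {0..})"
  shows "((\<lambda>s. k ((x + s *\<^sub>R b) \<bullet> (x + s *\<^sub>R b))) has_real_derivative k1 (x \<bullet> x) * (2 * (x \<bullet> b))) (at 0)"
proof -
  define q where "q = (\<lambda>s. (x + s *\<^sub>R b) \<bullet> (x + s *\<^sub>R b))"
  have "(k has_real_derivative k1 (q 0)) (at (q 0) within q ` UNIV)"
    by (rule has_field_derivative_subset[of _ _ _ "{0..}"]) (auto simp: q_def intro: assms)
  from DERIV_image_chain[OF this DERIV_inner_line[of x b, folded q_def]] show ?thesis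
    by (simp add: q_def o_def)
qed

lemma has_partial_radial_mult:
  fixes P :: "'a::euclidean_space \<Rightarrow> 'b::real_normed_vector"
  assumes k: "\<And>v. 0 \<le> v \<Longrightarrow> (k has_real_derivative k1 v) (at v within {0..})" and P: "has_partial b P Pb"
  shows "has_partial b (\<lambda>x. k (x \<bullet> x) *\<^sub>R P x) (\<lambda>x. (2 * k1 (x \<bullet> x) * (x \<bullet> b)) *\<^sub>R P x + k (x \<bullet> x) *\<^sub>R Pb x)"
  unfolding has_partial_def
proof
  fix x
  from has_vector_derivative_scaleR[OF DERIV_radial[of k k1 x b, OF k] has_partialD[OF P, of x]]
  show "((\<lambda>s. k ((x + s *\<^sub>R b) \<bullet> (x + s *\<^sub>R b)) *\<^sub>R P (x + s *\<^sub>R b)) has_vector_derivative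
      (2 * k1 (x \<bullet> x) * (x \<bullet> b)) *\<^sub>R P x + k (x \<bullet> x) *\<^sub>R Pb x) (at 0)"
    by (simp add: mult_ac add.commute)
qed

lemma has_vector_derivative_scaleR_at_0:
  fixes f :: "real \<Rightarrow> 'b::real_normed_vector"
  assumes "isCont f 0"
  shows "((\<lambda>s. s *\<^sub>R f s) has_vector_derivative f 0) (at 0)"
  unfolding has_vector_derivative_def has_derivative_at_within
proof (intro conjI)
  show "bounded_linear (\<lambda>s. s *\<^sub>R f 0)" by (rule bounded_linear_scaleR_left)
  have "((\<lambda>s. norm (f s - f 0)) \<longlongrightarrow> norm (f 0 - f 0)) (at 0)"
    using assms unfolding isCont_def by (intro tendsto_intros)
  then have "((\<lambda>s. norm (f s - f 0)) \<longlongrightarrow> 0) (at 0)" by simp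
  then show "((\<lambda>y. (y *\<^sub>R f y - 0 *\<^sub>R f 0 - (y - 0) *\<^sub>R f 0) /\<^sub>R norm (y - 0)) \<longlongrightarrow> 0) (at 0)"
  proof (rule Lim_null_comparison[rotated])
    show "\<forall>\<^sub>F y in at 0. norm ((y *\<^sub>R f y - 0 *\<^sub>R f 0 - (y - 0) *\<^sub>R f 0) /\<^sub>R norm (y - 0)) \<le> norm (f y - f 0)"
    proof -
      have "norm ((y *\<^sub>R f y - 0 *\<^sub>R f 0 - (y - 0) *\<^sub>R f 0) /\<^sub>R norm (y - 0)) = norm (f y - f 0)" if "y \<noteq> 0" for y
        using that by (simp add: abs_mult flip: scaleR_diff_right)
      then show ?thesis by (auto simp: eventually_at_filter)
    qed
  qed
qed

text \<open>Away from the origin this is the product and chain rule. At the origin \<open>k1\<close>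
  need not be differentiable, but x \<bullet> b is linear along the line, so the function is s times
  a continuous function, whose value at 0 is the derivative.\<close>

lemma has_partial_radial_deriv_mult:
  fixes P :: "'a::euclidean_space \<Rightarrow> 'b::real_normed_vector"
  assumes k: "radial_C2 k k1 k2" and P: "has_partial c P Pc"
  shows "has_partial c (\<lambda>x. (2 * k1 (x \<bullet> x) * (x \<bullet> b)) *\<^sub>R P x)
    (\<lambda>x. (4 * k2 (x \<bullet> x) * (x \<bullet> b) * (x \<bullet> c)) *\<^sub>R P x + (2 * k1 (x \<bullet> x) * (b \<bullet> c)) *\<^sub>R P x + (2 * k1 (x \<bullet> x) * (x \<bullet> b)) *\<^sub>R Pc x)"
  unfolding has_partial_def
proof
  fix x :: 'a
  show "((\<lambda>s. (2 * k1 ((x + s *\<^sub>R c) \<bullet> (x + s *\<^sub>R c)) * ((x + s *\<^sub>R c) \<bullet> b)) *\<^sub>R P (x + s *\<^sub>R c)) has_vector_derivative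
     (4 * k2 (x \<bullet> x) * (x \<bullet> b) * (x \<bullet> c)) *\<^sub>R P x + (2 * k1 (x \<bullet> x) * (b \<bullet> c)) *\<^sub>R P x + (2 * k1 (x \<bullet> x) * (x \<bullet> b)) *\<^sub>R Pc x) (at 0)"
  proof (cases "x = 0")
    case False
    then have "(k1 has_real_derivative k2 (x \<bullet> x)) (at ((x + 0 *\<^sub>R c) \<bullet> (x + 0 *\<^sub>R c)))"
      using k by (simp add: radial_C2_def)
    from DERIV_chain2[OF this DERIV_inner_line[of x c]]
    have "((\<lambda>s. k1 ((x + s *\<^sub>R c) \<bullet> (x + s *\<^sub>R c))) has_real_derivative k2 (x \<bullet> x) * (2 * (x \<bullet> c))) (at 0)" .
    moreover have "((\<lambda>s. (x + s *\<^sub>R c) \<bullet> b) has_real_derivative b \<bullet> c) (at 0)"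
    proof -
      have "(\<lambda>s. (x + s *\<^sub>R c) \<bullet> b) = (\<lambda>s. x \<bullet> b + s * (b \<bullet> c))"
        by (simp add: fun_eq_iff inner_add_left inner_commute[of c])
      then show ?thesis by (auto intro!: derivative_eq_intros)
    qed
    ultimately have "((\<lambda>s. 2 * k1 ((x + s *\<^sub>R c) \<bullet> (x + s *\<^sub>R c)) * ((x + s *\<^sub>R c) \<bullet> b)) has_real_derivative
       2 * (k2 (x \<bullet> x) * (2 * (x \<bullet> c))) * ((x + 0 *\<^sub>R c) \<bullet> b) + (b \<bullet> c) * (2 * k1 ((x + 0 *\<^sub>R c) \<bullet> (x + 0 *\<^sub>R c)))) (at 0)"
      by (intro DERIV_mult DERIV_cmult)
    from has_vector_derivative_scaleR[OF this has_partialD[OF P, of x]] show ?thesis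
      by (simp add: mult_ac add_ac scaleR_add_left)
  next
    case True
    define f where "f = (\<lambda>s. (2 * k1 (s\<^sup>2 * (c \<bullet> c)) * (c \<bullet> b)) *\<^sub>R P (s *\<^sub>R c))"
    have "isCont (\<lambda>s. k1 (s\<^sup>2 * (c \<bullet> c))) 0"
    proof -
      have "continuous_on UNIV (\<lambda>s::real. k1 (s\<^sup>2 * (c \<bullet> c)))"
        by (rule continuous_on_compose2[of "{0..}" k1])
          (use k in \<open>auto simp: radial_C2_def intro!: continuous_intros\<close>)
      then show ?thesis by (simp add: continuous_on_eq_continuous_at)
    qed
    moreover have "isCont (\<lambda>s. P (s *\<^sub>R c)) 0"
      using has_vector_derivative_continuous[OF has_partialD[OF P, of 0]] by simp
    ultimately have "isCont f 0" unfolding f_def by (intro continuous_intros)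
    from has_vector_derivative_scaleR_at_0[OF this] show ?thesis
      by (simp add: f_def True power2_eq_square mult_ac inner_commute)
  qed
qed

lemma continuous_on_compose_radial:
  "continuous_on {0..} k \<Longrightarrow> continuous_on UNIV (\<lambda>x::'a::euclidean_space. k (x \<bullet> x) :: real)"
  by (rule continuous_on_compose2[of "{0..}" k]) (auto intro!: continuous_intros)

text \<open>By Cauchy-Schwarz the product is at most 4 |v k2(v)| with v = x \<bullet> x, which tends
  to 0 at the origin. The last clause of \<open>radial_C2\<close> is made for this step.\<close>

lemma continuous_radial_second:
  fixes b c :: "'a::euclidean_space"
  assumes k: "radial_C2 k k1 k2" and b: "norm b = 1" "norm c = 1"
  shows "continuous_on UNIV (\<lambda>x. 4 * k2 (x \<bullet> x) * (x \<bullet> b) * (x \<bullet> c))"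
proof -
  have "isCont (\<lambda>x. 4 * k2 (x \<bullet> x) * (x \<bullet> b) * (x \<bullet> c)) x" for x
  proof (cases "x = 0")
    case False
    have "continuous_on (- {0::'a}) (\<lambda>x. k2 (x \<bullet> x))"
      by (rule continuous_on_compose2[of "{0<..}" k2]) (use k in \<open>auto simp: radial_C2_def intro!: continuous_intros\<close>)
    then have "isCont (\<lambda>x. k2 (x \<bullet> x)) x"
      using False continuous_on_eq_continuous_at[of "- {0::'a}"] by auto
    then show ?thesis by (intro continuous_intros)
  next
    case True
    have "filterlim (\<lambda>x::'a. x \<bullet> x) (at_right 0) (at 0)"
      unfolding filterlim_at
    proof
      show "\<forall>\<^sub>F x in at 0. x \<bullet> x \<in> {0<..} \<and> x \<bullet> (x::'a) \<noteq> 0" by (auto simp: eventually_at_filter)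
      have "((\<lambda>x::'a. x \<bullet> x) \<longlongrightarrow> (0::'a) \<bullet> 0) (at 0)" by (intro tendsto_inner tendsto_ident_at)
      then show "((\<lambda>x::'a. x \<bullet> x) \<longlongrightarrow> 0) (at 0)" by simp
    qed
    moreover have "((\<lambda>v. v * k2 v) \<longlongrightarrow> 0) (at_right 0)" using k by (simp add: radial_C2_def)
    ultimately have "((\<lambda>x::'a. (x \<bullet> x) * k2 (x \<bullet> x)) \<longlongrightarrow> 0) (at 0)"
      using filterlim_compose by blast
    then have "((\<lambda>x::'a. 4 * \<bar>(x \<bullet> x) * k2 (x \<bullet> x)\<bar>) \<longlongrightarrow> 4 * \<bar>0\<bar>) (at 0)"
      by (intro tendsto_intros)
    then have "((\<lambda>x::'a. 4 * \<bar>(x \<bullet> x) * k2 (x \<bullet> x)\<bar>) \<longlongrightarrow> 0) (at 0)" by simp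
    then have "((\<lambda>x. 4 * k2 (x \<bullet> x) * (x \<bullet> b) * (x \<bullet> c)) \<longlongrightarrow> 0) (at 0)"
    proof (rule Lim_null_comparison[rotated])
      have "norm (4 * k2 (x \<bullet> x) * (x \<bullet> b) * (x \<bullet> c)) \<le> 4 * \<bar>(x \<bullet> x) * k2 (x \<bullet> x)\<bar>" for x
      proof -
        have "\<bar>x \<bullet> b\<bar> * \<bar>x \<bullet> c\<bar> \<le> norm x * norm x"
          using Cauchy_Schwarz_ineq2[of x b] Cauchy_Schwarz_ineq2[of x c] b by (intro mult_mono) auto
        then have "4 * \<bar>k2 (x \<bullet> x)\<bar> * (\<bar>x \<bullet> b\<bar> * \<bar>x \<bullet> c\<bar>) \<le> 4 * \<bar>k2 (x \<bullet> x)\<bar> * (x \<bullet> x)"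
          by (intro mult_left_mono) (auto simp: dot_square_norm power2_eq_square)
        then show ?thesis by (simp add: abs_mult mult_ac)
      qed
      then show "\<forall>\<^sub>F x in at 0. norm (4 * k2 (x \<bullet> x) * (x \<bullet> b) * (x \<bullet> c)) \<le> 4 * \<bar>(x \<bullet> x) * k2 (x \<bullet> x)\<bar>"
        by simp
    qed
    then show ?thesis by (simp add: isCont_def True)
  qed
  then show ?thesis by (simp add: continuous_on_eq_continuous_at)
qed

section \<open>Twice continuously differentiable maps with explicit derivatives\<close>

text \<open>The partial derivatives are carried along as explicit functions, so that the Laplacian
  can be read off from \<open>F2\<close> instead of being recomputed.\<close>

definition space_C2 :: "('a::euclidean_space \<Rightarrow> 'b::real_normed_vector) \<Rightarrow> ('a \<Rightarrow> 'a \<Rightarrow> 'b) \<Rightarrow> ('a \<Rightarrow> 'a \<Rightarrow> 'a \<Rightarrow> 'b) \<Rightarrow> bool" where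
  "space_C2 F F1 F2 \<longleftrightarrow> continuous_on UNIV F \<and>
    (\<forall>b\<in>Basis. has_partial b F (F1 b) \<and> continuous_on UNIV (F1 b) \<and>
      (\<forall>c\<in>Basis. has_partial c (F1 b) (F2 b c) \<and> continuous_on UNIV (F2 b c)))"

lemma space_C2_radial_mult:
  fixes P :: "'a::euclidean_space \<Rightarrow> 'b::real_normed_vector"
  assumes k: "radial_C2 k k1 k2" and P: "space_C2 P P1 P2"
  shows "space_C2 (\<lambda>x. k (x \<bullet> x) *\<^sub>R P x)
    (\<lambda>b x. (2 * k1 (x \<bullet> x) * (x \<bullet> b)) *\<^sub>R P x + k (x \<bullet> x) *\<^sub>R P1 b x)
    (\<lambda>b c x. ((4 * k2 (x \<bullet> x) * (x \<bullet> b) * (x \<bullet> c)) *\<^sub>R P x + (2 * k1 (x \<bullet> x) * (b \<bullet> c)) *\<^sub>R P x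
        + (2 * k1 (x \<bullet> x) * (x \<bullet> b)) *\<^sub>R P1 c x)
      + ((2 * k1 (x \<bullet> x) * (x \<bullet> c)) *\<^sub>R P1 b x + k (x \<bullet> x) *\<^sub>R P2 b c x))"
proof -
  have kd: "\<And>v. 0 \<le> v \<Longrightarrow> (k has_real_derivative k1 v) (at v within {0..})" and k1c: "continuous_on {0..} k1"
    using k by (auto simp: radial_C2_def)
  have kc: "continuous_on {0..} k"
    using kd by (auto simp: continuous_on_eq_continuous_within intro: DERIV_continuous)
  note cont = continuous_on_compose_radial[OF kc] continuous_on_compose_radial[OF k1c]
  show ?thesis
    unfolding space_C2_def
  proof (intro conjI ballI)
    have Pc: "continuous_on UNIV P" using P by (simp add: space_C2_def)
    show "continuous_on UNIV (\<lambda>x. k (x \<bullet> x) *\<^sub>R P x)" by (intro continuous_intros cont Pc)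
    fix b :: 'a assume b: "b \<in> Basis"
    have P1: "has_partial b P (P1 b)" "continuous_on UNIV (P1 b)" using P b by (auto simp: space_C2_def)
    show "has_partial b (\<lambda>x. k (x \<bullet> x) *\<^sub>R P x) (\<lambda>x. (2 * k1 (x \<bullet> x) * (x \<bullet> b)) *\<^sub>R P x + k (x \<bullet> x) *\<^sub>R P1 b x)"
      by (rule has_partial_radial_mult[OF kd P1(1)])
    show "continuous_on UNIV (\<lambda>x. (2 * k1 (x \<bullet> x) * (x \<bullet> b)) *\<^sub>R P x + k (x \<bullet> x) *\<^sub>R P1 b x)"
      by (intro continuous_intros cont Pc P1)
    fix c :: 'a assume c: "c \<in> Basis"
    have P2: "has_partial c P (P1 c)" "continuous_on UNIV (P1 c)" "has_partial c (P1 b) (P2 b c)" "continuous_on UNIV (P2 b c)"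
      using P b c by (auto simp: space_C2_def)
    show "has_partial c (\<lambda>x. (2 * k1 (x \<bullet> x) * (x \<bullet> b)) *\<^sub>R P x + k (x \<bullet> x) *\<^sub>R P1 b x)
      (\<lambda>x. ((4 * k2 (x \<bullet> x) * (x \<bullet> b) * (x \<bullet> c)) *\<^sub>R P x + (2 * k1 (x \<bullet> x) * (b \<bullet> c)) *\<^sub>R P x
        + (2 * k1 (x \<bullet> x) * (x \<bullet> b)) *\<^sub>R P1 c x)
      + ((2 * k1 (x \<bullet> x) * (x \<bullet> c)) *\<^sub>R P1 b x + k (x \<bullet> x) *\<^sub>R P2 b c x))"
      by (intro has_partial_add has_partial_radial_deriv_mult[OF k] has_partial_radial_mult kd P2)
    show "continuous_on UNIV (\<lambda>x. ((4 * k2 (x \<bullet> x) * (x \<bullet> b) * (x \<bullet> c)) *\<^sub>R P x + (2 * k1 (x \<bullet> x) * (b \<bullet> c)) *\<^sub>R P x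
        + (2 * k1 (x \<bullet> x) * (x \<bullet> b)) *\<^sub>R P1 c x)
      + ((2 * k1 (x \<bullet> x) * (x \<bullet> c)) *\<^sub>R P1 b x + k (x \<bullet> x) *\<^sub>R P2 b c x))"
      using b c
      by (intro continuous_on_add continuous_on_scaleR continuous_radial_second[OF k] P1 P2 Pc cont continuous_intros) auto
  qed
qed

lemma space_C2_const: "space_C2 (\<lambda>x. w) (\<lambda>b x. 0) (\<lambda>b c x. 0)"
  by (simp add: space_C2_def has_partial_def)

lemma space_C2_radial:
  assumes k: "radial_C2 k k1 k2"
  shows "space_C2 (\<lambda>x::'a::euclidean_space. k (x \<bullet> x)) (\<lambda>b x. 2 * k1 (x \<bullet> x) * (x \<bullet> b))
    (\<lambda>b c x. 4 * k2 (x \<bullet> x) * (x \<bullet> b) * (x \<bullet> c) + 2 * k1 (x \<bullet> x) * (b \<bullet> c))"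
  using space_C2_radial_mult[OF k space_C2_const[of "1::real"]] by simp

lemma space_C2_linear_power:
  fixes z :: "'a::euclidean_space \<Rightarrow> complex"
  assumes z: "bounded_linear z"
  shows "space_C2 (\<lambda>x. z x ^ n) (\<lambda>b x. of_nat n * z x ^ (n - 1) * z b)
    (\<lambda>b c x. of_nat n * (of_nat (n - 1) * z x ^ (n - 1 - 1) * z c) * z b)"
proof -
  interpret bounded_linear z by fact
  have zc: "continuous_on UNIV z" by (rule linear_continuous_on[OF z])
  have "has_partial b (\<lambda>x. z x ^ n) (\<lambda>x. of_nat n * z x ^ (n - 1) * z b)" for b n
    unfolding has_partial_def
  proof
    fix x
    have "((\<lambda>s::real. z x + complex_of_real s * z b) has_vector_derivative z b) (at 0)"
      by (auto intro!: derivative_eq_intros simp: has_vector_derivative_def scaleR_conv_of_real)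
    moreover have "((\<lambda>w. w ^ n) has_field_derivative of_nat n * z x ^ (n - 1)) (at (z x + complex_of_real 0 * z b))"
      by (auto intro!: derivative_eq_intros)
    ultimately have "((\<lambda>s::real. (z x + complex_of_real s * z b) ^ n) has_vector_derivative z b * (of_nat n * z x ^ (n - 1))) (at 0)"
      by (rule field_vector_diff_chain_at[unfolded o_def])
    then show "((\<lambda>s. z (x + s *\<^sub>R b) ^ n) has_vector_derivative of_nat n * z x ^ (n - 1) * z b) (at 0)"
      by (simp add: add scaleR scaleR_conv_of_real mult_ac)
  qed
  note p = this
  have pc: "has_partial b (\<lambda>x. w * F x * w') (\<lambda>x. w * F' x * w')" if "has_partial b F F'" for b w w' and F F' :: "'a \<Rightarrow> complex"
    using that unfolding has_partial_def
    by (auto intro!: has_vector_derivative_mult_left has_vector_derivative_mult_right)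
  show ?thesis
    unfolding space_C2_def
    by (intro conjI ballI p pc continuous_intros zc)
qed

section \<open>Maps rotating about the vertical axis\<close>

text \<open>With the horizontal plane identified with the complex numbers, rotation about the axis
  through the poles is multiplication by \<open>cis\<close>.\<close>

definition emb :: "complex \<times> real \<Rightarrow> real^3" where
  "emb p = vector [Re (fst p), Im (fst p), snd p]"

lemma emb_nth [simp]: "emb p $ 1 = Re (fst p)" "emb p $ 2 = Im (fst p)" "emb p $ 3 = snd p"
  by (simp_all add: emb_def)

lemma bounded_linear_emb: "bounded_linear emb"
  by (rule linear_conv_bounded_linear[THEN iffD1], rule linearI) (simp_all add: vec_eq_iff forall_3)

lemmas emb_has_vector_derivative = bounded_linear.has_vector_derivative[OF bounded_linear_emb]

lemma continuous_on_emb [continuous_intros]: "continuous_on S f \<Longrightarrow> continuous_on S (\<lambda>x. emb (f x))"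
  by (rule bounded_linear.continuous_on[OF bounded_linear_emb])

lemma emb_sum: "(\<Sum>b\<in>B. emb (f b)) = emb (\<Sum>b\<in>B. f b)"
  by (simp add: linear_sum[OF bounded_linear.linear[OF bounded_linear_emb]] o_def)

definition rotating :: "real \<Rightarrow> ('a \<Rightarrow> complex) \<Rightarrow> ('a \<Rightarrow> real) \<Rightarrow> 'a \<Rightarrow> real \<Rightarrow> real^3" where
  "rotating \<omega> F C x t = emb (F x * cis (\<omega> * t), C x)"

lemma has_partial_rotating:
  assumes F: "has_partial b F F'" and C: "has_partial b C C'"
  shows "has_partial b (\<lambda>x. rotating \<omega> F C x t) (\<lambda>x. rotating \<omega> F' C' x t)"
  unfolding has_partial_def rotating_def
proof
  fix x
  show "((\<lambda>s. emb (F (x + s *\<^sub>R b) * cis (\<omega> * t), C (x + s *\<^sub>R b))) has_vector_derivative emb (F' x * cis (\<omega> * t), C' x)) (at 0)"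
    by (intro emb_has_vector_derivative has_vector_derivative_Pair has_vector_derivative_mult_left has_partialD F C)
qed

lemma continuous_on_rotating:
  assumes F: "continuous_on UNIV F" and C: "continuous_on UNIV C"
  shows "continuous_on UNIV (\<lambda>(x, t). rotating \<omega> F C x t)"
  unfolding rotating_def case_prod_unfold
  by (intro continuous_intros continuous_on_compose2[OF F continuous_on_fst[OF continuous_on_id]]
      continuous_on_compose2[OF C continuous_on_fst[OF continuous_on_id]]) auto

lemma has_vector_derivative_rotating:
  "(rotating \<omega> F C x has_vector_derivative rotating \<omega> (\<lambda>x. \<i> * \<omega> * F x) (\<lambda>_. 0) x t) (at t)"
proof -
  have c: "((\<lambda>t. cis (\<omega> * t)) has_vector_derivative \<i> * \<omega> * cis (\<omega> * t)) (at t)"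
  proof -
    have "((\<lambda>t. exp (\<i> * (\<omega> * t))) has_vector_derivative \<i> * \<omega> * exp (\<i> * (\<omega> * t))) (at t)"
      by (rule has_vector_derivative_real_field derivative_eq_intros refl | simp)+
    then show ?thesis by (simp add: cis_conv_exp)
  qed
  have "((\<lambda>t. emb (F x * cis (\<omega> * t), C x)) has_vector_derivative emb (F x * (\<i> * \<omega> * cis (\<omega> * t)), 0)) (at t)"
    by (intro emb_has_vector_derivative has_vector_derivative_Pair has_vector_derivative_mult_right has_vector_derivative_const c)
  then show ?thesis by (simp add: rotating_def[abs_def] mult_ac)
qed

lemma C21_regular_rotating:
  assumes F: "space_C2 F F1 F2" and C: "space_C2 C C1 C2"
  shows "C21_regular (rotating \<omega> F C)"
proof -
  have c: "continuous_on UNIV F" "continuous_on UNIV C" using F C by (auto simp: space_C2_def)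
  have vd: "vector_derivative (rotating \<omega> F C x) (at t) = rotating \<omega> (\<lambda>x. \<i> * \<omega> * F x) (\<lambda>_. 0) x t" for x t
    by (rule vector_derivative_at[OF has_vector_derivative_rotating])
  have p: "has_partial b (\<lambda>x. rotating \<omega> F C x t) (\<lambda>x. rotating \<omega> (F1 b) (C1 b) x t)"
      "continuous_on UNIV (F1 b)" "continuous_on UNIV (C1 b)" if "b \<in> Basis" for b t
    using that F C by (auto simp: space_C2_def intro: has_partial_rotating)
  have q: "has_partial c (\<lambda>x. rotating \<omega> (F1 b) (C1 b) x t) (\<lambda>x. rotating \<omega> (F2 b c) (C2 b c) x t)"
      "continuous_on UNIV (F2 b c)" "continuous_on UNIV (C2 b c)" if "b \<in> Basis" "c \<in> Basis" for b c t
    using that F C by (auto simp: space_C2_def intro: has_partial_rotating)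
  have diff: "(\<lambda>s. f (x + s *\<^sub>R b)) differentiable at 0" if "has_partial b f f'" for b x and f f' :: "'a \<Rightarrow> real^3"
    using has_partialD[OF that, of x] by (rule differentiableI_vector)
  show ?thesis
    unfolding C21_regular_def
  proof (intro conjI allI ballI)
    show "continuous_on UNIV (\<lambda>(x, t). rotating \<omega> F C x t)" by (intro continuous_on_rotating c)
    show "rotating \<omega> F C x differentiable at t" for x t
      by (rule differentiableI_vector[OF has_vector_derivative_rotating])
    show "continuous_on UNIV (\<lambda>(x, t). vector_derivative (rotating \<omega> F C x) (at t))"
      unfolding vd by (intro continuous_on_rotating continuous_intros c)
    fix b :: 'a assume b: "b \<in> Basis"
    show "(\<lambda>s. rotating \<omega> F C (x + s *\<^sub>R b) t) differentiable at 0" for x t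
      by (rule diff[OF p(1)[OF b]])
    show "continuous_on UNIV (\<lambda>(x, t). partial_derivative b (\<lambda>y. rotating \<omega> F C y t) x)"
      unfolding partial_derivative_eq[OF p(1)[OF b]] by (intro continuous_on_rotating p b)
    fix c :: 'a assume c: "c \<in> Basis"
    show "(\<lambda>s. partial_derivative b (\<lambda>y. rotating \<omega> F C y t) (x + s *\<^sub>R c)) differentiable at 0" for x t
      unfolding partial_derivative_eq[OF p(1)[OF b]] by (rule diff[OF q(1)[OF b c]])
    show "continuous_on UNIV (\<lambda>(x, t). partial_derivative c (partial_derivative b (\<lambda>y. rotating \<omega> F C y t)) x)"
      unfolding partial_derivative_eq[OF p(1)[OF b]] partial_derivative_eq[OF q(1)[OF b c]]
      by (intro continuous_on_rotating q b c)
  qed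
qed

lemma laplacian_rotating:
  assumes F: "space_C2 F F1 F2" and C: "space_C2 C C1 C2"
  shows "laplacian (\<lambda>y. rotating \<omega> F C y t) x = rotating \<omega> (\<lambda>x. \<Sum>b\<in>Basis. F2 b b x) (\<lambda>x. \<Sum>b\<in>Basis. C2 b b x) x t"
proof -
  have "partial_derivative b (partial_derivative b (\<lambda>y. rotating \<omega> F C y t)) x = rotating \<omega> (F2 b b) (C2 b b) x t"
    if b: "b \<in> Basis" for b
  proof -
    have "has_partial b (\<lambda>x. rotating \<omega> F C x t) (\<lambda>x. rotating \<omega> (F1 b) (C1 b) x t)"
      "has_partial b (\<lambda>x. rotating \<omega> (F1 b) (C1 b) x t) (\<lambda>x. rotating \<omega> (F2 b b) (C2 b b) x t)"
      using that F C by (auto simp: space_C2_def intro: has_partial_rotating)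
    from this[THEN partial_derivative_eq] show ?thesis by simp
  qed
  then show ?thesis
    by (simp add: laplacian_def rotating_def emb_sum sum_prod sum_distrib_right)
qed

lemma sum_Basis_2: "(\<Sum>b\<in>(Basis :: (real^2) set). f b) = f (axis 1 1) + f (axis 2 1)"
proof -
  have B: "(Basis :: (real^2) set) = {axis 1 1, axis 2 1}"
    by (auto simp: Basis_vec_def UNIV_2)
  have "axis 1 1 \<noteq> (axis 2 1 :: real^2)" by (simp add: axis_eq_axis)
  then show ?thesis unfolding B by simp
qed

section \<open>The Laplacian of radial multiples of powers of z\<close>

text \<open>For \<sigma> = 1 this is the complex coordinate, for \<sigma> = -1 its conjugate. With
  \<sigma> the sign of m, the power of exponent |m| has argument m \<theta>.\<close>

definition zc :: "real \<Rightarrow> real^2 \<Rightarrow> complex" where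
  "zc \<sigma> x = Complex (x $ 1) (\<sigma> * x $ 2)"

lemma bounded_linear_zc: "bounded_linear (zc \<sigma>)"
  by (rule linear_conv_bounded_linear[THEN iffD1], rule linearI)
    (simp_all add: zc_def complex_eq_iff algebra_simps)

lemma zc_axis: "zc \<sigma> (axis 1 1) = 1" "zc \<sigma> (axis 2 1) = \<i> * \<sigma>"
  by (simp_all add: zc_def complex_eq_iff axis_def)

lemma inner_axis_2: "(x::real^2) \<bullet> axis 1 1 = x $ 1" "x \<bullet> axis 2 1 = x $ 2"
  by (simp_all add: inner_axis)

lemma inner_self_2: "(x::real^2) \<bullet> x = (x $ 1)\<^sup>2 + (x $ 2)\<^sup>2"
  by (simp add: inner_vec_def sum_2 power2_eq_square)

text \<open>z^n is harmonic because the squares of z on the two basis vectors are 1 and -1. The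
  mixed terms add up by Euler's identity for the homogeneous polynomial z^n, which turns the
  dimension 2 into the factor n + 1.\<close>

lemma laplacian_radial_power:
  fixes x :: "real^2"
  assumes s: "\<sigma>\<^sup>2 = 1" and n: "1 \<le> n"
  shows "(\<Sum>b\<in>Basis. ((4 * k2 * (x \<bullet> b) * (x \<bullet> b)) *\<^sub>R zc \<sigma> x ^ n + (2 * k1 * (b \<bullet> b)) *\<^sub>R zc \<sigma> x ^ n
        + (2 * k1 * (x \<bullet> b)) *\<^sub>R (of_nat n * zc \<sigma> x ^ (n - 1) * zc \<sigma> b))
      + ((2 * k1 * (x \<bullet> b)) *\<^sub>R (of_nat n * zc \<sigma> x ^ (n - 1) * zc \<sigma> b)
         + k *\<^sub>R (of_nat n * (of_nat (n - 1) * zc \<sigma> x ^ (n - 1 - 1) * zc \<sigma> b) * zc \<sigma> b)))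
     = complex_of_real (4 * (x \<bullet> x) * k2 + 4 * (real n + 1) * k1) * zc \<sigma> x ^ n"
proof -
  define j where "j = \<i> * complex_of_real \<sigma>"
  have j: "j * j = -1"
    using s by (simp add: j_def complex_eq_iff power2_eq_square)
  have zx: "zc \<sigma> x = complex_of_real (x $ 1) + j * complex_of_real (x $ 2)"
    by (simp add: zc_def complex_eq_iff j_def)
  have pw: "zc \<sigma> x ^ n = zc \<sigma> x ^ (n - 1) * zc \<sigma> x" using n by (cases n) (auto simp: mult.commute)
  have gen: "((((4 * l * A * A) * (W * z) + (2 * l1) * (W * z) + (2 * l1 * A) * (N * W)) + ((2 * l1 * A) * (N * W) + l0 * (N * (M * V))))
      + (((4 * l * D * D) * (W * z) + (2 * l1) * (W * z) + (2 * l1 * D) * (N * W * j)) + ((2 * l1 * D) * (N * W * j) + l0 * (N * (M * V * j) * j))))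
      = (4 * (A * A + D * D) * l + 4 * (N + 1) * l1) * (W * z)"
    if z: "z = A + j * D" for l l0 l1 A D W V N M z :: complex
  proof -
    have "l0 * (N * (M * V * j) * j) = l0 * (N * (M * V)) * (j * j)" by (simp only: mult_ac)
    then have "l0 * (N * (M * V * j) * j) = - (l0 * (N * (M * V)))" by (simp add: j)
    then show ?thesis by (simp add: z algebra_simps)
  qed
  show ?thesis
    unfolding sum_Basis_2 inner_axis_2 zc_axis j_def[symmetric] inner_self_2 pw
    using gen[OF zx, of "complex_of_real k2" "zc \<sigma> x ^ (n - 1)" "complex_of_real k1" "of_nat n" "complex_of_real k"
        "of_nat (n - 1)" "zc \<sigma> x ^ (n - 1 - 1)"]
    by (simp add: scaleR_conv_of_real inner_axis_axis axis_def power2_eq_square)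
qed

section \<open>The gradient of a zonal function\<close>

lemma sphere_dist_north_pole:
  fixes u :: "real^3"
  assumes "u \<in> sphere 0 1"
  shows "sphere_dist u north_pole = arccos (u $ 3)"
proof -
  have "norm north_pole = 1"
    by (simp add: north_pole_def norm_eq_sqrt_inner inner_vec_def sum_3)
  moreover have "u \<bullet> north_pole = u $ 3"
    by (simp add: north_pole_def inner_vec_def sum_3)
  ultimately show ?thesis using assms by (simp add: sphere_dist_eq_arccos)
qed

lemma sphere_nth_le: "(u::real^3) \<in> sphere 0 1 \<Longrightarrow> \<bar>u $ 3\<bar> \<le> 1"
  using component_le_norm_cart[of u 3] by simp

text \<open>On the sphere \<open>y \<bullet> y\<close> is constant, so adding a multiple of it to \<open>H\<close> makes the
  differential tangential.\<close>

lemma sphere_gradient_zonal: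
  fixes u :: "real^3"
  assumes H: "\<And>u. u \<in> sphere 0 1 \<Longrightarrow> H u = Gt (sphere_dist u north_pole)"
    and u: "u \<in> sphere 0 1" and lt: "\<bar>u $ 3\<bar> < 1"
    and D: "(Gt has_real_derivative D) (at (arccos (u $ 3)) within {0..pi})"
  shows "sphere_gradient H u = - (D / sqrt (1 - (u $ 3)\<^sup>2)) *\<^sub>R (north_pole - (u $ 3) *\<^sub>R u)"
proof (rule sphere_gradient_eqI)
  have uu: "u \<bullet> u = 1" and nu: "u \<bullet> north_pole = u $ 3" "north_pole \<bullet> u = u $ 3"
    using u by (simp_all add: dot_square_norm north_pole_def inner_vec_def sum_3)
  show "norm u = 1" using u by simp
  show "(- (D / sqrt (1 - (u $ 3)\<^sup>2)) *\<^sub>R (north_pole - (u $ 3) *\<^sub>R u)) \<bullet> u = 0"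
    by (simp add: inner_diff_left nu uu)
  define q where "q = D / sqrt (1 - (u $ 3)\<^sup>2)"
  have int: "0 < arccos (u $ 3)" "arccos (u $ 3) < pi"
    using arccos_lt_bounded[of "u $ 3"] lt by auto
  have "at (arccos (u $ 3)) within {0..pi} = at (arccos (u $ 3))"
    by (rule at_within_Icc_at) (use int in auto)
  then have D': "(Gt has_real_derivative D) (at (arccos (u $ 3)))" using D by simp
  have "(arccos has_real_derivative inverse (- sqrt (1 - (u $ 3)\<^sup>2))) (at (u $ 3))"
    by (rule DERIV_arccos) (use lt in auto)
  from DERIV_chain2[OF D' this] have "((\<lambda>z. Gt (arccos z)) has_real_derivative - q) (at (u $ 3))"
    by (simp add: q_def divide_inverse)
  then have "((\<lambda>z. Gt (arccos z)) has_derivative (\<lambda>w. - q * w)) (at (u $ 3))"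
    unfolding has_field_derivative_def .
  moreover have "((\<lambda>y. y $ 3) has_derivative (\<lambda>w. w $ 3)) (at u)"
    by (rule bounded_linear_imp_has_derivative[OF bounded_linear_vec_nth])
  ultimately have 1: "((\<lambda>y. Gt (arccos (y $ 3))) has_derivative (\<lambda>w. - q * (w $ 3))) (at u)"
    using has_derivative_compose by fastforce
  have "((\<lambda>y. Gt (arccos (y $ 3)) + (q * (u $ 3) / 2) * (y \<bullet> y - 1)) has_derivative
      (\<lambda>w. - q * (w $ 3) + (q * (u $ 3) / 2) * ((u \<bullet> w + w \<bullet> u) - 0))) (at u)"
    by (intro has_derivative_add 1 has_derivative_mult_right has_derivative_diff has_derivative_inner has_derivative_ident has_derivative_const)
  moreover have "(\<lambda>w. - q * (w $ 3) + (q * (u $ 3) / 2) * ((u \<bullet> w + w \<bullet> u) - 0))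
      = (\<lambda>w. (- q *\<^sub>R (north_pole - (u $ 3) *\<^sub>R u)) \<bullet> w)"
    by (simp add: fun_eq_iff inner_diff_left inner_commute[of _ u] algebra_simps north_pole_def inner_vec_def[of "vector [0,0,1]"] sum_3)
  ultimately have 2: "((\<lambda>y. Gt (arccos (y $ 3)) + (q * (u $ 3) / 2) * (y \<bullet> y - 1)) has_derivative
      (\<lambda>w. (- q *\<^sub>R (north_pole - (u $ 3) *\<^sub>R u)) \<bullet> w)) (at u within sphere 0 1)"
    using has_derivative_at_withinI by force
  show "(H has_derivative (\<lambda>w. (- (D / sqrt (1 - (u $ 3)\<^sup>2)) *\<^sub>R (north_pole - (u $ 3) *\<^sub>R u)) \<bullet> w)) (at u within sphere 0 1)"
    unfolding q_def[symmetric]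
    by (rule has_derivative_transform[OF u _ 2]) (simp add: H sphere_dist_north_pole dot_square_norm)
qed

text \<open>Since arccos is not differentiable at 1, the zonal formula does not reach the pole.
  There sin d \<le> |y - p| bounds the difference quotient of H by |Gt d - Gt 0| / sin d, which
  tends to 0 because Gt has derivative 0 at 0 and sin d / d tends to 1.\<close>

lemma sphere_gradient_north_pole:
  fixes H :: "real^3 \<Rightarrow> real"
  assumes H: "\<And>u. u \<in> sphere 0 1 \<Longrightarrow> H u = Gt (sphere_dist u north_pole)"
    and D: "(Gt has_real_derivative 0) (at 0 within {0..pi})"
  shows "sphere_gradient H north_pole = 0"
proof (rule sphere_gradient_eqI)
  define p where "p = (north_pole :: real^3)"
  have p3: "p $ 1 = 0" "p $ 2 = 0" "p $ 3 = 1" by (simp_all add: p_def north_pole_def)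
  have pn: "norm p = 1" by (simp add: norm_eq_sqrt_inner inner_vec_def sum_3 p3)
  then show "norm (north_pole :: real^3) = 1" by (simp add: p_def)
  have Hp: "H p = Gt 0" using H[of p] pn p3 sphere_dist_north_pole[of p] by simp
  have l1: "((\<lambda>d. (Gt d - Gt 0) / d) \<longlongrightarrow> 0) (at 0 within {0..pi})"
    using D by (simp add: has_field_derivative_iff)
  have l2: "((\<lambda>d. sin d / d) \<longlongrightarrow> 1) (at 0 within {0..pi})"
    using has_field_derivative_at_within[OF DERIV_sin[of 0], of "{0..pi}"] by (simp add: has_field_derivative_iff)
  have l3: "((\<lambda>d. \<bar>((Gt d - Gt 0) / d) / (sin d / d)\<bar>) \<longlongrightarrow> 0) (at 0 within {0..pi})"
    using tendsto_rabs[OF tendsto_divide[OF l1 l2]] by simp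
  have "\<forall>x\<in>{-1..1}. (arccos \<longlongrightarrow> arccos x) (at x within {-1..1})"
    using continuous_on_arccos' unfolding continuous_on .
  from bspec[OF this, of 1] have arccos_1: "(arccos \<longlongrightarrow> 0) (at 1 within {-1..1})" by simp
  have 3: "filterlim (\<lambda>y::real^3. y $ 3) (at 1 within {-1..1}) (at p within sphere 0 1)"
    unfolding filterlim_at
  proof
    have "y $ 3 \<noteq> 1" if "y \<noteq> p" "y \<in> sphere 0 1" for y
    proof
      assume y: "y $ 3 = 1"
      have "(y $ 1)\<^sup>2 + (y $ 2)\<^sup>2 + (y $ 3)\<^sup>2 = 1"
        using that(2) by (simp add: norm_eq_sqrt_inner inner_vec_def sum_3 power2_eq_square)
      then have "y $ 1 = 0" "y $ 2 = 0" using y by (auto simp: sum_power2_eq_zero_iff)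
      then show False using that(1) y p3 by (simp add: vec_eq_iff forall_3)
    qed
    then show "\<forall>\<^sub>F y in at p within sphere 0 1. y $ 3 \<in> {-1..1} \<and> y $ 3 \<noteq> 1"
      using sphere_nth_le by (auto simp: eventually_at_filter abs_le_iff minus_le_iff)
    have "((\<lambda>y::real^3. y $ 3) \<longlongrightarrow> p $ 3) (at p within sphere 0 1)" by (intro tendsto_intros)
    then show "((\<lambda>y::real^3. y $ 3) \<longlongrightarrow> 1) (at p within sphere 0 1)" by (simp add: p3)
  qed
  have 4: "filterlim arccos (at 0 within {0..pi}) (at 1 within {-1..1})"
    unfolding filterlim_at
  proof
    have "arccos z \<noteq> 0" if "z \<noteq> 1" "z \<in> {-1..1}" for z
      using that cos_arccos[of z] cos_zero by (metis atLeastAtMost_iff)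
    then show "\<forall>\<^sub>F z in at 1 within {-1..1}. arccos z \<in> {0..pi} \<and> arccos z \<noteq> 0"
      using arccos_lbound arccos_ubound by (auto simp: eventually_at_filter)
    show "(arccos \<longlongrightarrow> 0) (at 1 within {-1..1})" by (rule arccos_1)
  qed
  note lim = filterlim_compose[OF l3 filterlim_compose[OF 4 3]]
  have "((\<lambda>y. (H y - H p - 0) /\<^sub>R norm (y - p)) \<longlongrightarrow> 0) (at p within sphere 0 1)"
  proof (rule Lim_null_comparison[OF _ lim])
    have bd: "norm ((H y - H p - 0) /\<^sub>R norm (y - p)) \<le> \<bar>((Gt (arccos (y $ 3)) - Gt 0) / arccos (y $ 3)) / (sin (arccos (y $ 3)) / arccos (y $ 3))\<bar>"
      if y: "y \<in> sphere 0 1" "\<bar>y $ 3\<bar> < 1" for y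
    proof -
      define d where "d = arccos (y $ 3)"
      have d: "0 < d" "d < pi" using arccos_lt_bounded[of "y $ 3"] y by (auto simp: d_def)
      have s: "0 < sin d" using d by (rule sin_gt_zero)
      have "(y $ 1)\<^sup>2 + (y $ 2)\<^sup>2 + (y $ 3)\<^sup>2 = 1"
        using y(1) by (simp add: norm_eq_sqrt_inner inner_vec_def sum_3 power2_eq_square)
      moreover have "cos d = y $ 3" using y by (simp add: d_def cos_arccos_abs)
      ultimately have "(sin d)\<^sup>2 = (y $ 1)\<^sup>2 + (y $ 2)\<^sup>2" by (simp add: sin_squared_eq)
      also have "\<dots> \<le> (norm (y - p))\<^sup>2"
        unfolding power2_norm_eq_inner by (simp add: inner_vec_def sum_3 p3 power2_eq_square)
      finally have le: "sin d \<le> norm (y - p)" by (rule power2_le_imp_le) simp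
      have "norm ((H y - H p - 0) /\<^sub>R norm (y - p)) = \<bar>Gt d - Gt 0\<bar> / norm (y - p)"
        using H[OF y(1)] Hp y(1) by (simp add: sphere_dist_north_pole d_def divide_inverse mult.commute abs_mult)
      also have "\<dots> \<le> \<bar>Gt d - Gt 0\<bar> / sin d" using le s by (intro divide_left_mono mult_pos_pos) linarith+
      also have "\<dots> = \<bar>((Gt d - Gt 0) / d) / (sin d / d)\<bar>" using d s by (simp add: abs_divide)
      finally show ?thesis by (simp add: d_def)
    qed
    have ev: "\<forall>\<^sub>F y in at p within sphere 0 1. \<bar>y $ 3\<bar> < 1 \<and> y \<in> sphere 0 1"
    proof -
      have "\<forall>\<^sub>F y in at p within sphere 0 1. 0 < y $ 3"
        by (rule order_tendstoD(1)[OF tendsto_vec_nth[OF tendsto_ident_at]]) (simp add: p3)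
      moreover have "\<forall>\<^sub>F y in at p within sphere 0 1. y $ 3 \<in> {-1..1} \<and> y $ 3 \<noteq> 1"
        using 3 by (simp add: filterlim_at)
      moreover have "\<forall>\<^sub>F y in at p within sphere 0 1. y \<in> sphere 0 1" by (auto simp: eventually_at_filter)
      ultimately show ?thesis by eventually_elim auto
    qed
    show "\<forall>\<^sub>F y in at p within sphere 0 1. norm ((H y - H p - 0) /\<^sub>R norm (y - p)) \<le>
        \<bar>((Gt (arccos (y $ 3)) - Gt 0) / arccos (y $ 3)) / (sin (arccos (y $ 3)) / arccos (y $ 3))\<bar>"
      by (rule eventually_mono[OF ev]) (use bd in blast)
  qed
  then show "(H has_derivative (\<lambda>w. 0 \<bullet> w)) (at north_pole within sphere 0 1)"
    unfolding p_def[symmetric] has_derivative_at_within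
    by (simp add: bounded_linear_inner_right)
qed simp

lemma norm_emb: "norm (emb (w, c)) = 1 \<longleftrightarrow> (cmod w)\<^sup>2 + c\<^sup>2 = 1"
  by (simp add: norm_eq_sqrt_inner inner_vec_def sum_3 cmod_power2 power2_eq_square inner_complex_def)

lemma cmod_zc: "\<sigma>\<^sup>2 = 1 \<Longrightarrow> (cmod (zc \<sigma> x))\<^sup>2 = x \<bullet> x"
  by (simp add: cmod_power2 zc_def inner_self_2 power_mult_distrib)

section \<open>Verification of the flow equation\<close>

lemma (in profile) equivariant_solution:
  fixes m :: int and \<omega> :: real and H :: "real^3 \<Rightarrow> real"
  assumes m: "m \<noteq> 0" "nat \<bar>m\<bar> = n"
    and H: "\<And>u. u \<in> sphere 0 1 \<Longrightarrow> H u = Gt (sphere_dist u north_pole)"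
    and Gt: "\<And>x. x \<in> {0..pi} \<Longrightarrow> (Gt has_real_derivative g x - \<omega> * sin x) (at x within {0..pi})"
    and g0: "g 0 = 0" and b_g: "\<And>s. 0 < s \<Longrightarrow> b s * sin (angle n s) = g (angle n s)"
  shows "\<exists>u h. is_solution H u \<and> has_equivariant_form m \<omega> h u \<and>
    h 0 = 0 \<and> (h \<longlongrightarrow> pi) at_top \<and> (\<forall>r>0. 0 < h r \<and> h r < pi)"
proof -
  define \<sigma> :: real where "\<sigma> = sgn (of_int m)"
  have \<sigma>: "\<sigma>\<^sup>2 = 1" using m by (simp add: \<sigma>_def sgn_if)
  have n\<sigma>: "real n * \<sigma> = of_int m" using m(2) by (auto simp: \<sigma>_def sgn_if)
  define F where "F = (\<lambda>x::real^2. K (x \<bullet> x) *\<^sub>R zc \<sigma> x ^ n)"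
  define D where "D = (\<lambda>x::real^2. C (x \<bullet> x))"
  define u where "u = rotating \<omega> F D"
  define h where "h = (\<lambda>r. angle n (eta (r\<^sup>2)))"
  note F2 = space_C2_radial_mult[OF radial_C2_K space_C2_linear_power[OF bounded_linear_zc[of \<sigma>], of n], folded F_def]
  note D2 = space_C2_radial[OF radial_C2_C, where 'a = "real^2", folded D_def]
  have norm1: "(cmod (F x * cis \<theta>))\<^sup>2 + (D x)\<^sup>2 = 1" for x \<theta>
  proof -
    have "(cmod (F x * cis \<theta>))\<^sup>2 = (K (x \<bullet> x))\<^sup>2 * ((cmod (zc \<sigma> x))\<^sup>2) ^ n"
      by (simp add: F_def norm_mult norm_power power_mult_distrib power_commutes flip: power_mult)
        (simp add: mult.commute)
    also have "\<dots> = (K (x \<bullet> x))\<^sup>2 * (x \<bullet> x) ^ n" by (simp add: cmod_zc[OF \<sigma>])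
    finally show ?thesis using K_squared[of "x \<bullet> x"] by (simp add: D_def)
  qed
  have sphere: "u x t \<in> sphere 0 1" for x t
    using norm1[of x "\<omega> * t"] by (simp add: u_def rotating_def norm_emb)
  have eq: "rotating \<omega> (\<lambda>x. \<i> * \<omega> * F x) (\<lambda>_. 0) x t =
      cross3 (u x t) (laplacian (\<lambda>y. u y t) x - sphere_gradient H (u x t))" for x t
  proof -
    define v where "v = x \<bullet> x"
    define \<alpha> where "\<alpha> = 4 * v * K2 v + 4 * (real n + 1) * K1 v"
    define \<beta> where "\<beta> = 4 * v * C2 v + 4 * C1 v"
    define w where "w = zc \<sigma> x ^ n * cis (\<omega> * t)"
    have u: "u x t = emb (K v *\<^sub>R w, C v)"
      by (simp add: u_def rotating_def F_def D_def v_def w_def)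
    have lap: "laplacian (\<lambda>y. u y t) x = emb (\<alpha> *\<^sub>R w, \<beta>)"
    proof -
      have "(\<Sum>b\<in>Basis. 4 * C2 v * (x \<bullet> b) * (x \<bullet> b) + 2 * C1 v * (b \<bullet> b)) = \<beta>"
        unfolding sum_Basis_2 inner_axis_2 \<beta>_def
        by (simp add: inner_axis_axis v_def inner_self_2 power2_eq_square algebra_simps)
      then show ?thesis
        unfolding u_def laplacian_rotating[OF F2 D2]
        unfolding rotating_def laplacian_radial_power[OF \<sigma> n] v_def[symmetric] \<alpha>_def
        by (simp add: w_def scaleR_conv_of_real mult.assoc)
    qed
    have ut: "rotating \<omega> (\<lambda>x. \<i> * \<omega> * F x) (\<lambda>_. 0) x t = emb (\<i> * \<omega> * (K v *\<^sub>R w), 0)"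
      by (simp add: rotating_def F_def v_def w_def mult.assoc)
    show ?thesis
    proof (cases "x = 0")
      case True
      have w0: "w = 0" using n_pos True by (simp add: w_def zc_def complex_eq_iff)
      have u0: "u x t = north_pole"
      proof -
        have "v = 0" using True by (simp add: v_def)
        then show ?thesis using \<open>w = 0\<close> by (simp add: u C_0 vec_eq_iff forall_3 north_pole_def)
      qed
      have g0: "sphere_gradient H north_pole = 0"
        by (rule sphere_gradient_north_pole[where H = H and Gt = Gt, OF H]) (use Gt[of 0] \<open>g 0 = 0\<close> in auto)
      show ?thesis
        unfolding ut lap u0 g0 by (simp add: w0 vec_eq_iff forall_3 cross3_def north_pole_def)
    next
      case False
      then have v: "0 < v" by (simp add: v_def)
      define s where "s = eta v"
      have s: "0 < s" using eta_pos[OF v] by (simp add: s_def)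
      define a where "a = angle n s"
      have a: "0 < a" "a < pi" using angle_bounds(1)[OF s, of n] angle_bounds(2)[of n s] by (auto simp: a_def)
      have sa: "0 < sin a" using a by (rule sin_gt_zero)
      have Cv: "C v = cos a" by (simp add: C_def cos_angle a_def s_def)
      have u3: "u x t $ 3 = cos a" by (simp add: u Cv)
      have sq: "sqrt (1 - (cos a)\<^sup>2) = sin a" using sa by (simp add: sin_squared_eq[symmetric])
      have "\<bar>cos a\<bar> < 1"
      proof -
        have "(cos a)\<^sup>2 < 1" using sa sin_squared_eq[of a] zero_less_power[OF sa, of 2] by linarith
        then show ?thesis by (simp add: abs_square_less_1)
      qed
      then have "sphere_gradient H (u x t) = - ((g a - \<omega> * sin a) / sin a) *\<^sub>R (north_pole - cos a *\<^sub>R u x t)"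
        using sphere_gradient_zonal[where H = H and Gt = Gt and u = "u x t" and D = "g a - \<omega> * sin a", OF H sphere] Gt[of a] a u3 sq arccos_cos[of a] by simp
      \<comment> \<open>Division by sin a turns g into b and the term - \<omega> sin a into the
        constant - \<omega>. This constant produces exactly the rotation about the axis with angular
        velocity \<omega>.\<close>
      moreover have "(g a - \<omega> * sin a) / sin a = b s - \<omega>"
        using b_g[OF s] sa by (simp add: a_def[symmetric] field_simps)
      ultimately have grad: "sphere_gradient H (u x t) = - (b s - \<omega>) *\<^sub>R (north_pole - C v *\<^sub>R u x t)"
        by (simp add: Cv)
      have ode: "K v * (\<beta> + b s) = C v * \<alpha>"
        using K_C_equation[OF v] by (simp add: \<alpha>_def \<beta>_def s_def)
      define p where "p = Re w"
      define q where "q = Im w"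
      have key: "K v * (\<beta> + (b s - \<omega>)) - C v * \<alpha> = - (\<omega> * K v)"
        using ode by (simp add: algebra_simps)
      \<comment> \<open>\<open>c1\<close>, \<open>c2\<close> and \<open>c3\<close> correspond to the
        three components of the equation for w = p + i q. The first two are q and p times the same
        scalar identity \<open>key\<close>; the third holds because u, its Laplacian and the
        gradient have horizontal parts proportional to w.\<close>
      have c1: "- \<omega> * (K v * q) = (K v * q) * (\<beta> + (b s - \<omega>) * (1 - C v * C v)) - C v * (\<alpha> * q + (b s - \<omega>) * (0 - C v * (K v * q)))"
      proof -
        have "(K v * q) * (\<beta> + (b s - \<omega>) * (1 - C v * C v)) - C v * (\<alpha> * q + (b s - \<omega>) * (0 - C v * (K v * q)))
           = q * (K v * (\<beta> + (b s - \<omega>)) - C v * \<alpha>)" by (simp add: algebra_simps)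
        then show ?thesis unfolding key by simp
      qed
      have c2: "\<omega> * (K v * p) = C v * (\<alpha> * p + (b s - \<omega>) * (0 - C v * (K v * p))) - (K v * p) * (\<beta> + (b s - \<omega>) * (1 - C v * C v))"
      proof -
        have "C v * (\<alpha> * p + (b s - \<omega>) * (0 - C v * (K v * p))) - (K v * p) * (\<beta> + (b s - \<omega>) * (1 - C v * C v))
           = - p * (K v * (\<beta> + (b s - \<omega>)) - C v * \<alpha>)" by (simp add: algebra_simps)
        then show ?thesis unfolding key by simp
      qed
      have c3: "p * (\<alpha> * q - (b s - \<omega>) * (C v * (K v * q))) = q * (\<alpha> * p - (b s - \<omega>) * (C v * (K v * p)))"
        by (simp add: algebra_simps)
      have "laplacian (\<lambda>y. u y t) x - sphere_gradient H (u x t) =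
          emb (Complex (\<alpha> * p + (b s - \<omega>) * (0 - C v * (K v * p))) (\<alpha> * q + (b s - \<omega>) * (0 - C v * (K v * q))),
            \<beta> + (b s - \<omega>) * (1 - C v * C v))"
        unfolding grad lap by (simp add: vec_eq_iff forall_3 u p_def q_def north_pole_def algebra_simps)
      then show ?thesis
        unfolding ut using c1 c2 c3
        by (simp add: vec_eq_iff forall_3 cross3_def u mult.left_commute[of \<omega>] flip: p_def q_def)
    qed
  qed
  have "is_solution H u"
    unfolding is_solution_def
  proof (intro conjI allI)
    show "C21_regular u" unfolding u_def by (rule C21_regular_rotating[OF F2 D2])
    show "u x t \<in> sphere 0 1" for x t by (rule sphere)
    show "vector_derivative (u x) (at t) = cross3 (u x t) (laplacian (\<lambda>y. u y t) x - sphere_gradient H (u x t))" for x t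
      using vector_derivative_at[OF has_vector_derivative_rotating[of \<omega> F D x t]] eq[of x t] by (simp add: u_def)
  qed
  moreover have "has_equivariant_form m \<omega> h u"
    unfolding has_equivariant_form_def
  proof (intro allI impI)
    fix r \<theta> t :: real assume r: "0 \<le> r"
    define x :: "real^2" where "x = vector [r * cos \<theta>, r * sin \<theta>]"
    have xx: "x \<bullet> x = r\<^sup>2"
      by (simp add: inner_self_2 x_def power_mult_distrib flip: distrib_left)
    have "zc \<sigma> x = r * cis (\<sigma> * \<theta>)"
      using m by (auto simp: zc_def x_def complex_eq_iff \<sigma>_def sgn_if)
    then have "zc \<sigma> x ^ n = r ^ n * cis (of_int m * \<theta>)"
      by (simp add: power_mult_distrib Complex.DeMoivre mult.assoc[symmetric] n\<sigma>)
    moreover have "K (r\<^sup>2) * r ^ n = sin (h r)"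
      using K_power[of "r\<^sup>2"] r by (simp add: h_def)
    ultimately have "F x * cis (\<omega> * t) = sin (h r) * cis (of_int m * \<theta> + \<omega> * t)"
      by (simp add: F_def xx scaleR_conv_of_real mult.assoc cis_mult flip: of_real_mult)
        (simp flip: of_real_mult of_real_power)
    moreover have "D x = cos (h r)" by (simp add: D_def xx C_def cos_angle h_def)
    ultimately show "u (vector [r * cos \<theta>, r * sin \<theta>]) t = vector [sin (h r) * cos (of_int m * \<theta> + \<omega> * t),
        sin (h r) * sin (of_int m * \<theta> + \<omega> * t), cos (h r)]"
      by (simp add: u_def rotating_def x_def[symmetric] emb_def)
  qed
  moreover have "h 0 = 0" using n_pos by (simp add: h_def)
  moreover have "(h \<longlongrightarrow> pi) at_top"
    unfolding h_def
    by (rule filterlim_compose[OF angle_at_top[OF n]], rule filterlim_compose[OF eta_at_top])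
      (intro filterlim_pow_at_top filterlim_ident, simp)
  moreover have "0 < h r \<and> h r < pi" if "0 < r" for r
    using angle_bounds(1)[of "eta (r\<^sup>2)" n] angle_bounds(2)[of n "eta (r\<^sup>2)"] eta_pos[of "r\<^sup>2"] that by (simp add: h_def)
  ultimately show ?thesis by blast
qed

section \<open>The ordinary differential equation of a solution\<close>

definition pt :: "real \<Rightarrow> real \<Rightarrow> real^2" where "pt a b = vector [a, b]"

lemma pt_add: "pt a b + s *\<^sub>R axis 1 1 = pt (a + s) b" "pt a b + s *\<^sub>R axis 2 1 = pt a (b + s)"
  by (simp_all add: pt_def vec_eq_iff forall_2 axis_def)

lemma axis_Basis_2: "axis 1 1 \<in> (Basis :: (real^2) set)" "axis 2 1 \<in> (Basis :: (real^2) set)"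
  by (auto simp: Basis_vec_def)

lemma DERIV_component:
  fixes F :: "real^2 \<Rightarrow> real^3"
  assumes "(\<lambda>s. F (x + s *\<^sub>R b)) differentiable at 0"
  shows "((\<lambda>s. F (x + s *\<^sub>R b) $ i) has_real_derivative partial_derivative b F x $ i) (at 0)"
proof -
  have "((\<lambda>s. F (x + s *\<^sub>R b)) has_vector_derivative partial_derivative b F x) (at 0)"
    using assms vector_derivative_works unfolding partial_derivative_def by blast
  from bounded_linear.has_vector_derivative[OF bounded_linear_vec_nth this, of i]
  show ?thesis by (simp add: has_real_derivative_iff_has_vector_derivative)
qed

lemma DERIV_local_eq:
  fixes f g :: "real \<Rightarrow> real"
  assumes f: "(f has_real_derivative D) (at x)" and S: "open S" "x \<in> S" and eq: "\<And>y. y \<in> S \<Longrightarrow> f y = g y"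
  shows "(g has_real_derivative D) (at x)"
  by (rule has_field_derivative_transform_within_open[OF f S]) (rule eq)

lemma DERIV_mult_id_at_0:
  fixes f :: "real \<Rightarrow> real"
  assumes "isCont f 0"
  shows "((\<lambda>y. y * f y) has_real_derivative f 0) (at 0)"
  using has_vector_derivative_scaleR_at_0[OF assms]
  by (simp add: has_real_derivative_iff_has_vector_derivative)

lemma polar_pt:
  assumes "0 < r"
  shows "pt r y = vector [sqrt (r\<^sup>2 + y\<^sup>2) * cos (arctan (y / r)), sqrt (r\<^sup>2 + y\<^sup>2) * sin (arctan (y / r))]"
proof -
  have "sqrt (r\<^sup>2 + y\<^sup>2) = r * sqrt (1 + (y / r)\<^sup>2)"
  proof -
    have "r\<^sup>2 + y\<^sup>2 = r\<^sup>2 * (1 + (y / r)\<^sup>2)" using assms by (simp add: field_simps)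
    then show ?thesis using assms by (simp add: real_sqrt_mult)
  qed
  moreover have "0 < sqrt (1 + (y / r)\<^sup>2)" by (simp add: add_pos_nonneg)
  ultimately show ?thesis using assms by (simp add: pt_def cos_arctan sin_arctan)
qed

text \<open>The flow equation is evaluated at time 0 on the positive first axis, where its second
  component alone gives the ordinary differential equation. The second derivative along the axis is
  computed on the ray itself, the transversal one on the perpendicular line, in polar
  coordinates.\<close>

lemma equivariant_solution_ode:
  fixes m :: int and H :: "real^3 \<Rightarrow> real"
  assumes sol: "is_solution H u" and form: "has_equivariant_form m \<omega> h u"
    and h: "\<And>r. 0 < r \<Longrightarrow> 0 < h r \<and> h r < pi" and h0: "h 0 = 0"
    and H: "\<And>u. u \<in> sphere 0 1 \<Longrightarrow> H u = Gt (sphere_dist u north_pole)"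
    and Gt: "\<And>x. x \<in> {0..pi} \<Longrightarrow> (Gt has_real_derivative g x - \<omega> * sin x) (at x within {0..pi})"
  obtains h1 h2 where
    "\<And>r. 0 < r \<Longrightarrow> (h has_real_derivative h1 r) (at r)"
    "\<And>r. 0 < r \<Longrightarrow> (h1 has_real_derivative h2 r) (at r)"
    "\<And>r. 0 < r \<Longrightarrow> h2 r + h1 r / r - (of_int m)\<^sup>2 * sin (h r) * cos (h r) / r\<^sup>2 = g (h r)"
    "(h \<longlongrightarrow> 0) (at_right 0)"
proof -
  define f where "f = (\<lambda>x. u x 0)"
  define e1 where "e1 = (axis 1 1 :: real^2)"
  define e2 where "e2 = (axis 2 1 :: real^2)"
  define D1 where "D1 = partial_derivative e1 f"
  define D2 where "D2 = partial_derivative e2 f"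
  define D11 where "D11 = partial_derivative e1 D1"
  define D22 where "D22 = partial_derivative e2 D2"
  have reg: "C21_regular u" using sol by (simp add: is_solution_def)
  have d1: "(\<lambda>s. f (x + s *\<^sub>R e1)) differentiable at 0" "(\<lambda>s. D1 (x + s *\<^sub>R e1)) differentiable at 0" for x
    using reg axis_Basis_2(1) unfolding C21_regular_def f_def D1_def e1_def by blast+
  have d2: "(\<lambda>s. f (x + s *\<^sub>R e2)) differentiable at 0" "(\<lambda>s. D2 (x + s *\<^sub>R e2)) differentiable at 0" for x
    using reg axis_Basis_2(2) unfolding C21_regular_def f_def D2_def e2_def by blast+
  have dr: "((\<lambda>r. f (pt r 0) $ i) has_real_derivative D1 (pt r 0) $ i) (at r)"
      "((\<lambda>r. D1 (pt r 0) $ i) has_real_derivative D11 (pt r 0) $ i) (at r)" for r i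
    using DERIV_component[OF d1(1), of "pt r 0" i] DERIV_component[OF d1(2), of "pt r 0" i]
      DERIV_shift[of "\<lambda>r. f (pt r 0) $ i" _ 0 r] DERIV_shift[of "\<lambda>r. D1 (pt r 0) $ i" _ 0 r]
    by (simp_all add: e1_def pt_add D1_def D11_def add.commute)
  have dy: "((\<lambda>y. f (pt r y) $ i) has_real_derivative D2 (pt r y) $ i) (at y)"
      "((\<lambda>y. D2 (pt r y) $ i) has_real_derivative D22 (pt r y) $ i) (at y)" for r y i
    using DERIV_component[OF d2(1), of "pt r y" i] DERIV_component[OF d2(2), of "pt r y" i]
      DERIV_shift[of "\<lambda>y. f (pt r y) $ i" _ 0 y] DERIV_shift[of "\<lambda>y. D2 (pt r y) $ i" _ 0 y]
    by (simp_all add: e2_def pt_add D2_def D22_def add.commute)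
  have fr: "f (pt r 0) $ 1 = sin (h r)" "f (pt r 0) $ 3 = cos (h r)" if "0 \<le> r" for r
    using form[unfolded has_equivariant_form_def, rule_format, OF that, of 0 0] by (simp_all add: f_def pt_def)
  define h1 where "h1 = (\<lambda>r. - D1 (pt r 0) $ 3 / sin (h r))"
  have sinh: "0 < sin (h r)" if "0 < r" for r using h[OF that] by (simp add: sin_gt_zero)
  \<comment> \<open>Differentiability is known for u only. Recovering h from the third component,
    which is possible since 0 < h < \<pi>, transfers it to h.\<close>
  have h_arccos: "h r = arccos (f (pt r 0) $ 3)" if "0 < r" for r
    using h[OF that] fr(2)[of r] that by (simp add: arccos_cos)
  have dh: "(h has_real_derivative h1 r) (at r)" if r: "0 < r" for r
  proof -
    have c: "f (pt r 0) $ 3 = cos (h r)" using fr r by simp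
    have "\<bar>cos (h r)\<bar> < 1"
    proof -
      have "(cos (h r))\<^sup>2 < 1" using sin_squared_eq[of "h r"] zero_less_power[OF sinh[OF r], of 2] by linarith
      then show ?thesis by (simp add: abs_square_less_1)
    qed
    then have "((\<lambda>r. arccos (f (pt r 0) $ 3)) has_real_derivative inverse (- sqrt (1 - (f (pt r 0) $ 3)\<^sup>2)) * D1 (pt r 0) $ 3) (at r)"
      by (intro DERIV_chain2[OF DERIV_arccos dr(1)]) (auto simp: c)
    moreover have "sqrt (1 - (f (pt r 0) $ 3)\<^sup>2) = sin (h r)"
      using sinh[OF r] by (simp add: c sin_squared_eq[symmetric])
    ultimately have "((\<lambda>r. arccos (f (pt r 0) $ 3)) has_real_derivative h1 r) (at r)"
      by (simp add: h1_def divide_inverse mult.commute)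
    then show ?thesis by (rule DERIV_local_eq[of _ _ _ "{0<..}"]) (use r h_arccos in auto)
  qed
  define h2 where "h2 = (\<lambda>r. (- D11 (pt r 0) $ 3 * sin (h r) - (- D1 (pt r 0) $ 3) * (cos (h r) * h1 r)) / (sin (h r) * sin (h r)))"
  have dh1: "(h1 has_real_derivative h2 r) (at r)" if r: "0 < r" for r
    unfolding h1_def h2_def
    by (intro DERIV_divide DERIV_minus dr DERIV_chain2[OF DERIV_sin dh[OF r, unfolded h1_def]])
      (use sinh[OF r] in simp)
  have D1: "D1 (pt r 0) $ 1 = cos (h r) * h1 r" "D1 (pt r 0) $ 3 = - sin (h r) * h1 r" if r: "0 < r" for r
  proof -
    have "((\<lambda>r. sin (h r)) has_real_derivative D1 (pt r 0) $ 1) (at r)"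
      by (rule DERIV_local_eq[OF dr(1), of "{0<..}"]) (use r fr in auto)
    then show "D1 (pt r 0) $ 1 = cos (h r) * h1 r"
      by (rule DERIV_unique) (rule DERIV_chain2[OF DERIV_sin dh[OF r]])
    show "D1 (pt r 0) $ 3 = - sin (h r) * h1 r" using sinh[OF r] by (simp add: h1_def)
  qed
  have D11: "D11 (pt r 0) $ 1 = - sin (h r) * h1 r * h1 r + h2 r * cos (h r)"
      "D11 (pt r 0) $ 3 = (- (cos (h r) * h1 r)) * h1 r + h2 r * (- sin (h r))" if r: "0 < r" for r
  proof -
    have "((\<lambda>r. cos (h r) * h1 r) has_real_derivative D11 (pt r 0) $ 1) (at r)"
      by (rule DERIV_local_eq[OF dr(2), of "{0<..}"]) (use r D1 in auto)
    then show "D11 (pt r 0) $ 1 = - sin (h r) * h1 r * h1 r + h2 r * cos (h r)"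
      by (rule DERIV_unique) (rule DERIV_mult[OF DERIV_chain2[OF DERIV_cos dh[OF r]] dh1[OF r]])
    have "((\<lambda>r. - sin (h r) * h1 r) has_real_derivative D11 (pt r 0) $ 3) (at r)"
      by (rule DERIV_local_eq[OF dr(2), of "{0<..}"]) (use r D1 in auto)
    then show "D11 (pt r 0) $ 3 = (- (cos (h r) * h1 r)) * h1 r + h2 r * (- sin (h r))"
      by (rule DERIV_unique) (rule DERIV_mult[OF DERIV_minus[OF DERIV_chain2[OF DERIV_sin dh[OF r]]] dh1[OF r]])
  qed
  have D22: "D22 (pt r 0) $ 1 = cos (h r) * h1 r / r - (of_int m)\<^sup>2 * sin (h r) / r\<^sup>2"
      "D22 (pt r 0) $ 3 = - sin (h r) * h1 r / r" if r: "0 < r" for r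
  proof -
    define \<rho> where "\<rho> = (\<lambda>y. sqrt (r\<^sup>2 + y\<^sup>2))"
    define \<theta> where "\<theta> = (\<lambda>y. arctan (y / r))"
    have \<rho>: "0 < \<rho> y" "(\<rho> y)\<^sup>2 = r\<^sup>2 + y\<^sup>2" for y using r by (auto simp: \<rho>_def add_pos_nonneg)
    have \<rho>0: "\<rho> 0 = r" "\<theta> 0 = 0" using r by (simp_all add: \<rho>_def \<theta>_def)
    have d\<rho>: "(\<rho> has_real_derivative y / \<rho> y) (at y)" for y
    proof -
      have "(\<rho> has_real_derivative inverse (sqrt (r\<^sup>2 + y\<^sup>2)) / 2 * (2 * y)) (at y)"
        unfolding \<rho>_def
      proof (rule DERIV_chain2[OF DERIV_real_sqrt])
        show "0 < r\<^sup>2 + y\<^sup>2" using r by (simp add: add_pos_nonneg)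
        show "((\<lambda>y. r\<^sup>2 + y\<^sup>2) has_real_derivative 2 * y) (at y)"
          using DERIV_add[OF DERIV_const[of "r\<^sup>2"] DERIV_power[OF DERIV_ident, of 2]] by simp
      qed
      then show ?thesis by (rule DERIV_cong) (simp add: \<rho>_def inverse_eq_divide)
    qed
    have d\<theta>: "(\<theta> has_real_derivative r / (\<rho> y)\<^sup>2) (at y)" for y
    proof -
      have "(\<theta> has_real_derivative inverse (1 + (y / r)\<^sup>2) * (1 / r)) (at y)"
        unfolding \<theta>_def by (rule DERIV_chain2[OF DERIV_arctan DERIV_cdivide[OF DERIV_ident]])
      moreover have "inverse (1 + (y / r)\<^sup>2) * (1 / r) = r / (\<rho> y)\<^sup>2"
      proof -
        have "1 + (y / r)\<^sup>2 = (r\<^sup>2 + y\<^sup>2) / r\<^sup>2" using r by (simp add: field_simps)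
        then show ?thesis unfolding \<rho>(2) using r by (simp add: power2_eq_square)
      qed
      ultimately show ?thesis by simp
    qed
    have "f (pt r y) = vector [sin (h (\<rho> y)) * cos (of_int m * \<theta> y), sin (h (\<rho> y)) * sin (of_int m * \<theta> y), cos (h (\<rho> y))]" for y
      using form[unfolded has_equivariant_form_def, rule_format, of "\<rho> y" "\<theta> y" 0] \<rho>(1)[of y]
      by (simp add: f_def polar_pt[OF r] \<rho>_def \<theta>_def)
    then have fy: "f (pt r y) $ 1 = sin (h (\<rho> y)) * cos (of_int m * \<theta> y)" "f (pt r y) $ 3 = cos (h (\<rho> y))" for y
      by simp_all
    note hy = DERIV_chain2[OF dh[OF \<rho>(1)] d\<rho>]
    \<comment> \<open>Written as y times a continuous function, so that the derivative at y = 0 is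
      the value of that function there.\<close>
    have D2_3: "D2 (pt r y) $ 3 = y * (- sin (h (\<rho> y)) * h1 (\<rho> y) / \<rho> y)" for y
    proof -
      have "((\<lambda>y. cos (h (\<rho> y))) has_real_derivative D2 (pt r y) $ 3) (at y)"
        using dy(1)[of r 3 y] by (simp add: fy)
      then have "D2 (pt r y) $ 3 = - sin (h (\<rho> y)) * (h1 (\<rho> y) * (y / \<rho> y))"
        by (rule DERIV_unique) (rule DERIV_chain2[OF DERIV_cos hy])
      then show ?thesis by simp
    qed
    have c\<rho>: "isCont \<rho> 0" by (rule DERIV_isCont[OF d\<rho>])
    have ch: "isCont (\<lambda>y. h (\<rho> y)) 0" by (rule DERIV_isCont[OF hy])
    have ch1: "isCont (\<lambda>y. h1 (\<rho> y)) 0"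
      by (rule DERIV_isCont[OF DERIV_chain2[OF dh1[OF \<rho>(1)] d\<rho>]])
    have \<rho>nz: "\<rho> 0 \<noteq> 0" using \<rho>(1)[of 0] by simp
    have "((\<lambda>y. y * (- sin (h (\<rho> y)) * h1 (\<rho> y) / \<rho> y)) has_real_derivative D22 (pt r 0) $ 3) (at 0)"
      using dy(2)[of r 3 0] by (simp only: D2_3)
    then have "D22 (pt r 0) $ 3 = - sin (h (\<rho> 0)) * h1 (\<rho> 0) / \<rho> 0"
      by (rule DERIV_unique) (intro DERIV_mult_id_at_0 continuous_intros ch ch1 c\<rho> \<rho>nz)
    then show "D22 (pt r 0) $ 3 = - sin (h r) * h1 r / r" by (simp add: \<rho>0)
    define k where "k = (\<lambda>y. cos (h (\<rho> y)) * h1 (\<rho> y) / \<rho> y * cos (of_int m * \<theta> y))"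
    define l where "l = (\<lambda>y. - sin (h (\<rho> y)) * (of_int m * (r / (\<rho> y)\<^sup>2)))"
    have D2_1: "D2 (pt r y) $ 1 = y * k y + l y * sin (of_int m * \<theta> y)" for y
    proof -
      have "((\<lambda>y. sin (h (\<rho> y)) * cos (of_int m * \<theta> y)) has_real_derivative D2 (pt r y) $ 1) (at y)"
        using dy(1)[of r 1 y] by (simp add: fy)
      then have "D2 (pt r y) $ 1 = cos (h (\<rho> y)) * (h1 (\<rho> y) * (y / \<rho> y)) * cos (of_int m * \<theta> y)
          + - sin (of_int m * \<theta> y) * (of_int m * (r / (\<rho> y)\<^sup>2)) * sin (h (\<rho> y))"
        by (rule DERIV_unique) (intro DERIV_mult DERIV_chain2[OF DERIV_sin hy] DERIV_chain2[OF DERIV_cos DERIV_cmult[OF d\<theta>]])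
      then show ?thesis by (simp add: k_def l_def mult_ac)
    qed
    have c\<theta>: "isCont \<theta> 0" by (rule DERIV_isCont[OF d\<theta>])
    have ck: "isCont k 0" unfolding k_def by (intro continuous_intros ch ch1 c\<rho> c\<theta> \<rho>nz)
    \<comment> \<open>Differentiability of l is what counts: in the product rule its derivative is
      multiplied by sin 0.\<close>
    obtain l' where dl: "(l has_real_derivative l') (at 0)"
    proof -
      have nz: "(\<rho> 0)\<^sup>2 \<noteq> 0" using \<rho>nz by simp
      show thesis
        using that[unfolded l_def] DERIV_mult[OF DERIV_minus[OF DERIV_chain2[OF DERIV_sin hy[of 0]]]
          DERIV_cmult[OF DERIV_divide[OF DERIV_const[of r] DERIV_power[OF d\<rho>[of 0], of 2] nz], of "of_int m"]]
        by blast
    qed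
    have "((\<lambda>y. y * k y + l y * sin (of_int m * \<theta> y)) has_real_derivative D22 (pt r 0) $ 1) (at 0)"
      using dy(2)[of r 1 0] by (simp only: D2_1)
    moreover have "((\<lambda>y. y * k y + l y * sin (of_int m * \<theta> y)) has_real_derivative
        k 0 + (l' * sin (of_int m * \<theta> 0) + cos (of_int m * \<theta> 0) * (of_int m * (r / (\<rho> 0)\<^sup>2)) * l 0)) (at 0)"
      by (intro DERIV_add DERIV_mult_id_at_0 ck DERIV_mult dl DERIV_chain2[OF DERIV_sin DERIV_cmult[OF d\<theta>]])
    ultimately have "D22 (pt r 0) $ 1 = k 0 + (l' * sin (of_int m * \<theta> 0) + cos (of_int m * \<theta> 0) * (of_int m * (r / (\<rho> 0)\<^sup>2)) * l 0)"
      by (rule DERIV_unique)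
    then show "D22 (pt r 0) $ 1 = cos (h r) * h1 r / r - (of_int m)\<^sup>2 * sin (h r) / r\<^sup>2"
      using r by (simp add: \<rho>0 k_def l_def power2_eq_square)
  qed
  have ode: "h2 r + h1 r / r - (of_int m)\<^sup>2 * sin (h r) * cos (h r) / r\<^sup>2 = g (h r)" if r: "0 < r" for r
  proof -
    define x where "x = pt r 0"
    define a where "a = h r"
    have a: "0 < a" "a < pi" "0 < sin a" using h[OF r] sinh[OF r] by (auto simp: a_def)
    define \<kappa> where "\<kappa> = (g a - \<omega> * sin a) / sin a"
    have ut: "u x t = vector [sin a * cos (\<omega> * t), sin a * sin (\<omega> * t), cos a]" for t
      using form[unfolded has_equivariant_form_def, rule_format, of r 0 t] r by (simp add: x_def pt_def a_def)
    have sph: "u x 0 \<in> sphere 0 1" using sol by (simp add: is_solution_def)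
    have "(u x has_vector_derivative vector_derivative (u x) (at 0)) (at 0)"
      using reg by (simp add: C21_regular_def vector_derivative_works)
    from bounded_linear.has_vector_derivative[OF bounded_linear_vec_nth this, of 2]
    have "((\<lambda>t. sin a * sin (\<omega> * t)) has_real_derivative vector_derivative (u x) (at 0) $ 2) (at 0)"
      by (simp add: has_real_derivative_iff_has_vector_derivative ut)
    moreover have "((\<lambda>t. sin a * sin (\<omega> * t)) has_real_derivative sin a * (cos (\<omega> * 0) * (\<omega> * 1))) (at 0)"
      by (intro DERIV_cmult DERIV_chain2[OF DERIV_sin] DERIV_ident)
    ultimately have "vector_derivative (u x) (at 0) $ 2 = sin a * \<omega>"
      using DERIV_unique by fastforce
    moreover have "vector_derivative (u x) (at 0) = cross3 (u x 0) (laplacian (\<lambda>y. u y 0) x - sphere_gradient H (u x 0))"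
      using sol by (simp add: is_solution_def)
    moreover have "laplacian (\<lambda>y. u y 0) x = D11 x + D22 x"
      unfolding laplacian_def sum_Basis_2 D11_def D22_def D1_def D2_def e1_def e2_def f_def ..
    moreover have "sphere_gradient H (u x 0) = - \<kappa> *\<^sub>R (north_pole - cos a *\<^sub>R u x 0)"
    proof -
      have sq: "sqrt (1 - (cos a)\<^sup>2) = sin a" using a by (simp add: sin_squared_eq[symmetric])
      have "\<bar>cos a\<bar> < 1"
      proof -
        have "(cos a)\<^sup>2 < 1" using sin_squared_eq[of a] zero_less_power[OF a(3), of 2] by linarith
        then show ?thesis by (simp add: abs_square_less_1)
      qed
      then show ?thesis
        using sphere_gradient_zonal[where H = H and Gt = Gt and u = "u x 0" and D = "g a - \<omega> * sin a", OF H sph]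
          Gt[of a] a sq arccos_cos[of a] ut[of 0] by (simp add: \<kappa>_def)
    qed
    ultimately have "sin a * \<omega> = cross3 (u x 0) (D11 x + D22 x - - \<kappa> *\<^sub>R (north_pole - cos a *\<^sub>R u x 0)) $ 2"
      by simp
    then have 1: "sin a * \<omega> = cos a * (D11 x $ 1 + D22 x $ 1 + \<kappa> * (0 - cos a * sin a))
        - sin a * (D11 x $ 3 + D22 x $ 3 + \<kappa> * (1 - cos a * cos a))"
      by (simp add: cross3_def ut north_pole_def algebra_simps)
    have "cos a * (\<kappa> * (0 - cos a * sin a)) - sin a * (\<kappa> * (1 - cos a * cos a)) = - (\<kappa> * sin a)"
      by (simp add: algebra_simps)
    moreover have "\<kappa> * sin a = g a - \<omega> * sin a" using a by (simp add: \<kappa>_def)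
    ultimately have "g a = cos a * (D11 x $ 1 + D22 x $ 1) - sin a * (D11 x $ 3 + D22 x $ 3)"
      using 1 by (simp add: algebra_simps)
    also have "\<dots> = (h2 r + h1 r / r) * ((cos a)\<^sup>2 + (sin a)\<^sup>2) - (of_int m)\<^sup>2 * sin a * cos a / r\<^sup>2"
    proof -
      have "c * ((- s * d * d + e * c) + (c * d / r - k * s / r\<^sup>2)) - s * (((- (c * d)) * d + e * (- s)) + - s * d / r)
          = (e + d / r) * (c\<^sup>2 + s\<^sup>2) - k * s * c / r\<^sup>2" for s c d e k :: real
        by (simp add: power2_eq_square algebra_simps add_divide_distrib diff_divide_distrib)
      then show ?thesis unfolding x_def D11[OF r] D22[OF r] a_def .
    qed
    finally show ?thesis by (simp add: a_def)
  qed
  have lim: "(h \<longlongrightarrow> 0) (at_right 0)"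
  proof -
    have "isCont (\<lambda>r. f (pt r 0) $ 3) 0" by (rule DERIV_isCont[OF dr(1)])
    then have "((\<lambda>r. f (pt r 0) $ 3) \<longlongrightarrow> 1) (at_right 0)"
      using fr(2)[of 0] h0 by (simp add: isCont_def filterlim_at_split)
    moreover have "\<forall>\<^sub>F r in at_right 0. f (pt r 0) $ 3 \<in> {-1..1}"
      using at_right_pos by eventually_elim (simp add: fr(2))
    ultimately have "((\<lambda>r. arccos (f (pt r 0) $ 3)) \<longlongrightarrow> arccos 1) (at_right 0)"
      by (intro continuous_on_tendsto_compose[OF continuous_on_arccos']) auto
    then have "((\<lambda>r. arccos (f (pt r 0) $ 3)) \<longlongrightarrow> 0) (at_right 0)" by simp
    then show ?thesis
    proof (rule Lim_transform_eventually)
      show "\<forall>\<^sub>F r in at_right 0. arccos (f (pt r 0) $ 3) = h r"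
        using at_right_pos by eventually_elim (simp add: h_arccos)
    qed
  qed
  show thesis by (rule that[OF dh dh1 ode lim])
qed

section \<open>Comparison with the harmonic map\<close>

text \<open>Here \<open>x(t) = h(e\<^sup>t)\<close>. As long as \<open>Q = v\<^sup>2 - n\<^sup>2 sin\<^sup>2 x\<close> is positive, \<open>x\<close> rises
  faster than the harmonic map, which bounds \<open>Q\<close> from below by a multiple of \<open>M\<close>.\<close>

locale connecting_orbit =
  fixes n :: nat and g b :: "real \<Rightarrow> real" and \<xi> :: real and x v :: "real \<Rightarrow> real"
  assumes n: "1 \<le> n" and \<xi>: "0 < \<xi>" "\<xi> < pi"
    and g_pos: "\<And>a. 0 < a \<Longrightarrow> a < \<xi> \<Longrightarrow> 0 < g a" and g_neg: "\<And>a. \<xi> < a \<Longrightarrow> a < pi \<Longrightarrow> g a < 0" and g_\<xi>: "g \<xi> = 0"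
    and b_cont: "continuous_on {0..} b" and b_g: "\<And>s. 0 < s \<Longrightarrow> b s * sin (angle n s) = g (angle n s)"
    and dx: "\<And>t. (x has_real_derivative v t) (at t)"
    and dv: "\<And>t. (v has_real_derivative n\<^sup>2 * sin (x t) * cos (x t) + (exp t)\<^sup>2 * g (x t)) (at t)"
    and x_bounds: "\<And>t. 0 < x t" "\<And>t. x t < pi" and x_bot: "(x \<longlongrightarrow> 0) at_bot"
    and M_nonneg: "\<And>s. 0 < s \<Longrightarrow> 0 \<le> integral {0..s} (\<lambda>t. t * b t * sin2 n t)"
begin

definition Q :: "real \<Rightarrow> real" where "Q t = (v t)\<^sup>2 - n\<^sup>2 * (sin (x t))\<^sup>2"

text \<open>The inverse of \<open>angle n\<close> applied to x, that is the radius at which the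
  unscaled harmonic map has the height x(t).\<close>

definition sc :: "real \<Rightarrow> real" where "sc t = root n (tan (x t / 2))"

text \<open>The integral of 2 R^2 g over heights from 0 to \<open>angle n s\<close>, transformed by
  dh = n sin h ds / s and g = b sin h.\<close>

definition M :: "real \<Rightarrow> real" where "M s = 2 * real n * integral {0..s} (\<lambda>t. t * b t * sin2 n t)"

lemma sin_x: "0 < sin (x t)" using x_bounds by (simp add: sin_gt_zero)

lemma n_pos: "0 < n" using n by simp

lemma DERIV_Q: "(Q has_real_derivative 2 * (exp t)\<^sup>2 * g (x t) * v t) (at t)"
proof -
  have "(Q has_real_derivative
     real 2 * ((n\<^sup>2 * sin (x t) * cos (x t) + (exp t)\<^sup>2 * g (x t)) * v t ^ (2 - Suc 0))
      - n\<^sup>2 * (real 2 * (cos (x t) * v t * sin (x t) ^ (2 - Suc 0)))) (at t)"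
    unfolding Q_def[abs_def] by (intro DERIV_diff DERIV_cmult DERIV_power DERIV_chain2[OF DERIV_sin dx] dv)
  then show ?thesis by (rule DERIV_cong) (simp add: algebra_simps)
qed

lemma cont: "continuous_on S x" "continuous_on S v" "continuous_on S Q"
  by (auto intro!: continuous_at_imp_continuous_on DERIV_isCont[OF dx] DERIV_isCont[OF dv] DERIV_isCont[OF DERIV_Q])

lemma tan_pos: "0 < tan (x t / 2)"
  using x_bounds[of t] by (intro tan_gt_zero) auto

lemma sc_pos: "0 < sc t" using tan_pos n_pos by (simp add: sc_def)

lemma angle_sc: "angle n (sc t) = x t"
proof -
  have "sc t ^ n = tan (x t / 2)"
    using tan_pos[of t] n_pos by (simp add: sc_def)
  moreover have "arctan (tan (x t / 2)) = x t / 2"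
    using x_bounds[of t] by (intro arctan_tan) auto
  ultimately show ?thesis by (simp add: angle_def)
qed

lemma DERIV_ln_sc: "((\<lambda>t. ln (sc t)) has_real_derivative v t / (n * sin (x t))) (at t)"
proof -
  have c: "0 < cos (x t / 2)" using x_bounds[of t] by (intro cos_gt_zero_pi) auto
  have s: "0 < sin (x t / 2)" using x_bounds[of t] by (intro sin_gt_zero) auto
  have "((\<lambda>t. ln (tan (x t / 2)) / n) has_real_derivative
      (1 / tan (x t / 2) * (inverse ((cos (x t / 2))\<^sup>2) * (v t / 2))) / n) (at t)"
    by (intro DERIV_cdivide DERIV_chain2[OF DERIV_ln_divide] DERIV_chain2[OF DERIV_tan] dx tan_pos) (use c in simp)
  moreover have "(1 / tan (x t / 2) * (inverse ((cos (x t / 2))\<^sup>2) * (v t / 2))) / n = v t / (n * sin (x t))"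
  proof -
    have "sin (x t) = 2 * sin (x t / 2) * cos (x t / 2)" using sin_double[of "x t / 2"] by simp
    then show ?thesis using c s by (simp add: tan_def power2_eq_square divide_simps)
  qed
  moreover have "(\<lambda>t. ln (tan (x t / 2)) / n) = (\<lambda>t. ln (sc t))"
    using n_pos tan_pos by (simp add: sc_def ln_root)
  ultimately show ?thesis by metis
qed

lemma DERIV_sc: "(sc has_real_derivative sc t * (v t / (n * sin (x t)))) (at t)"
proof -
  have "((\<lambda>t. exp (ln (sc t))) has_real_derivative exp (ln (sc t)) * (v t / (n * sin (x t)))) (at t)"
    by (rule DERIV_chain2[OF DERIV_exp DERIV_ln_sc])
  then show ?thesis using sc_pos by simp
qed

lemma M_integrand: "continuous_on {0..} (\<lambda>t. t * b t * sin2 n t)"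
  by (intro continuous_intros b_cont)

lemma DERIV_M_sc: "((\<lambda>t. M (sc t)) has_real_derivative 2 * (sc t)\<^sup>2 * g (x t) * v t) (at t)"
proof -
  have "((\<lambda>t. M (sc t)) has_real_derivative
     2 * real n * ((sc t * b (sc t) * sin2 n (sc t)) * (sc t * (v t / (n * sin (x t)))))) (at t)"
    unfolding M_def
    by (intro DERIV_cmult DERIV_chain2[OF DERIV_primitive[OF M_integrand sc_pos] DERIV_sc])
  moreover have "2 * real n * ((sc t * b (sc t) * sin2 n (sc t)) * (sc t * (v t / (n * sin (x t)))))
      = 2 * (sc t)\<^sup>2 * (b (sc t) * sin (x t)) * v t"
    using n_pos sin_x[of t] by (simp add: sin2_eq angle_sc power2_eq_square)
  ultimately show ?thesis using b_g[OF sc_pos[of t]] by (simp add: angle_sc)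
qed

lemma sc_bot: "(sc \<longlongrightarrow> 0) at_bot"
proof -
  have "((\<lambda>t. root n (tan (x t / 2))) \<longlongrightarrow> root n (tan (0 / 2))) at_bot"
    by (intro tendsto_intros x_bot) auto
  then show ?thesis by (simp add: sc_def[abs_def])
qed

lemma M_bot: "((\<lambda>t. M (sc t)) \<longlongrightarrow> 0) at_bot"
proof -
  have "continuous_on {0..} M"
    unfolding M_def[abs_def] by (intro continuous_intros continuous_on_primitive M_integrand)
  then have "((\<lambda>t. M (sc t)) \<longlongrightarrow> M 0) at_bot"
    by (rule continuous_on_tendsto_compose[OF _ sc_bot]) (use sc_pos in \<open>auto simp: less_imp_le\<close>)
  then show ?thesis by (simp add: M_def)
qed

lemma M_sc_nonneg: "0 \<le> M (sc t)" using M_nonneg[OF sc_pos] by (simp add: M_def)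

text \<open>A lower bound for Q, because v^2 \<ge> 0. It takes the place of any information on the
  limit of v at - \<infinity>.\<close>

lemma sin_bot: "((\<lambda>t. - (n\<^sup>2 * (sin (x t))\<^sup>2)) \<longlongrightarrow> 0) at_bot"
proof -
  have "((\<lambda>t. - (n\<^sup>2 * (sin (x t))\<^sup>2)) \<longlongrightarrow> - (n\<^sup>2 * (sin 0)\<^sup>2)) at_bot"
    by (intro tendsto_intros x_bot)
  then show ?thesis by simp
qed

text \<open>Early on, g and cos are positive, so v increases. A nonpositive v would make x grow
  backwards in time at a rate bounded away from 0, beyond \<pi>. With v > 0 also Q increases, and
  since it is bounded below by a function tending to 0 at - \<infinity>, it is positive.\<close>

lemma initial_time: "\<exists>T. \<forall>t\<le>T. x t < \<xi> \<and> 0 < v t \<and> 0 < Q t"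
proof -
  have "\<forall>\<^sub>F t in at_bot. x t < min \<xi> (pi / 2)"
    by (rule order_tendstoD(2)[OF x_bot]) (use \<xi> in auto)
  then obtain T where T: "\<And>t. t \<le> T \<Longrightarrow> x t < min \<xi> (pi / 2)" by (auto simp: eventually_at_bot_linorder)
  have v_mono: "v s < v t" if "s < t" "t \<le> T" for s t
  proof (rule increasing_on_Icc[OF that(1) cont(2) dv])
    fix z assume z: "s < z" "z < t"
    have "0 < cos (x z)" using T[of z] x_bounds(1)[of z] z that by (intro cos_gt_zero_pi) auto
    then have "0 \<le> n\<^sup>2 * sin (x z) * cos (x z)" using sin_x[of z] by simp
    moreover have "0 < (exp z)\<^sup>2 * g (x z)" using T[of z] x_bounds(1)[of z] z that by (intro mult_pos_pos g_pos) auto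
    ultimately show "0 < n\<^sup>2 * sin (x z) * cos (x z) + (exp z)\<^sup>2 * g (x z)" by simp
  qed
  have v: "0 < v t" if t: "t \<le> T" for t
  proof (rule ccontr)
    assume "\<not> 0 < v t"
    then have c: "v (t - 1) < 0" using v_mono[of "t - 1" t] t by simp
    \<comment> \<open>Backwards in time x gains at least - v (t - 1) per unit, so the missing pi - x
      (t - 1) is made up one unit before the end; the last unit makes x exceed \<pi>
      strictly.\<close>
    define z where "z = t - 1 - (pi - x (t - 1)) / (- v (t - 1)) - 1"
    have "(pi - x (t - 1)) / (- v (t - 1)) > 0" using c x_bounds(2)[of "t - 1"] by (intro divide_pos_pos) auto
    then have z: "z < t - 1" by (simp add: z_def)
    have "v (t - 1) * (t - 1) - x (t - 1) \<ge> v (t - 1) * z - x z"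
    proof (rule nondecreasing_on_Icc[of z "t - 1" "\<lambda>y. v (t - 1) * y - x y" "\<lambda>y. v (t - 1) * 1 - v y"])
      show "continuous_on {z..t - 1} (\<lambda>y. v (t - 1) * y - x y)" by (intro continuous_intros cont)
      fix y assume y: "z < y" "y < t - 1"
      show "((\<lambda>y. v (t - 1) * y - x y) has_real_derivative v (t - 1) * 1 - v y) (at y)"
        by (intro DERIV_diff DERIV_cmult DERIV_ident dx)
      show "0 \<le> v (t - 1) * 1 - v y" using v_mono[of y "t - 1"] y t by simp
    qed (use z in simp)
    then have "x (t - 1) + (- v (t - 1)) * (t - 1 - z) \<le> x z" by (simp add: algebra_simps)
    moreover have "(- v (t - 1)) * (t - 1 - z) = pi - x (t - 1) - v (t - 1)"
    proof -
      have "(- v (t - 1)) * ((pi - x (t - 1)) / (- v (t - 1)) + 1) = (pi - x (t - 1)) + - v (t - 1)"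
        using c by (simp only: distrib_left) simp
      moreover have "t - 1 - z = (pi - x (t - 1)) / (- v (t - 1)) + 1" by (simp add: z_def)
      ultimately show ?thesis by (metis add_uminus_conv_diff)
    qed
    ultimately show False using x_bounds(2)[of z] c by simp
  qed
  have Q_mono: "Q s < Q t" if "s < t" "t \<le> T" for s t
  proof (rule increasing_on_Icc[OF that(1) cont(3) DERIV_Q])
    fix z assume z: "s < z" "z < t"
    then show "0 < 2 * (exp z)\<^sup>2 * g (x z) * v z"
      using T[of z] x_bounds(1)[of z] that v[of z] by (intro mult_pos_pos g_pos) auto
  qed
  have "0 < Q t" if t: "t \<le> T" for t
  proof -
    have "0 \<le> Q (t - 1)"
    proof (rule tendsto_upperbound[OF sin_bot])
      show "\<forall>\<^sub>F s in at_bot. - (n\<^sup>2 * (sin (x s))\<^sup>2) \<le> Q (t - 1)"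
        unfolding eventually_at_bot_linorder
      proof (intro exI[of _ "t - 2"] allI impI)
        fix s assume "s \<le> t - 2"
        then have "Q s < Q (t - 1)" using Q_mono t by auto
        moreover have "- (n\<^sup>2 * (sin (x s))\<^sup>2) \<le> Q s" by (simp add: Q_def)
        ultimately show "- (n\<^sup>2 * (sin (x s))\<^sup>2) \<le> Q (t - 1)" by simp
      qed
    qed simp
    also have "\<dots> < Q t" using Q_mono t by simp
    finally show ?thesis .
  qed
  then show ?thesis using T v by (intro exI[of _ T]) auto
qed

text \<open>Stated for an initial segment of times, in order to apply both before a hypothetical
  first zero of Q and to the whole line. If x never exceeds \<xi>, then g(x) \<ge> 0 and Q itself is
  nondecreasing; otherwise the comparison is made at a time when x = \<xi>.\<close>

lemma Q_lower_bound:
  assumes I: "\<And>s t. t \<in> I \<Longrightarrow> s \<le> t \<Longrightarrow> s \<in> I" and Q: "\<And>t. t \<in> I \<Longrightarrow> 0 < Q t"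
    and T: "T \<in> I" "\<And>t. t \<le> T \<Longrightarrow> x t < \<xi> \<and> 0 < v t"
  shows "\<exists>\<delta>>0. \<exists>t0\<in>I. (\<forall>t\<in>I. t0 \<le> t \<longrightarrow> \<delta> \<le> Q t) \<and> (\<forall>t\<in>I. 0 < v t)"
proof -
  have v: "0 < v t" if t: "t \<in> I" for t
  proof (rule ccontr)
    assume "\<not> 0 < v t"
    then have vt: "v t \<le> 0" by simp
    then have Tt: "T \<le> t" using T(2)[of t] by force
    have "\<exists>z\<ge>T. z \<le> t \<and> v z = 0"
      by (rule IVT2') (use vt Tt T(2)[of T] cont in auto)
    then obtain z where z: "z \<le> t" "v z = 0" by blast
    have "Q z < 0" using z sin_x[of z] n_pos by (simp add: Q_def)
    then show False using Q[OF I[OF t z(1)]] by simp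
  qed
  have x_mono: "x s < x t" if "s < t" "t \<in> I" for s t
    by (rule increasing_on_Icc[OF that(1) cont(1) dx]) (use v I that in force)
  have fast: "1 < v t / (n * sin (x t))" if t: "t \<in> I" for t
  proof -
    have "(n * sin (x t))\<^sup>2 < (v t)\<^sup>2" using Q[OF t] by (simp add: Q_def power_mult_distrib)
    then have "n * sin (x t) < v t" using v[OF t] by (simp add: power2_less_imp_less)
    then show ?thesis using n_pos sin_x[of t] by simp
  qed
  show ?thesis
  proof (cases "\<exists>t\<in>I. \<xi> < x t")
    case False
    have "Q T \<le> Q t" if t: "t \<in> I" "T \<le> t" for t
    proof (rule nondecreasing_on_Icc[OF t(2) cont(3) DERIV_Q])
      fix z assume z: "T < z" "z < t"
      have zI: "z \<in> I" using I[OF t(1)] z by simp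
      have "x z < \<xi> \<or> x z = \<xi>" using False zI by force
      then have "0 \<le> g (x z)" using g_pos[of "x z"] x_bounds(1)[of z] g_\<xi> by auto
      then show "0 \<le> 2 * (exp z)\<^sup>2 * g (x z) * v z" using v[OF zI] by simp
    qed
    then show ?thesis using Q[OF T(1)] T(1) v by blast
  next
    case True
    then obtain t1 where t1: "t1 \<in> I" "\<xi> < x t1" by blast
    have "T \<le> t1" using T(2)[of t1] t1 by force
    then have "\<exists>z\<ge>T. z \<le> t1 \<and> x z = \<xi>"
      by (intro IVT') (use T(2)[of T] t1 cont in auto)
    then obtain p where p: "p \<le> t1" "x p = \<xi>" by blast
    have pI: "p \<in> I" using I[OF t1(1) p(1)] .
    \<comment> \<open>For a harmonic map ln sc - t is constant; Q > 0 says exactly that, with v > 0,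
      ln sc grows faster than t.\<close>
    have ratio: "ln (sc s) - s < ln (sc t) - t" if "s < t" "t \<in> I" for s t
    proof (rule increasing_on_Icc[OF that(1), where f = "\<lambda>t. ln (sc t) - t" and f' = "\<lambda>t. v t / (n * sin (x t)) - 1"])
      show "continuous_on {s..t} (\<lambda>t. ln (sc t) - t)"
        by (intro continuous_on_diff continuous_on_id continuous_at_imp_continuous_on ballI DERIV_isCont[OF DERIV_ln_sc])
      fix z assume z: "s < z" "z < t"
      show "((\<lambda>t. ln (sc t) - t) has_real_derivative v z / (n * sin (x z)) - 1) (at z)"
        by (intro DERIV_diff DERIV_ln_sc DERIV_ident)
      show "0 < v z / (n * sin (x z)) - 1" using fast[of z] I[OF that(2), of z] z by simp
    qed
    \<comment> \<open>The scale for which the harmonic map has height \<xi> at time p: there exp t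
      and \<mu> sc agree.\<close>
    define \<mu> where "\<mu> = exp p / sc p"
    have \<mu>: "0 < \<mu>" using sc_pos by (simp add: \<mu>_def)
    have l\<mu>: "ln \<mu> = p - ln (sc p)" using sc_pos[of p] by (simp add: \<mu>_def ln_div)
    have scale: "\<mu> * sc t = exp (t + ((ln (sc t) - t) - (ln (sc p) - p)))" for t
    proof -
      have "exp (t + ((ln (sc t) - t) - (ln (sc p) - p))) = exp (ln \<mu> + ln (sc t))" by (simp add: l\<mu>)
      then show ?thesis using \<mu> sc_pos[of t] by (simp add: exp_add)
    qed
    define N where "N = (\<lambda>t. Q t - \<mu>\<^sup>2 * M (sc t))"
    have dN: "(N has_real_derivative 2 * (exp t)\<^sup>2 * g (x t) * v t - \<mu>\<^sup>2 * (2 * (sc t)\<^sup>2 * g (x t) * v t)) (at t)" for t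
      unfolding N_def by (intro DERIV_diff DERIV_cmult DERIV_Q DERIV_M_sc)
    have N': "2 * (exp t)\<^sup>2 * g (x t) * v t - \<mu>\<^sup>2 * (2 * (sc t)\<^sup>2 * g (x t) * v t)
        = 2 * v t * (g (x t) * ((exp t)\<^sup>2 - (\<mu> * sc t)\<^sup>2))" for t
      by (simp add: algebra_simps)
    have cN: "continuous_on S N" for S
      by (intro continuous_at_imp_continuous_on ballI DERIV_isCont[OF dN])
    \<comment> \<open>Both factors change sign at p: g because x passes \<xi>, and the difference of
      squares because exp t and \<mu> sc are matched there. Their product is therefore positive on
      either side.\<close>
    have up: "0 < 2 * v t * (g (x t) * ((exp t)\<^sup>2 - (\<mu> * sc t)\<^sup>2))" if t: "t \<in> I" "t \<noteq> p" for t
    proof (cases "t < p")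
      case True
      have "\<mu> * sc t < exp t" using ratio[OF True pI] by (simp add: scale)
      then have "(\<mu> * sc t)\<^sup>2 < (exp t)\<^sup>2" using \<mu> sc_pos[of t] by (intro power_strict_mono) auto
      moreover have "0 < g (x t)" using x_mono[OF True pI] p x_bounds(1) by (intro g_pos) auto
      ultimately show ?thesis using v[OF t(1)] by simp
    next
      case False
      then have pt: "p < t" using t by simp
      have "exp t < \<mu> * sc t" using ratio[OF pt t(1)] by (simp add: scale)
      then have "(exp t)\<^sup>2 < (\<mu> * sc t)\<^sup>2" by (intro power_strict_mono) auto
      moreover have "g (x t) < 0" using x_mono[OF pt t(1)] p x_bounds(2) by (intro g_neg) auto
      ultimately show ?thesis using v[OF t(1)] by (simp add: mult_neg_neg)
    qed
    have before: "N s < N t" if "s < t" "t \<le> p" for s t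
    proof (rule increasing_on_Icc[OF that(1) cN dN])
      fix z assume "s < z" "z < t"
      then show "0 < 2 * (exp z)\<^sup>2 * g (x z) * v z - \<mu>\<^sup>2 * (2 * (sc z)\<^sup>2 * g (x z) * v z)"
        unfolding N' using I[OF pI, of z] that by (intro up) auto
    qed
    have after: "N p \<le> N t" if "p \<le> t" "t \<in> I" for t
    proof (rule nondecreasing_on_Icc[OF that(1) cN dN])
      fix z assume "p < z" "z < t"
      then show "0 \<le> 2 * (exp z)\<^sup>2 * g (x z) * v z - \<mu>\<^sup>2 * (2 * (sc z)\<^sup>2 * g (x z) * v z)"
        unfolding N' using I[OF that(2), of z] by (intro less_imp_le up) auto
    qed
    have "((\<lambda>t. - (n\<^sup>2 * (sin (x t))\<^sup>2) - \<mu>\<^sup>2 * M (sc t)) \<longlongrightarrow> 0 - \<mu>\<^sup>2 * 0) at_bot"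
      by (intro tendsto_diff tendsto_mult tendsto_const sin_bot M_bot)
    then have lim: "((\<lambda>t. - (n\<^sup>2 * (sin (x t))\<^sup>2) - \<mu>\<^sup>2 * M (sc t)) \<longlongrightarrow> 0) at_bot" by simp
    have "0 \<le> N (p - 1)"
    proof (rule tendsto_upperbound[OF lim])
      show "\<forall>\<^sub>F s in at_bot. - (n\<^sup>2 * (sin (x s))\<^sup>2) - \<mu>\<^sup>2 * M (sc s) \<le> N (p - 1)"
        unfolding eventually_at_bot_linorder
      proof (intro exI[of _ "p - 2"] allI impI)
        fix s assume "s \<le> p - 2"
        then have "N s < N (p - 1)" using before by auto
        moreover have "- (n\<^sup>2 * (sin (x s))\<^sup>2) - \<mu>\<^sup>2 * M (sc s) \<le> N s" by (simp add: N_def Q_def)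
        ultimately show "- (n\<^sup>2 * (sin (x s))\<^sup>2) - \<mu>\<^sup>2 * M (sc s) \<le> N (p - 1)" by simp
      qed
    qed simp
    also have "\<dots> < N p" using before by simp
    finally have Np: "0 < N p" .
    have "N p \<le> Q t" if "p \<le> t" "t \<in> I" for t
    proof -
      have "0 \<le> \<mu>\<^sup>2 * M (sc t)" using M_sc_nonneg by simp
      then show ?thesis using after[OF that] by (simp add: N_def)
    qed
    then show ?thesis using Np pI v by blast
  qed
qed

text \<open>At a first zero of Q, the positive lower bound valid before it would persist by
  continuity.\<close>

lemma Q_pos: "0 < Q t"
proof (rule ccontr)
  assume neg: "\<not> 0 < Q t"
  obtain T where T: "\<And>t. t \<le> T \<Longrightarrow> x t < \<xi> \<and> 0 < v t \<and> 0 < Q t" using initial_time by blast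
  define Z where "Z = {s. Q s \<le> 0}"
  have Z: "closed Z" "Z \<noteq> {}" "bdd_below Z"
  proof -
    have "continuous_on UNIV Q" by (rule cont)
    then show "closed Z" unfolding Z_def by (intro closed_Collect_le continuous_on_const)
    show "Z \<noteq> {}" using neg by (auto simp: Z_def not_less)
    show "bdd_below Z"
    proof (rule bdd_belowI[of _ T])
      fix s assume "s \<in> Z"
      then show "T \<le> s" using T[of s] by (force simp: Z_def)
    qed
  qed
  define p where "p = Inf Z"
  have p: "p \<in> Z" unfolding p_def by (rule closed_contains_Inf[OF Z(2,3,1)])
  have I: "0 < Q s" if "s \<in> {..<p}" for s
  proof (rule ccontr)
    assume "\<not> 0 < Q s"
    then have "p \<le> s" unfolding p_def by (intro cInf_lower Z) (simp add: Z_def)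
    then show False using that by simp
  qed
  have "T < p" using T[of p] p by (force simp: Z_def)
  then obtain \<delta> t0 where \<delta>: "0 < \<delta>" "t0 < p" "\<And>t. t < p \<Longrightarrow> t0 \<le> t \<Longrightarrow> \<delta> \<le> Q t"
    using Q_lower_bound[of "{..<p}" T] I T by auto
  have "(Q \<longlongrightarrow> Q p) (at_left p)"
    using DERIV_isCont[OF DERIV_Q, of p] by (simp add: isCont_def filterlim_at_split)
  moreover have "\<forall>\<^sub>F t in at_left p. \<delta> \<le> Q t"
    using eventually_at_left_real[OF \<delta>(2)] by eventually_elim (use \<delta> in auto)
  ultimately have "\<delta> \<le> Q p" by (intro tendsto_lowerbound) auto
  then show False using p \<delta> by (simp add: Z_def)
qed

theorem no_connecting_orbit: False
proof -
  obtain T where T: "\<And>t. t \<le> T \<Longrightarrow> x t < \<xi> \<and> 0 < v t \<and> 0 < Q t" using initial_time by blast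
  obtain \<delta> t0 where \<delta>: "0 < \<delta>" "\<And>t. t0 \<le> t \<Longrightarrow> \<delta> \<le> Q t" "\<And>t. 0 < v t"
    using Q_lower_bound[of UNIV T] Q_pos T by auto
  have v: "sqrt \<delta> \<le> v t" if "t0 \<le> t" for t
  proof -
    have "\<delta> \<le> (v t)\<^sup>2"
    proof -
      have "0 \<le> n\<^sup>2 * (sin (x t))\<^sup>2" by simp
      then show ?thesis using \<delta>(2)[OF that] unfolding Q_def by linarith
    qed
    then show ?thesis using \<delta>(3)[of t] by (intro real_le_lsqrt) auto
  qed
  define t where "t = t0 + pi / sqrt \<delta>"
  have t: "t0 \<le> t" using \<delta> by (simp add: t_def)
  have "x t0 - sqrt \<delta> * t0 \<le> x t - sqrt \<delta> * t"
  proof (rule nondecreasing_on_Icc[OF t, where f = "\<lambda>t. x t - sqrt \<delta> * t" and f' = "\<lambda>t. v t - sqrt \<delta> * 1"])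
    show "continuous_on {t0..t} (\<lambda>t. x t - sqrt \<delta> * t)" by (intro continuous_intros cont)
    fix z assume z: "t0 < z" "z < t"
    show "((\<lambda>t. x t - sqrt \<delta> * t) has_real_derivative v z - sqrt \<delta> * 1) (at z)"
      by (intro DERIV_diff DERIV_cmult DERIV_ident dx)
    show "0 \<le> v z - sqrt \<delta> * 1" using v[of z] z by simp
  qed
  moreover have "sqrt \<delta> * t = sqrt \<delta> * t0 + pi" using \<delta> by (simp add: t_def field_simps)
  ultimately have "x t0 + pi \<le> x t" by simp
  then show False using x_bounds(1)[of t0] x_bounds(2)[of t] by simp
qed

end

section \<open>The integral condition\<close>

context shooting
begin

abbreviation moment :: "real \<Rightarrow> real" where
  "moment s \<equiv> integral {0..s} (\<lambda>t. t * b t * sin2 n t)"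

lemma moment_integrand: "continuous_on {0..} (\<lambda>t. t * b t * sin2 n t)"
  by (intro continuous_intros b_cont)

lemma energy_integrand: "continuous_on {0..} (\<lambda>r. \<Gamma> r * r)"
  by (intro continuous_intros continuous_Gamma)

text \<open>Integration by parts with r dr = d(r^2) / 2. For n = 1 the boundary term need not tend
  to 0, so the signs of the integral and of the moment are related through inequalities rather than
  by passing to the limit.\<close>

lemma energy_integral:
  assumes s: "0 \<le> s"
  shows "2 * integral {0..s} (\<lambda>r. \<Gamma> r * r) = s\<^sup>2 * \<Gamma> s - n * moment s"
proof -
  define k where "k = (\<lambda>s. s\<^sup>2 * \<Gamma> s - n * moment s - 2 * integral {0..s} (\<lambda>r. \<Gamma> r * r))"
  have c: "continuous_on {0..s} k"
    unfolding k_def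
    by (intro continuous_intros continuous_Gamma_Icc continuous_on_subset[OF continuous_on_primitive[OF moment_integrand], of "{0..s}"]
        continuous_on_subset[OF continuous_on_primitive[OF energy_integrand], of "{0..s}"]) auto
  have d: "(k has_real_derivative 0) (at x)" if x: "0 < x" for x
  proof -
    have "(k has_real_derivative (2 * x * \<Gamma> x + n * b x * sin2 n x / x * x\<^sup>2) - n * (x * b x * sin2 n x) - 2 * (\<Gamma> x * x)) (at x)"
      unfolding k_def
      by (intro DERIV_diff DERIV_mult DERIV_cmult DERIV_primitive moment_integrand energy_integrand DERIV_Gamma x)
        (auto intro!: derivative_eq_intros)
    moreover have "(2 * x * \<Gamma> x + n * b x * sin2 n x / x * x\<^sup>2) - n * (x * b x * sin2 n x) - 2 * (\<Gamma> x * x) = 0"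
      using x by (simp add: power2_eq_square)
    ultimately show ?thesis by simp
  qed
  have "k 0 \<le> k s" by (rule nondecreasing_on_Icc[OF s c d]) auto
  moreover have "- k 0 \<le> - k s"
    by (rule nondecreasing_on_Icc[OF s continuous_on_minus[OF c] DERIV_minus[OF d]]) auto
  ultimately show ?thesis by (simp add: k_def)
qed

text \<open>Beyond \<sigma> the boundary term of \<open>energy_integral\<close> is nonnegative;
  before \<sigma> the integrand of the moment is.\<close>

lemma moment_nonneg:
  assumes le: "\<And>s. \<sigma> \<le> s \<Longrightarrow> integral {0..s} (\<lambda>r. \<Gamma> r * r) \<le> 0" and s: "0 < s"
  shows "0 \<le> moment s"
proof (cases "\<sigma> \<le> s")
  case True
  then have "0 \<le> n * moment s"
    using energy_integral[of s] le[OF True] s mult_nonneg_nonneg[OF zero_le_power2[of s] Gamma_nonneg[OF True]]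
    by linarith
  then show ?thesis using n_pos by (simp add: zero_le_mult_iff)
next
  case False
  show ?thesis
  proof (rule Henstock_Kurzweil_Integration.integral_nonneg)
    show "(\<lambda>t. t * b t * sin2 n t) integrable_on {0..s}"
      by (intro integrable_continuous_real continuous_on_subset[OF moment_integrand]) auto
    fix t assume t: "t \<in> {0..s}"
    show "0 \<le> t * b t * sin2 n t"
    proof (cases "t = 0")
      case False
      then have "0 < b t" using t \<open>\<not> \<sigma> \<le> s\<close> by (intro b_pos) auto
      then show ?thesis using t sin2_nonneg[of n t] by simp
    qed simp
  qed
qed

text \<open>If no moment were negative, \<open>energy_integral\<close> would give t^2 \<Gamma> \<ge>
  2 J \<ge> 2 c with c > 0, so J would grow at least like 2 c ln t. But \<Gamma> \<le> \<beta> (1 +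
  cos h) and n \<ge> 1 give t^2 \<Gamma> \<le> 2 \<beta>, hence J \<le> \<beta>.\<close>

lemma moment_negative:
  assumes pos: "0 < integral {0..s} (\<lambda>r. \<Gamma> r * r)" and s: "\<sigma> \<le> s"
  shows "\<exists>s>0. moment s < 0"
proof (rule ccontr)
  assume "\<not> ?thesis"
  then have M: "0 \<le> moment s" if "0 < s" for s using that by force
  define J where "J = (\<lambda>s. integral {0..s} (\<lambda>r. \<Gamma> r * r))"
  define c where "c = J s"
  have c: "0 < c" using pos by (simp add: c_def J_def)
  define s0 where "s0 = max s 1"
  have s0: "1 \<le> s0" "s \<le> s0" by (auto simp: s0_def)
  have J_mono: "J s \<le> J t" if "s \<le> t" for t
  proof (rule nondecreasing_on_Icc[OF that])
    show "continuous_on {s..t} J"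
      unfolding J_def by (rule continuous_on_subset[OF continuous_on_primitive[OF energy_integrand]]) (use s \<sigma> in auto)
    fix z assume z: "s < z" "z < t"
    show "(J has_real_derivative \<Gamma> z * z) (at z)"
      unfolding J_def by (rule DERIV_primitive[OF energy_integrand]) (use z s \<sigma> in auto)
    show "0 \<le> \<Gamma> z * z" using Gamma_nonneg[of z] z s \<sigma> by simp
  qed
  have two: "2 * J t \<le> t\<^sup>2 * \<Gamma> t" if "0 < t" for t
    using energy_integral[of t] M[OF that] that by (simp add: J_def)
  have J_le: "J t \<le> \<beta>" if t: "1 \<le> t" for t
  proof -
    have "t\<^sup>2 * \<Gamma> t \<le> t\<^sup>2 * (\<beta> * (1 + cosn n t))"
      using t by (intro mult_left_mono Gamma_le) auto
    also have "\<dots> = 2 * \<beta> * (t\<^sup>2 / (1 + t ^ (2*n)))"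
      using one_plus_power_neq[of t n] by (simp add: cosn_def field_simps)
    also have "\<dots> \<le> 2 * \<beta> * 1"
    proof (intro mult_left_mono)
      have "t\<^sup>2 \<le> t ^ (2*n)" using t n by (intro power_increasing) auto
      then show "t\<^sup>2 / (1 + t ^ (2*n)) \<le> 1" using one_plus_power_pos[of t n] by (simp add: pos_divide_le_eq)
    qed (use beta_nonneg in auto)
    finally show ?thesis using two[of t] t by simp
  qed
  \<comment> \<open>The exponent raises 2 c ln t by \<beta> + 2 c, enough to push J above
    \<beta>.\<close>
  define t where "t = s0 * exp (\<beta> / (2 * c) + 1)"
  have t: "s0 \<le> t"
  proof -
    have "s0 * 1 \<le> s0 * exp (\<beta> / (2 * c) + 1)" using s0 c beta_nonneg by (intro mult_left_mono) auto
    then show ?thesis by (simp add: t_def)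
  qed
  have "J s0 - 2 * c * ln s0 \<le> J t - 2 * c * ln t"
  proof (rule nondecreasing_on_Icc[OF t, where f = "\<lambda>t. J t - 2 * c * ln t" and f' = "\<lambda>z. \<Gamma> z * z - 2 * c * (1 / z)"])
    have "continuous_on {s0..t} J"
      unfolding J_def by (rule continuous_on_subset[OF continuous_on_primitive[OF energy_integrand]]) (use s0 in auto)
    then show "continuous_on {s0..t} (\<lambda>t. J t - 2 * c * ln t)" using s0 by (intro continuous_intros) auto
    fix z assume z: "s0 < z" "z < t"
    then have z0: "0 < z" using s0 by simp
    show "((\<lambda>t. J t - 2 * c * ln t) has_real_derivative \<Gamma> z * z - 2 * c * (1 / z)) (at z)"
      unfolding J_def by (intro DERIV_diff DERIV_cmult DERIV_primitive[OF energy_integrand] DERIV_ln_divide z0)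
    have "2 * c \<le> z\<^sup>2 * \<Gamma> z" using two[OF z0] J_mono[of z] z s0 by (simp add: c_def)
    then show "0 \<le> \<Gamma> z * z - 2 * c * (1 / z)" using z0 by (simp add: field_simps power2_eq_square)
  qed
  moreover have "ln t = ln s0 + (\<beta> / (2 * c) + 1)" using s0 by (simp add: t_def ln_mult)
  moreover have "2 * c * (\<beta> / (2 * c) + 1) = \<beta> + 2 * c" using c by (simp add: field_simps)
  ultimately have "J s0 + \<beta> + 2 * c \<le> J t" by (simp add: distrib_left)
  moreover have "c \<le> J s0" using J_mono[OF s0(2)] by (simp add: c_def)
  ultimately show False using J_le[of t] t s0 c by simp
qed

end

section \<open>Positivity of the improper integral\<close>

text \<open>The negative part of F is confined to [0, \<sigma>] and has a finite integral, so
  \<infinity> - \<infinity> does not occur. The integral of the positive part is the supremum over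
  truncations by monotone convergence, so positivity is already seen on a bounded interval.\<close>

lemma set_integral_ereal_pos_iff:
  fixes F :: "real \<Rightarrow> real"
  assumes F: "continuous_on {0..} F" and \<sigma>: "0 \<le> \<sigma>" and pos: "\<And>r. \<sigma> \<le> r \<Longrightarrow> 0 \<le> F r"
  shows "0 < set_integral_ereal lborel {0..} F \<longleftrightarrow> (\<exists>\<rho>\<ge>\<sigma>. 0 < integral {0..\<rho>} F)"
proof -
  \<comment> \<open>The even extension makes the positive and negative parts continuous on the whole
    line, hence Borel measurable.\<close>
  define P where "P = (\<lambda>x. max 0 (F \<bar>x\<bar>))"
  define N where "N = (\<lambda>x. max 0 (- F \<bar>x\<bar>))"
  have "continuous_on UNIV (\<lambda>x. F \<bar>x\<bar>)"
    by (rule continuous_on_compose2[OF F]) (auto intro!: continuous_intros)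
  then have c: "continuous_on UNIV P" "continuous_on UNIV N"
    unfolding P_def N_def by (auto intro!: continuous_intros)
  then have meas: "P \<in> borel_measurable borel" "N \<in> borel_measurable borel"
    by (simp_all add: borel_measurable_continuous_onI)
  have int: "P integrable_on {0..\<rho>}" "N integrable_on {0..\<rho>}" for \<rho>
    using c by (auto intro!: integrable_continuous_real continuous_on_subset[of UNIV])
  have nn: "(\<integral>\<^sup>+x\<in>{0..\<rho>}. ennreal (k x) \<partial>lborel) = ennreal (integral {0..\<rho>} k)"
    if "k = P \<or> k = N" for \<rho> k
  proof -
    have k: "k \<in> borel_measurable borel" "\<And>x. 0 \<le> k x" "k integrable_on {0..\<rho>}"
      using that meas int by (auto simp: P_def N_def)
    have "(\<integral>\<^sup>+x. ennreal (if x \<in> {0..\<rho>} then k x else 0) \<partial>lborel) = ennreal (integral {0..\<rho>} k)"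
    proof (rule nn_integral_has_integral_lborel)
      show "((\<lambda>x. if x \<in> {0..\<rho>} then k x else 0) has_integral integral {0..\<rho>} k) UNIV"
        unfolding has_integral_restrict_UNIV by (rule integrable_integral[OF k(3)])
      show "(\<lambda>x. if x \<in> {0..\<rho>} then k x else 0) \<in> borel_measurable borel"
        using k(1) by measurable
    qed (use k in auto)
    moreover have "(\<lambda>x. ennreal (if x \<in> {0..\<rho>} then k x else 0)) = (\<lambda>x. ennreal (k x) * indicator {0..\<rho>} x)"
      by (auto simp: fun_eq_iff indicator_def)
    ultimately show ?thesis by simp
  qed
  have diff: "integral {0..\<rho>} F = integral {0..\<rho>} P - integral {0..\<rho>} N" for \<rho>
    unfolding Henstock_Kurzweil_Integration.integral_diff[OF int, symmetric]
    by (rule integral_cong) (auto simp: P_def N_def max_def)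
  define p where "p = (\<integral>\<^sup>+x\<in>{0..}. ennreal (F x) \<partial>lborel)"
  have p: "p = (\<integral>\<^sup>+x\<in>{0..}. ennreal (P x) \<partial>lborel)"
    unfolding p_def by (intro nn_integral_cong) (auto simp: P_def indicator_def ennreal_max_0)
  have N0: "N r = 0" if "\<sigma> \<le> r" for r using pos[OF that] \<sigma> that by (simp add: N_def)
  have q: "(\<integral>\<^sup>+x\<in>{0..}. ennreal (- F x) \<partial>lborel) = ennreal (integral {0..\<rho>} N)" if "\<sigma> \<le> \<rho>" for \<rho>
  proof -
    have "(\<integral>\<^sup>+x\<in>{0..}. ennreal (- F x) \<partial>lborel) = (\<integral>\<^sup>+x\<in>{0..\<rho>}. ennreal (N x) \<partial>lborel)"
    proof (intro nn_integral_cong)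
      fix x :: real
      have "ennreal (N x) = ennreal (- F x)" if "0 \<le> x" using that by (simp add: N_def ennreal_max_0)
      moreover have "ennreal (N x) = 0" if "\<rho> < x" using N0[of x] \<open>\<sigma> \<le> \<rho>\<close> that by simp
      ultimately show "ennreal (- F x) * indicator {0..} x = ennreal (N x) * indicator {0..\<rho>} x"
        by (cases "0 \<le> x"; cases "\<rho> < x") (auto simp: indicator_def)
    qed
    also have "\<dots> = ennreal (integral {0..\<rho>} N)" by (rule nn) simp
    finally show ?thesis .
  qed
  have iff: "0 < set_integral_ereal lborel {0..} F \<longleftrightarrow> ennreal (integral {0..\<sigma>} N) < p"
  proof -
    have "0 \<le> integral {0..\<sigma>} N" by (intro Henstock_Kurzweil_Integration.integral_nonneg int) (auto simp: N_def)
    then have e: "enn2ereal (ennreal (integral {0..\<sigma>} N)) = ereal (integral {0..\<sigma>} N)" by simp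
    have "0 < set_integral_ereal lborel {0..} F \<longleftrightarrow> ereal (integral {0..\<sigma>} N) < enn2ereal p"
      unfolding set_integral_ereal_def q[OF order_refl] p_def[symmetric] e
      by (cases "enn2ereal p") auto
    then show ?thesis by (simp add: less_ennreal.rep_eq e)
  qed
  have nonneg: "0 \<le> integral {0..\<rho>} N" "0 \<le> integral {0..\<rho>} P" for \<rho>
    by (intro Henstock_Kurzweil_Integration.integral_nonneg int; simp add: N_def P_def)+
  have N_eq: "integral {0..\<rho>} N = integral {0..\<sigma>} N" if "\<sigma> \<le> \<rho>" for \<rho>
    using q[OF that] q[OF order_refl] nonneg by simp
  show ?thesis
  proof
    assume "0 < set_integral_ereal lborel {0..} F"
    then have less: "ennreal (integral {0..\<sigma>} N) < p" by (simp add: iff)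
    have "p = (\<integral>\<^sup>+x. (SUP k. ennreal (P x) * indicator {0..real k} x) \<partial>lborel)"
      unfolding p
    proof (intro nn_integral_cong antisym)
      fix x :: real
      show "ennreal (P x) * indicator {0..} x \<le> (SUP k. ennreal (P x) * indicator {0..real k} x)"
      proof (rule SUP_upper2[of "nat \<lceil>x\<rceil>"])
        show "ennreal (P x) * indicator {0..} x \<le> ennreal (P x) * indicator {0..real (nat \<lceil>x\<rceil>)} x"
          by (auto simp: indicator_def real_nat_ceiling_ge)
      qed simp
      show "(SUP k. ennreal (P x) * indicator {0..real k} x) \<le> ennreal (P x) * indicator {0..} x"
        by (rule SUP_least) (auto simp: indicator_def)
    qed
    also have "\<dots> = (SUP k. (\<integral>\<^sup>+x\<in>{0..real k}. ennreal (P x) \<partial>lborel))"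
    proof (rule nn_integral_monotone_convergence_SUP)
      show "incseq (\<lambda>k x. ennreal (P x) * indicator {0..real k} x)"
        by (auto simp: incseq_def le_fun_def indicator_def)
      show "(\<lambda>x. ennreal (P x) * indicator {0..real k} x) \<in> borel_measurable lborel" for k
        using meas by measurable
    qed
    also have "\<dots> = (SUP k. ennreal (integral {0..real k} P))" using nn by simp
    finally obtain k where k: "ennreal (integral {0..\<sigma>} N) < ennreal (integral {0..real k} P)"
      using less by (auto simp: less_SUP_iff)
    define \<rho> where "\<rho> = max \<sigma> (real k)"
    have "integral {0..real k} P \<le> integral {0..\<rho>} P"
      by (rule integral_subset_le[OF _ int(1) int(1)]) (auto simp: \<rho>_def P_def)
    then have "integral {0..\<rho>} N < integral {0..\<rho>} P"
      using k N_eq[of \<rho>] nonneg by (simp add: \<rho>_def ennreal_less_iff)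
    then show "\<exists>\<rho>\<ge>\<sigma>. 0 < integral {0..\<rho>} F" unfolding diff by (intro exI[of _ \<rho>]) (simp add: \<rho>_def)
  next
    assume "\<exists>\<rho>\<ge>\<sigma>. 0 < integral {0..\<rho>} F"
    then obtain \<rho> where \<rho>: "\<sigma> \<le> \<rho>" "integral {0..\<rho>} N < integral {0..\<rho>} P" by (auto simp: diff)
    have "ennreal (integral {0..\<sigma>} N) < ennreal (integral {0..\<rho>} P)"
      using \<rho> N_eq[OF \<rho>(1)] nonneg by (simp add: ennreal_less_iff)
    also have "\<dots> = (\<integral>\<^sup>+x\<in>{0..\<rho>}. ennreal (P x) \<partial>lborel)" using nn by simp
    also have "\<dots> \<le> p" unfolding p by (intro nn_integral_mono) (auto simp: indicator_def)
    finally show "0 < set_integral_ereal lborel {0..} F" by (simp add: iff)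
  qed
qed

section \<open>The quotient g / sin along the harmonic map\<close>

lemma filterlim_angle:
  assumes n: "1 \<le> n"
  shows "filterlim (angle n) (at 0 within {0..pi}) (at_right 0)"
    and "filterlim (angle n) (at pi within {0..pi}) at_top"
proof -
  have "\<forall>\<^sub>F s in at_right 0. angle n s \<in> {0..pi} \<and> angle n s \<noteq> 0"
    using at_right_pos
  proof eventually_elim
    case (elim s)
    then show ?case using angle_bounds(1)[OF elim, of n] angle_bounds(2)[of n s] by simp
  qed
  moreover have "(angle n \<longlongrightarrow> 0) (at_right 0)"
    using tendsto_at_right_0[OF continuous_angle[OF continuous_on_id], of n] n by simp
  ultimately show "filterlim (angle n) (at 0 within {0..pi}) (at_right 0)" by (simp add: filterlim_at)
  have "\<forall>\<^sub>F s in at_top. angle n s \<in> {0..pi} \<and> angle n s \<noteq> pi"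
    using eventually_gt_at_top[of 0]
  proof eventually_elim
    case (elim s)
    then show ?case using angle_bounds(1)[OF elim, of n] angle_bounds(2)[of n s] by simp
  qed
  then show "filterlim (angle n) (at pi within {0..pi}) at_top"
    using angle_at_top[OF n] by (simp add: filterlim_at)
qed

definition slope :: "nat \<Rightarrow> (real \<Rightarrow> real) \<Rightarrow> real \<Rightarrow> real \<Rightarrow> real" where
  "slope n g d s = (if s = 0 then d else g (angle n s) / sin (angle n s))"

text \<open>g and sin vanish at both 0 and \<pi>, so there the quotient is one of difference
  quotients, with limits g'(0) and - g'(\<pi>). The first gives continuity at s = 0, the second
  boundedness at infinity.\<close>

lemma slope_properties:
  assumes n: "1 \<le> n" and g: "g 0 = 0" "g pi = 0"
    and d: "\<And>x. x \<in> {0..pi} \<Longrightarrow> (g has_real_derivative g' x) (at x within {0..pi})"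
  shows "continuous_on {0..} (slope n g (g' 0))"
    and "\<exists>\<beta>. \<forall>s\<ge>0. \<bar>slope n g (g' 0) s\<bar> \<le> \<beta>"
    and "\<And>s. 0 < s \<Longrightarrow> slope n g (g' 0) s * sin (angle n s) = g (angle n s)"
proof -
  have sin_pos: "0 < sin (angle n s)" if "0 < s" for s
    using angle_bounds(1)[OF that, of n] angle_bounds(2)[of n s] by (rule sin_gt_zero)
  have ev0: "\<forall>\<^sub>F s in at_right 0. slope n g (g' 0) s = ((g (angle n s) - g 0) / (angle n s - 0)) / ((sin (angle n s) - sin 0) / (angle n s - 0))"
    using at_right_pos
  proof eventually_elim
    case (elim s)
    then show ?case using angle_bounds(1)[OF elim, of n] by (simp add: slope_def g)
  qed
  have dq: "((\<lambda>a. ((g a - g c) / (a - c)) / ((sin a - sin c) / (a - c))) \<longlongrightarrow> g' c / cos c) (at c within {0..pi})"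
    if "c \<in> {0..pi}" "cos c \<noteq> 0" for c
    using d[OF that(1)] has_field_derivative_at_within[OF DERIV_sin[of c], of "{0..pi}"] that(2)
    unfolding has_field_derivative_iff by (intro tendsto_divide) auto
  have "(slope n g (g' 0) \<longlongrightarrow> g' 0 / cos 0) (at_right 0)"
    using filterlim_compose[OF dq filterlim_angle(1)[OF n]]
    by (rule Lim_transform_eventually) (use ev0 in \<open>auto elim: eventually_mono\<close>)
  then have lim0: "(slope n g (g' 0) \<longlongrightarrow> slope n g (g' 0) 0) (at_right 0)" by (simp add: slope_def)
  have cg: "continuous_on {0..pi} g"
    by (rule DERIV_continuous_on[OF d])
  have "continuous_on {0<..} (\<lambda>s. g (angle n s) / sin (angle n s))"
  proof (intro continuous_intros)
    show "continuous_on {0<..} (\<lambda>s. g (angle n s))"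
      using angle_bounds by (intro continuous_on_compose2[OF cg] continuous_intros) (force simp: less_imp_le)
    show "\<forall>s\<in>{0<..}. sin (angle n s) \<noteq> 0"
    proof
      fix s :: real assume "s \<in> {0<..}"
      then show "sin (angle n s) \<noteq> 0" using sin_pos[of s] by simp
    qed
  qed
  then have "continuous_on {0<..} (slope n g (g' 0))"
    by (rule continuous_on_eq) (auto simp: slope_def)
  then show c: "continuous_on {0..} (slope n g (g' 0))" by (rule continuous_on_Ici[OF _ lim0])
  have ev1: "\<forall>\<^sub>F s in at_top. slope n g (g' 0) s = ((g (angle n s) - g pi) / (angle n s - pi)) / ((sin (angle n s) - sin pi) / (angle n s - pi))"
    using eventually_gt_at_top[of 0]
  proof eventually_elim
    case (elim s)
    then show ?case using angle_bounds(2)[of n s] by (simp add: slope_def g)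
  qed
  have "(slope n g (g' 0) \<longlongrightarrow> g' pi / cos pi) at_top"
    using filterlim_compose[OF dq filterlim_angle(2)[OF n]]
    by (rule Lim_transform_eventually) (use ev1 in \<open>auto elim: eventually_mono\<close>)
  then have "((\<lambda>s. \<bar>slope n g (g' 0) s\<bar>) \<longlongrightarrow> \<bar>g' pi / cos pi\<bar>) at_top" by (rule tendsto_rabs)
  then have "\<forall>\<^sub>F s in at_top. \<bar>slope n g (g' 0) s\<bar> < \<bar>g' pi / cos pi\<bar> + 1"
    by (rule order_tendstoD(2)) simp
  then obtain S where S: "\<And>s. S \<le> s \<Longrightarrow> \<bar>slope n g (g' 0) s\<bar> < \<bar>g' pi / cos pi\<bar> + 1"
    by (auto simp: eventually_at_top_linorder)
  have "bounded (slope n g (g' 0) ` {0..S})"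
    by (intro compact_imp_bounded compact_continuous_image continuous_on_subset[OF c]) auto
  then obtain B where B: "\<forall>s\<in>{0..S}. \<bar>slope n g (g' 0) s\<bar> \<le> B"
    unfolding bounded_iff by auto
  show "\<exists>\<beta>. \<forall>s\<ge>0. \<bar>slope n g (g' 0) s\<bar> \<le> \<beta>"
  proof (intro exI allI impI)
    fix s :: real assume "0 \<le> s"
    then show "\<bar>slope n g (g' 0) s\<bar> \<le> max B (\<bar>g' pi / cos pi\<bar> + 1)"
      using S[of s] B[rule_format, of s] by (cases "S \<le> s") (auto simp: le_max_iff_disj)
  qed
  show "slope n g (g' 0) s * sin (angle n s) = g (angle n s)" if "0 < s" for s
    using sin_pos[OF that] that by (simp add: slope_def)
qed

lemma shooting_slope:
  assumes n: "1 \<le> n" and g: "g 0 = 0" "g \<xi> = 0" "g pi = 0" and \<xi>: "0 < \<xi>" "\<xi> < pi"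
    and pos: "\<And>x. 0 < x \<Longrightarrow> x < \<xi> \<Longrightarrow> 0 < g x" and neg: "\<And>x. \<xi> < x \<Longrightarrow> x < pi \<Longrightarrow> g x < 0"
    and int: "0 < integral {0..pi} g"
    and d: "\<And>x. x \<in> {0..pi} \<Longrightarrow> (g has_real_derivative g' x) (at x within {0..pi})"
    and G: "\<And>x. x \<in> {0..pi} \<Longrightarrow> G x = - integral {x..pi} g"
  obtains \<beta> where "shooting n (slope n g (g' 0)) \<beta> (\<lambda>s. G (angle n s)) (root n (tan (\<xi> / 2)))"
proof -
  have sl: "continuous_on {0..} (slope n g (g' 0))" "\<exists>\<beta>. \<forall>s\<ge>0. \<bar>slope n g (g' 0) s\<bar> \<le> \<beta>"
    by (rule slope_properties[OF n g(1,3)], rule d, assumption)+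
  have sl3: "slope n g (g' 0) s * sin (angle n s) = g (angle n s)" if "0 < s" for s
    by (rule slope_properties(3)[OF n g(1,3) _ that]) (rule d)
  obtain \<beta> where \<beta>: "\<And>s. 0 \<le> s \<Longrightarrow> \<bar>slope n g (g' 0) s\<bar> \<le> \<beta>" using sl(2) by blast
  have n0: "0 < n" using n by simp
  define \<sigma> where "\<sigma> = root n (tan (\<xi> / 2))"
  have tan: "0 < tan (\<xi> / 2)" using \<xi> by (intro tan_gt_zero) auto
  have \<sigma>: "0 < \<sigma>" using tan n0 by (simp add: \<sigma>_def)
  have a\<sigma>: "angle n \<sigma> = \<xi>"
  proof -
    have "arctan (tan (\<xi> / 2)) = \<xi> / 2" using \<xi> by (intro arctan_tan) auto
    then show ?thesis using tan n0 by (simp add: angle_def \<sigma>_def)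
  qed
  have mono: "angle n s < angle n t" if "0 \<le> s" "s < t" for s t
    using that n0 by (simp add: angle_def arctan_less_iff power_strict_mono)
  have sin_pos: "0 < sin (angle n s)" if "0 < s" for s
    using angle_bounds(1)[OF that, of n] angle_bounds(2)[of n s] by (rule sin_gt_zero)
  have cg: "continuous_on {0..pi} g"
    by (rule DERIV_continuous_on[OF d])
  have "continuous_on {0..pi} (\<lambda>x. - integral {x..pi} g)"
    by (intro continuous_intros indefinite_integral_continuous_1' integrable_continuous_real cg)
  then have cG: "continuous_on {0..pi} G" by (rule continuous_on_eq) (simp add: G)
  have angle_mem: "angle n s \<in> {0..pi}" if "0 \<le> s" for s
    using that angle_bounds(2)[of n s] by (simp add: angle_def less_imp_le)
  have dG: "(G has_real_derivative g x) (at x)" if x: "0 < x" "x < pi" for x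
  proof -
    have "((\<lambda>x. - integral {x..pi} g) has_real_derivative - (- g x)) (at x within {0..pi})"
      by (intro DERIV_minus integral_has_real_derivative' cg) (use x in auto)
    then have "((\<lambda>x. - integral {x..pi} g) has_real_derivative g x) (at x)"
      using at_within_Icc_at[OF x] by simp
    then show ?thesis by (rule DERIV_local_eq[of _ _ _ "{0<..<pi}"]) (use x G in auto)
  qed
  have "shooting n (slope n g (g' 0)) \<beta> (\<lambda>s. G (angle n s)) \<sigma>"
  proof
    show "1 \<le> n" "continuous_on {0..} (slope n g (g' 0))" "0 < \<sigma>" using n sl(1) \<sigma> by simp_all
    show "\<bar>slope n g (g' 0) s\<bar> \<le> \<beta>" if "0 \<le> s" for s using \<beta> that .
    show "0 < slope n g (g' 0) s" if "0 < s" "s < \<sigma>" for s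
      using pos[of "angle n s"] angle_bounds(1)[OF that(1), of n] mono[of s \<sigma>] sin_pos[OF that(1)] that
      by (simp add: slope_def a\<sigma>)
    show "slope n g (g' 0) s < 0" if "\<sigma> < s" for s
      using neg[of "angle n s"] angle_bounds(2)[of n s] mono[of \<sigma> s] sin_pos[of s] \<sigma> that
      by (simp add: slope_def a\<sigma> divide_neg_pos)
    show "continuous_on {0..} (\<lambda>s. G (angle n s))"
      by (rule continuous_on_compose2[OF cG continuous_angle[OF continuous_on_id]])
        (rule image_subsetI, rule angle_mem, simp)
    show "((\<lambda>s. G (angle n s)) has_real_derivative n * slope n g (g' 0) s * sin2 n s / s) (at s)" if s: "0 < s" for s
    proof -
      have "((\<lambda>s. G (angle n s)) has_real_derivative g (angle n s) * (n * sqrt (sin2 n s) / s)) (at s)"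
        using angle_bounds(1)[OF s, of n] angle_bounds(2)[of n s] by (intro DERIV_chain2[OF dG DERIV_angle] s n)
      moreover have "g (angle n s) * (n * sqrt (sin2 n s) / s) = n * slope n g (g' 0) s * sin2 n s / s"
        unfolding sl3[OF s, symmetric] using sin_pos[OF s] by (simp add: sin2_eq power2_eq_square)
      ultimately show ?thesis by metis
    qed
    have "(G \<longlongrightarrow> G pi) (at pi within {0..pi})" using cG by (simp add: continuous_on)
    from filterlim_compose[OF this filterlim_angle(2)[OF n]]
    show "((\<lambda>s. G (angle n s)) \<longlongrightarrow> 0) at_top" by (simp add: G)
    show "G (angle n 0) < 0" using int n0 by (simp add: G)
  qed
  then show thesis using that by (simp add: \<sigma>_def)
qed

theorem theorem6p2:
  fixes m :: int and \<omega> \<xi> :: real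
    and g Gt G \<phi>\<^sub>1 :: "real \<Rightarrow> real" and H :: "real^3 \<Rightarrow> real"
  assumes "m \<noteq> 0"
    and "smooth_on_Icc 0 pi g"
    and "0 < \<xi>" "\<xi> < pi" "g 0 = 0" "g \<xi> = 0" "g pi = 0"
    and "\<forall>x\<in>{0<..<\<xi>}. 0 < g x" "\<forall>x\<in>{\<xi><..<pi}. g x < 0"
    and "0 < integral {0..pi} g"
    and "\<exists>d>0. (g has_real_derivative d) (at pi within {0..pi})"
    and "\<forall>x\<in>{0..pi}. (Gt has_real_derivative g x - \<omega> * sin x) (at x within {0..pi})"
    and "\<forall>u\<in>sphere 0 1. H u = Gt (sphere_dist u north_pole)"
    and "\<forall>x\<in>{0..pi}. G x = - integral {x..pi} g"
    and "\<forall>r\<ge>0. \<phi>\<^sub>1 r = 2 * arctan (r ^ nat \<bar>m\<bar>)"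
  shows "(\<exists>u h. is_solution H u \<and> has_equivariant_form m \<omega> h u \<and>
            h 0 = 0 \<and> (h \<longlongrightarrow> pi) at_top \<and> (\<forall>r>0. 0 < h r \<and> h r < pi))
         \<longleftrightarrow> 0 < set_integral_ereal lborel {0..} (\<lambda>r. G (\<phi>\<^sub>1 r) * r) \<and>
             set_integral_ereal lborel {0..} (\<lambda>r. G (\<phi>\<^sub>1 r) * r) \<le> \<infinity>"
proof -
  define n where "n = nat \<bar>m\<bar>"
  have n: "1 \<le> n" and m2: "(of_int m)\<^sup>2 = (real n)\<^sup>2" using assms(1) by (auto simp: n_def)
  obtain D where D: "\<forall>x\<in>{0..pi}. D 0 x = g x" "\<And>k x. x \<in> {0..pi} \<Longrightarrow> (D k has_real_derivative D (Suc k) x) (at x within {0..pi})"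
    using assms(2) unfolding smooth_on_Icc_def by blast
  have d: "(g has_real_derivative D 1 x) (at x within {0..pi})" if x: "x \<in> {0..pi}" for x
  proof -
    have "(D 0 has_derivative (*) (D 1 x)) (at x within {0..pi})"
      using D(2)[OF x, of 0] by (simp add: has_field_derivative_def)
    then have "(g has_derivative (*) (D 1 x)) (at x within {0..pi})"
      by (rule has_derivative_transform[OF x, rotated]) (use D(1) in simp)
    then show ?thesis by (simp add: has_field_derivative_def)
  qed
  have pos: "\<And>x. 0 < x \<Longrightarrow> x < \<xi> \<Longrightarrow> 0 < g x" and neg: "\<And>x. \<xi> < x \<Longrightarrow> x < pi \<Longrightarrow> g x < 0"
    and G: "\<And>x. x \<in> {0..pi} \<Longrightarrow> G x = - integral {x..pi} g"
    and H: "\<And>u. u \<in> sphere 0 1 \<Longrightarrow> H u = Gt (sphere_dist u north_pole)"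
    and Gt: "\<And>x. x \<in> {0..pi} \<Longrightarrow> (Gt has_real_derivative g x - \<omega> * sin x) (at x within {0..pi})"
    using assms by auto
  define b where "b = slope n g (D 1 0)"
  define \<sigma> where "\<sigma> = root n (tan (\<xi> / 2))"
  have b_g: "b s * sin (angle n s) = g (angle n s)" if "0 < s" for s
    unfolding b_def by (rule slope_properties(3)[OF n assms(5,7) _ that]) (rule d)
  obtain \<beta> where "shooting n b \<beta> (\<lambda>s. G (angle n s)) \<sigma>"
    unfolding b_def \<sigma>_def
    using shooting_slope[where G = G and g' = "D 1", OF n assms(5-7,3,4) pos neg assms(10) d G] by blast
  then interpret shooting n b \<beta> "\<lambda>s. G (angle n s)" \<sigma> .
  \<comment> \<open>Since G is nonnegative beyond \<xi>, positivity of the extended integral is that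
    of some truncated integral reaching at least to \<sigma>; both directions work with this finite
    form.\<close>
  have cond: "0 < set_integral_ereal lborel {0..} (\<lambda>r. G (\<phi>\<^sub>1 r) * r) \<longleftrightarrow>
      (\<exists>\<rho>\<ge>\<sigma>. 0 < integral {0..\<rho>} (\<lambda>r. G (angle n r) * r))"
  proof -
    have eq: "G (\<phi>\<^sub>1 r) * r = G (angle n r) * r" if "0 \<le> r" for r
      using assms(15) that by (simp add: angle_def n_def)
    have "set_integral_ereal lborel {0..} (\<lambda>r. G (\<phi>\<^sub>1 r) * r) = set_integral_ereal lborel {0..} (\<lambda>r. G (angle n r) * r)"
      unfolding set_integral_ereal_def
      by (intro arg_cong2[where f = minus] arg_cong[where f = enn2ereal] nn_integral_cong) (auto simp: indicator_def eq)
    moreover have "0 \<le> G (angle n r) * r" if "\<sigma> \<le> r" for r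
      using Gamma_nonneg[OF that] \<sigma> that by simp
    ultimately show ?thesis using set_integral_ereal_pos_iff[OF energy_integrand, of \<sigma>] \<sigma> by simp
  qed
  show ?thesis
  proof (intro iffI conjI)
    assume "\<exists>u h. is_solution H u \<and> has_equivariant_form m \<omega> h u \<and>
            h 0 = 0 \<and> (h \<longlongrightarrow> pi) at_top \<and> (\<forall>r>0. 0 < h r \<and> h r < pi)"
    then obtain u h where u: "is_solution H u" "has_equivariant_form m \<omega> h u" and h: "h 0 = 0" "\<And>r. 0 < r \<Longrightarrow> 0 < h r \<and> h r < pi"
      by blast
    obtain h1 h2 where dh: "\<And>r. 0 < r \<Longrightarrow> (h has_real_derivative h1 r) (at r)" "\<And>r. 0 < r \<Longrightarrow> (h1 has_real_derivative h2 r) (at r)"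
      and ode: "\<And>r. 0 < r \<Longrightarrow> h2 r + h1 r / r - (of_int m)\<^sup>2 * sin (h r) * cos (h r) / r\<^sup>2 = g (h r)"
      and h_lim: "(h \<longlongrightarrow> 0) (at_right 0)"
      using equivariant_solution_ode[where g = g and H = H and Gt = Gt, OF u h(2,1) H Gt] by blast
    show "0 < set_integral_ereal lborel {0..} (\<lambda>r. G (\<phi>\<^sub>1 r) * r)"
    proof (rule ccontr)
      assume "\<not> ?thesis"
      then have le: "integral {0..\<rho>} (\<lambda>r. G (angle n r) * r) \<le> 0" if "\<sigma> \<le> \<rho>" for \<rho>
        using cond that by force
      \<comment> \<open>In logarithmic time t = ln r the operator r d/dr becomes d/dt, and r enters
        the equation only through the factor (exp t)^2 of g.\<close>
      interpret connecting_orbit n g b \<xi> "\<lambda>t. h (exp t)" "\<lambda>t. exp t * h1 (exp t)"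
      proof
        show "1 \<le> n" "0 < \<xi>" "\<xi> < pi" "g \<xi> = 0" "continuous_on {0..} b" using n assms(3,4,6) b_cont by simp_all
        show "0 < g a" if "0 < a" "a < \<xi>" for a using pos that .
        show "g a < 0" if "\<xi> < a" "a < pi" for a using neg that .
        show "b s * sin (angle n s) = g (angle n s)" if "0 < s" for s using b_g[OF that] .
        fix t :: real
        show "0 < h (exp t)" "h (exp t) < pi" using h(2)[of "exp t"] by auto
        have "((\<lambda>t. h (exp t)) has_real_derivative h1 (exp t) * exp t) (at t)"
          by (rule DERIV_chain2[OF dh(1) DERIV_exp]) simp
        then show "((\<lambda>t. h (exp t)) has_real_derivative exp t * h1 (exp t)) (at t)" by (simp add: mult.commute)
        have "((\<lambda>t. exp t * h1 (exp t)) has_real_derivative exp t * h1 (exp t) + h2 (exp t) * exp t * exp t) (at t)"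
          by (rule DERIV_mult[OF DERIV_exp DERIV_chain2[OF dh(2) DERIV_exp]]) simp
        moreover have "exp t * h1 (exp t) + h2 (exp t) * exp t * exp t
            = n\<^sup>2 * sin (h (exp t)) * cos (h (exp t)) + (exp t)\<^sup>2 * g (h (exp t))"
        proof -
          have "(exp t)\<^sup>2 * g (h (exp t)) = (exp t)\<^sup>2 * (h2 (exp t) + h1 (exp t) / exp t - (real n)\<^sup>2 * sin (h (exp t)) * cos (h (exp t)) / (exp t)\<^sup>2)"
            using ode[of "exp t"] m2 by simp
          also have "\<dots> = exp t * h1 (exp t) + h2 (exp t) * exp t * exp t - (real n)\<^sup>2 * sin (h (exp t)) * cos (h (exp t))"
          proof -
            have "e\<^sup>2 * (y + x / e - z / e\<^sup>2) = e * x + y * e * e - z" if "e \<noteq> 0" for e x y z :: real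
              using that by (simp add: field_simps power2_eq_square)
            from this[of "exp t"] show ?thesis by simp
          qed
          finally show ?thesis by simp
        qed
        ultimately show "((\<lambda>t. exp t * h1 (exp t)) has_real_derivative
            n\<^sup>2 * sin (h (exp t)) * cos (h (exp t)) + (exp t)\<^sup>2 * g (h (exp t))) (at t)" by simp
      next
        have "filterlim exp (at_right (0::real)) at_bot"
          unfolding filterlim_at using exp_at_bot by (simp add: always_eventually)
        then show "((\<lambda>t. h (exp t)) \<longlongrightarrow> 0) at_bot" by (rule filterlim_compose[OF h_lim])
        show "0 \<le> integral {0..s} (\<lambda>t. t * b t * sin2 n t)" if "0 < s" for s
          using le that by (rule moment_nonneg)
      qed
      show False by (rule no_connecting_orbit)
    qed
  next
    assume "0 < set_integral_ereal lborel {0..} (\<lambda>r. G (\<phi>\<^sub>1 r) * r) \<and>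
             set_integral_ereal lborel {0..} (\<lambda>r. G (\<phi>\<^sub>1 r) * r) \<le> \<infinity>"
    then obtain \<rho> where "\<sigma> \<le> \<rho>" "0 < integral {0..\<rho>} (\<lambda>r. G (angle n r) * r)" using cond by blast
    then obtain s where s: "0 < s" "moment s < 0" using moment_negative by blast
    obtain A where A: "0 < A" "\<And>s. 0 \<le> s \<Longrightarrow> 0 \<le> excess A s" "\<And>B. \<exists>s>0. B < rho A s"
      using balanced_parameter[OF s] by blast
    interpret profile n b \<beta> "\<lambda>s. G (angle n s)" \<sigma> A
      by unfold_locales (fact A)+
    show "\<exists>u h. is_solution H u \<and> has_equivariant_form m \<omega> h u \<and>
            h 0 = 0 \<and> (h \<longlongrightarrow> pi) at_top \<and> (\<forall>r>0. 0 < h r \<and> h r < pi)"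
      by (rule equivariant_solution[where g = g and Gt = Gt, OF assms(1) n_def[symmetric] H Gt assms(5) b_g])
  qed simp
qed

end
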